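(* Let $X,\nu,R,M_p,M_p^*$ be as in the context, with $R\nabla$ closable in $L^p(X,\nu)$ for every $p\in(1,\infty)$, and let $g:X\to\mathbb{R}$ be a Borel function such that, for every $p>1$, $g\in W^{1,p}(X,\nu)$ and $Mg\,\|Mg\|^{-2}\in D(M_p^* )$. Let $\varphi\in W^{1,p}(X,\nu)$ for some $p>1$, and fix any $r\in\mathbb{R}$. There exists a unique $\psi\in L^1(X,\sigma_r^g)$ such that every sequence $(\varphi_n)\subset C_b^1(X)$ that converges to $\varphi$ in $W^{1,p}(X,\nu)$ also converges to $\psi$ in $L^1(X,\sigma_r^g)$. Setting $T\varphi:=\psi$ and $F_\varphi(s)=\int_{\{g\le s\}}\varphi\,d\nu$, we have $$F_\varphi'(r)=\int_X T\varphi(x)\,\sigma_r^g(dx).$$ Moreover: (i) for every $q\in[1,p)$, $(\varphi_n)$ converges to $\psi$ in $L^q(X,\sigma_r^g)$ (for every sequence $(\varphi_n)\subset C_b^1(X)$ that converges to $\varphi$ in $W^{1,p}(X,\nu)$) and $T\in\mathcal{L}(W^{1,p}(X,\nu),L^q(X,\sigma_r^g))$; (ii) for every $C_p$-quasicontinuous version $\varphi^*$ of $\varphi$, $T\varphi(x)=\varphi^*(x)$ for $\sigma_r^g$-a.e. $x\in X$. In particular, if $\varphi$ is continuous, then $T\varphi(x)=\varphi(x)$ for $\sigma_r^g$-a.e. $x\in X$; (iii) if $\varphi_1\in W^{1,p_1}(X,\nu)$, $\varphi_2\in W^{1,p_2}(X,\nu)$ and $1/p_1+1/p_2<1$, then $T(\varphi_1\varphi_2)=T(\varphi_1)T(\varphi_2)$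 as elements of $L^1(X,\sigma_r^g)$.
   Context: $X$ is a separable infinite-dimensional real Hilbert space with inner product $\langle\cdot,\cdot\rangle$ and norm $\|\cdot\|$, and $\nu$ is a non-degenerate Borel probability measure on $X$ (non-degenerate: not concentrated on any proper closed linear subspace). $C_b(X)$ is the space of bounded continuous real functions; $C_b^1(X)$ is the space of bounded continuously Fréchet differentiable $\varphi:X\to\mathbb{R}$ with bounded gradient $\nabla\varphi$. $R\in\mathcal{L}(X)$ is a bounded linear operator such that for every $p\in(1,\infty)$ the operator $\varphi\mapsto R\nabla\varphi$, with domain $C^1_b(X)\subset L^p(X,\nu)$ and values in $L^p(X,\nu;X)$, is closable. $M_p$ denotes its closure, $W^{1,p}(X,\nu)$ the domain of $M_p$, with norm $\|f\|_{W^{1,p}}=\|f\|_{L^p(X,\nu)}+\|M_pf\|_{L^p(X,\nu;X)}$. With $p'=p/(p-1)$, $M_p^*:D(M_p^* )\subset L^{p'}(X,\nu;X)\to L^{p'}(X,\nu)$ is the adjoint of $M_p$. One writes $M$, $M^*$ on $\bigcap_{p>1}W^{1,p}(X,\nu)$, $\bigcap_{p>1}D(M_p^* )$, where the operators do not depend on $p$. The condition on $Mg\,\|Mg\|^{-2}$ includes that it is defined $\nu$-a.e. The product $\varphi_1\varphi_2$ of $\varphi_i\in W^{1,p_i}(X,\nu)$ with $1/s:=1/p_1+1/p_2<1$ belongs to $W^{1,s}(X,\nu)$. For $r\in\mathbb{R}$, $\sigma_r^g$ is the unique finite nonnegative Borel measure on $X$ such that $\int_X\varphi\,d\sigma_r^g=\frac{d}{dr}\int_{\{g\le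 r\}}\varphi\,d\nu$ for every $\varphi\in C_b(X)$ (the derivatives and the measure exist whenever $R\nabla$ is closable in $L^p(X,\nu)$ for every $p\in(1,\infty)$ and $g:X\to\mathbb{R}$ is a Borel function such that $g\in W^{1,p}(X,\nu)$ and $Mg\,\|Mg\|^{-2}\in D(M_p^* )$ for every $p>1$). Capacity: for $O\subset X$ open, $C_p(O)=\inf\{\|f\|_{W^{1,p}(X,\nu)}: f\in W^{1,p}(X,\nu),\ f\ge \mathbf{1}_O\ \nu\text{-a.e.}\}$; for a Borel set $B$, $C_p(B)=\inf\{C_p(O): O\text{ open},\ O\supset B\}$. A function $f:X\to\mathbb{R}$ is $C_p$-quasicontinuous if for every $\varepsilon>0$ there is an open set $O$ with $C_p(O)<\varepsilon$ such that the restriction of $f$ to $X\setminus O$ is continuous. A version of an element of $W^{1,p}(X,\nu)$ is a function equal to it $\nu$-a.e.; every element of $W^{1,p}(X,\nu)$ has a $C_p$-quasicontinuous version. *)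

theory Defs
  imports "HOL-Probability.Probability"
begin

text \<open>
  Elements of \<open>L\<^sup>p\<close> spaces are represented by measurable functions; identification up to null sets
  is made explicit by \<open>AE\<close> wherever two classes are compared.
\<close>

definition Lp :: "'a measure \<Rightarrow> real \<Rightarrow> ('a \<Rightarrow> 'b::{banach, second_countable_topology}) set" where
  "Lp N p = {f \<in> borel_measurable N. integrable N (\<lambda>x. norm (f x) powr p)}"

definition Lp_norm :: "'a measure \<Rightarrow> real \<Rightarrow> ('a \<Rightarrow> 'b::{banach, second_countable_topology}) \<Rightarrow> real" where
  "Lp_norm N p f = (\<integral>x. norm (f x) powr p \<partial>N) powr (1 / p)"

definition Lp_tendsto :: "'a measure \<Rightarrow> real \<Rightarrow> (nat \<Rightarrow> 'a \<Rightarrow> 'b::{banach, second_countable_topology}) \<Rightarrow>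
    ('a \<Rightarrow> 'b) \<Rightarrow> bool" where
  "Lp_tendsto N p F f \<longleftrightarrow> (\<forall>n. F n \<in> Lp N p) \<and> f \<in> Lp N p \<and>
     (\<lambda>n. Lp_norm N p (\<lambda>x. F n x - f x)) \<longlonglongrightarrow> 0"

definition grad :: "('a::{real_inner, banach, polish_space} \<Rightarrow> real) \<Rightarrow> 'a \<Rightarrow> 'a" where
  "grad \<phi> x = (THE v. GDERIV \<phi> x :> v)"

text \<open>
  \<open>GDERIV\<close> is Frechet differentiability with the derivative represented by a vector; on a Hilbert
  space every Frechet derivative has this form, and continuity of the derivative is continuity
  of the gradient, by the Riesz isometry.
\<close>

definition Cb :: "('a::topological_space \<Rightarrow> real) set" where
  "Cb = {\<phi>. continuous_on UNIV \<phi> \<and> bounded (range \<phi>)}"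

definition Cb1 :: "('a::{real_inner, banach, polish_space} \<Rightarrow> real) set" where
  "Cb1 = {\<phi>. bounded (range \<phi>) \<and> (\<forall>x. GDERIV \<phi> x :> grad \<phi> x) \<and>
            continuous_on UNIV (grad \<phi>) \<and> bounded (range (grad \<phi>))}"

definition nondegenerate :: "'a::real_normed_vector measure \<Rightarrow> bool" where
  "nondegenerate \<nu> \<longleftrightarrow> (\<forall>S. subspace S \<and> closed S \<and> S \<noteq> UNIV \<longrightarrow> \<not> (AE x in \<nu>. x \<in> S))"

definition closable_grad :: "('a::{real_inner, banach, polish_space} \<Rightarrow> 'a) \<Rightarrow> 'a measure \<Rightarrow> real \<Rightarrow> bool" where
  "closable_grad R \<nu> p \<longleftrightarrow>
     (\<forall>\<phi> \<Phi>. (\<forall>n. \<phi> n \<in> Cb1) \<and> Lp_tendsto \<nu> p \<phi> (\<lambda>x. 0) \<and>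
        Lp_tendsto \<nu> p (\<lambda>n x. R (grad (\<phi> n) x)) \<Phi> \<longrightarrow> (AE x in \<nu>. \<Phi> x = 0))"

text \<open>The graph of \<open>M\<^sub>p\<close> is the closure of the graph of \<open>R\<nabla>\<close>.\<close>

definition M_graph :: "('a::{real_inner, banach, polish_space} \<Rightarrow> 'a) \<Rightarrow> 'a measure \<Rightarrow> real \<Rightarrow>
    (('a \<Rightarrow> real) \<times> ('a \<Rightarrow> 'a)) set" where
  "M_graph R \<nu> p = {(f, F). \<exists>\<phi>. (\<forall>n. \<phi> n \<in> Cb1) \<and> Lp_tendsto \<nu> p \<phi> f \<and>
        Lp_tendsto \<nu> p (\<lambda>n x. R (grad (\<phi> n) x)) F}"

definition W1p :: "('a::{real_inner, banach, polish_space} \<Rightarrow> 'a) \<Rightarrow> 'a measure \<Rightarrow> real \<Rightarrow> ('a \<Rightarrow> real) set" where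
  "W1p R \<nu> p = Domain (M_graph R \<nu> p)"

definition Mp :: "('a::{real_inner, banach, polish_space} \<Rightarrow> 'a) \<Rightarrow> 'a measure \<Rightarrow> real \<Rightarrow>
    ('a \<Rightarrow> real) \<Rightarrow> 'a \<Rightarrow> 'a" where
  "Mp R \<nu> p f = (SOME F. (f, F) \<in> M_graph R \<nu> p)"

text \<open>
  \<open>M\<close> on the intersection of all \<open>W\<^sup>1\<^sup>,\<^sup>p\<close>: a common representative of all the \<open>M\<^sub>p f\<close>.
\<close>

definition M_all :: "('a::{real_inner, banach, polish_space} \<Rightarrow> 'a) \<Rightarrow> 'a measure \<Rightarrow>
    ('a \<Rightarrow> real) \<Rightarrow> 'a \<Rightarrow> 'a" where
  "M_all R \<nu> f = (SOME F. \<forall>p>1. (f, F) \<in> M_graph R \<nu> p)"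

definition W1p_norm :: "('a::{real_inner, banach, polish_space} \<Rightarrow> 'a) \<Rightarrow> 'a measure \<Rightarrow> real \<Rightarrow>
    ('a \<Rightarrow> real) \<Rightarrow> real" where
  "W1p_norm R \<nu> p f = Lp_norm \<nu> p f + Lp_norm \<nu> p (Mp R \<nu> p f)"

definition W1p_tendsto :: "('a::{real_inner, banach, polish_space} \<Rightarrow> 'a) \<Rightarrow> 'a measure \<Rightarrow> real \<Rightarrow>
    (nat \<Rightarrow> 'a \<Rightarrow> real) \<Rightarrow> ('a \<Rightarrow> real) \<Rightarrow> bool" where
  "W1p_tendsto R \<nu> p F f \<longleftrightarrow> (\<forall>n. F n \<in> W1p R \<nu> p) \<and> f \<in> W1p R \<nu> p \<and>
     (\<lambda>n. W1p_norm R \<nu> p (\<lambda>x. F n x - f x)) \<longlonglongrightarrow> 0"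

text \<open>
  Domain of the adjoint of \<open>M\<^sub>p\<close>, with the duals of the \<open>L\<^sup>p\<close> spaces identified with
  \<open>L\<^sup>q\<close>, \<open>q = p / (p - 1)\<close>; the function \<open>h\<close> below is the value of the adjoint at \<open>\<Phi>\<close>.
\<close>

definition dom_Mp_adjoint :: "('a::{real_inner, banach, polish_space} \<Rightarrow> 'a) \<Rightarrow> 'a measure \<Rightarrow> real \<Rightarrow>
    ('a \<Rightarrow> 'a) set" where
  "dom_Mp_adjoint R \<nu> p = {\<Phi> \<in> Lp \<nu> (p / (p - 1)). \<exists>h \<in> Lp \<nu> (p / (p - 1)).
      \<forall>f \<in> W1p R \<nu> p. (\<integral>x. Mp R \<nu> p f x \<bullet> \<Phi> x \<partial>\<nu>) = (\<integral>x. f x * h x \<partial>\<nu>)}"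

text \<open>
  The property that characterises \<open>\<sigma>\<^sub>r\<^sup>g\<close>. At most one measure has it, since a finite Borel measure
  on a metric space is determined by its integrals of bounded continuous functions.
\<close>

definition is_surface_measure :: "'a::polish_space measure \<Rightarrow> ('a \<Rightarrow> real) \<Rightarrow> real \<Rightarrow> 'a measure \<Rightarrow> bool" where
  "is_surface_measure \<nu> g r \<sigma> \<longleftrightarrow> finite_measure \<sigma> \<and> sets \<sigma> = sets borel \<and>
     (\<forall>\<phi>\<in>Cb. ((\<lambda>s. LINT x:{x. g x \<le> s}|\<nu>. \<phi> x) has_real_derivative (\<integral>x. \<phi> x \<partial>\<sigma>)) (at r))"

text \<open>Capacity of an open set; quasicontinuity involves no other sets.\<close>

definition capacity_open :: "('a::{real_inner, banach, polish_space} \<Rightarrow> 'a) \<Rightarrow> 'a measure \<Rightarrow> real \<Rightarrow>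
    'a set \<Rightarrow> real" where
  "capacity_open R \<nu> p U =
     Inf {W1p_norm R \<nu> p f | f. f \<in> W1p R \<nu> p \<and> (AE x in \<nu>. indicator U x \<le> f x)}"

definition quasicontinuous :: "('a::{real_inner, banach, polish_space} \<Rightarrow> 'a) \<Rightarrow> 'a measure \<Rightarrow> real \<Rightarrow>
    ('a \<Rightarrow> real) \<Rightarrow> bool" where
  "quasicontinuous R \<nu> p f \<longleftrightarrow>
     (\<forall>\<epsilon>>0. \<exists>U. open U \<and> capacity_open R \<nu> p U < \<epsilon> \<and> continuous_on (- U) f)"

definition is_trace :: "('a::{real_inner, banach, polish_space} \<Rightarrow> 'a) \<Rightarrow> 'a measure \<Rightarrow> 'a measure \<Rightarrow> real \<Rightarrow>
    ('a \<Rightarrow> real) \<Rightarrow> ('a \<Rightarrow> real) \<Rightarrow> bool" where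
  "is_trace R \<nu> \<sigma> p \<phi> \<psi> \<longleftrightarrow> \<psi> \<in> Lp \<sigma> 1 \<and>
     (\<forall>\<phi>n. (\<forall>n. \<phi>n n \<in> Cb1) \<and> W1p_tendsto R \<nu> p \<phi>n \<phi> \<longrightarrow> Lp_tendsto \<sigma> 1 \<phi>n \<psi>)"

definition trace_op :: "('a::{real_inner, banach, polish_space} \<Rightarrow> 'a) \<Rightarrow> 'a measure \<Rightarrow> 'a measure \<Rightarrow> real \<Rightarrow>
    ('a \<Rightarrow> real) \<Rightarrow> 'a \<Rightarrow> real" where
  "trace_op R \<nu> \<sigma> p \<phi> = (SOME \<psi>. is_trace R \<nu> \<sigma> p \<phi> \<psi>)"

text \<open>
  \<open>T \<in> \<L>(W\<^sup>1\<^sup>,\<^sup>p(X,\<nu>), L\<^sup>q(X,\<sigma>))\<close>. Compatibility with equality \<open>\<nu>\<close>-a.e. follows from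
  linearity and the bound.
\<close>

definition bounded_operator_W1p_Lq :: "('a::{real_inner, banach, polish_space} \<Rightarrow> 'a) \<Rightarrow> 'a measure \<Rightarrow> real \<Rightarrow>
    'a measure \<Rightarrow> real \<Rightarrow> (('a \<Rightarrow> real) \<Rightarrow> 'a \<Rightarrow> real) \<Rightarrow> bool" where
  "bounded_operator_W1p_Lq R \<nu> p \<sigma> q T \<longleftrightarrow>
     (\<forall>f \<in> W1p R \<nu> p. T f \<in> Lp \<sigma> q) \<and>
     (\<forall>f \<in> W1p R \<nu> p. \<forall>h \<in> W1p R \<nu> p. AE x in \<sigma>. T (\<lambda>y. f y + h y) x = T f x + T h x) \<and>
     (\<forall>c. \<forall>f \<in> W1p R \<nu> p. AE x in \<sigma>. T (\<lambda>y. c * f y) x = c * T f x) \<and>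
     (\<exists>C. \<forall>f \<in> W1p R \<nu> p. Lp_norm \<sigma> q (T f) \<le> C * W1p_norm R \<nu> p f)"

end

theory Submission
  imports Defs
begin

text \<open>
  Let \<open>\<Psi> = Mg / \<parallel>Mg\<parallel>\<^sup>2\<close>, so that \<open>\<langle>Mg, \<Psi>\<rangle> = 1\<close> almost everywhere. Everything rests on one
  inequality for the mass that \<open>\<nu>\<close> gives to a thin layer \<open>{a < g \<le> b}\<close>. Choose \<open>\<theta>\<close> with
  \<open>\<theta>' \<ge> 0\<close> everywhere, \<open>\<theta>' \<ge> 1\<close> on \<open>[a, b]\<close> and \<open>\<bar>\<theta>\<bar> \<le> \<pi> (b - a)\<close>. For a smooth \<open>u \<ge> 0\<close> the
  product rule \<open>M(\<theta>(g) u) = \<theta>'(g) u Mg + \<theta>(g) R\<nabla>u\<close> and the definition of the adjoint give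
  \<open>\<integral>\<^bsub>a<g\<le>b\<^esub> u d\<nu> \<le> \<integral> \<theta>'(g) u \<langle>Mg, \<Psi>\<rangle> d\<nu> = \<integral> \<theta>(g) (u M\<^sup>*\<Psi> - \<langle>R\<nabla>u, \<Psi>\<rangle>) d\<nu>
  \<le> \<pi> (b - a) \<integral> (u \<bar>M\<^sup>*\<Psi>\<bar> + \<parallel>R\<nabla>u\<parallel> \<parallel>\<Psi>\<parallel>) d\<nu>\<close>; this is \<open>layer_by_parts\<close>.

  Now let \<open>1 \<le> q < p\<close> and let \<open>h\<close> be smooth. Insert \<open>u = (1 + h\<^sup>2)\<^bsup>q/2\<^esup> \<ge> \<bar>h\<bar>\<^sup>q\<close>. Since \<open>\<Psi>\<close> and
  \<open>M\<^sup>*\<Psi>\<close> lie in \<open>L\<^bsup>p/(p-q)\<^esup>\<close>, Young's inequality bounds the last integral by a constant as soon as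
  \<open>\<integral> \<bar>h\<bar>\<^sup>p + \<parallel>R\<nabla>h\<parallel>\<^sup>p d\<nu> \<le> 1\<close>, and by scaling the layer carries a mass of \<open>\<bar>h\<bar>\<^sup>q\<close> of at most
  \<open>K c\<^sup>q (b - a)\<close> if that integral is at most \<open>c\<^sup>p\<close> (\<open>layer_estimate\<close>). Division by \<open>b - a\<close> and
  passage to the limit turn this into \<open>\<integral> \<bar>h\<bar>\<^sup>q d\<sigma> \<le> K c\<^sup>q\<close> (\<open>surface_estimate\<close>).

  The claims follow from these two estimates. Smooth sequences that converge in \<open>W\<^sup>1\<^sup>,\<^sup>p\<close> are Cauchy
  in every \<open>L\<^sup>q(\<sigma>)\<close> with \<open>q < p\<close>, and two sequences with the same limit become arbitrarily close
  there, which gives the trace, its independence of \<open>q\<close> and its boundedness (\<open>trace_exists\<close>,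
  \<open>trace_op_bound\<close>). The layer estimate with \<open>q = 1\<close> survives the passage to \<open>W\<^sup>1\<^sup>,\<^sup>p\<close>, so the
  difference quotients of \<open>F\<^sub>\<phi>\<close> are uniform limits of those of smooth functions and the derivative
  formula, which for smooth functions is the definition of \<open>\<sigma>\<close>, carries over
  (\<open>level_derivative_W1p\<close>). It also bounds \<open>\<sigma>(G)\<close>, for open \<open>G\<close>, by a multiple of the Sobolev norm
  of any function that is at least 1 on \<open>G\<close>. If \<open>u\<close> is a quasicontinuous version of \<open>\<phi>\<close>, then up to
  a set of small capacity \<open>{\<bar>u - h\<bar> > \<kappa>}\<close> is open for smooth \<open>h\<close>, and \<open>\<bar>\<phi> - h\<bar> / \<kappa>\<close> is at least 1 on
  it; hence smooth functions that approximate \<open>\<phi>\<close> converge to \<open>u\<close> in \<open>\<sigma>\<close>-measure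
  (\<open>trace_op_quasicontinuous\<close>). Multiplicativity holds along sequences that converge almost
  everywhere (\<open>trace_op_mult\<close>).
\<close>

section \<open>Lebesgue spaces\<close>

text \<open>
  The \<open>p\<close>-th power of \<open>Lp_norm\<close>. It tends to 0 together with the norm, it is an integral and so fits
  the convergence theorems directly, and it satisfies a triangle inequality with the factor
  \<open>2 powr p\<close>, which is enough for every limit below.
\<close>

definition Lp_mass :: "'a measure \<Rightarrow> real \<Rightarrow> ('a \<Rightarrow> 'b::{banach, second_countable_topology}) \<Rightarrow> real" where
  "Lp_mass N p f = (\<integral>x. norm (f x) powr p \<partial>N)"

lemma norm_add_powr_le:
  fixes a b :: "'b::real_normed_vector"
  assumes "0 < p"
  shows "norm (a + b) powr p \<le> 2 powr p * (norm a powr p + norm b powr p)"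
proof -
  have "norm (a + b) powr p \<le> (2 * max (norm a) (norm b)) powr p"
    using norm_triangle_ineq[of a b] assms by (intro powr_mono2) auto
  also have "\<dots> = 2 powr p * max (norm a) (norm b) powr p"
    by (simp add: powr_mult)
  also have "max (norm a) (norm b) powr p \<le> norm a powr p + norm b powr p"
    by (auto simp: max_def)
  finally show ?thesis by simp
qed

text \<open>
  Young's inequality for \<open>a\<^sup>s\<close> and \<open>b\<^sup>s\<close>, whose conjugate exponents are \<open>p1 / s\<close> and \<open>p2 / s\<close>; the
  weights \<open>s / p1\<close> and \<open>s / p2\<close> are below 1 and are dropped.
\<close>

lemma mult_powr_le_Young:
  fixes a b :: real
  assumes "0 \<le> a" "0 \<le> b" "0 < s" "0 < p1" "0 < p2" "1 / p1 + 1 / p2 = 1 / s"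
  shows "(a * b) powr s \<le> a powr p1 + b powr p2"
proof -
  have lt: "1 / p1 < 1 / s" "1 / p2 < 1 / s" using assms by (smt (verit) divide_pos_pos)+
  have s: "s < p1" "s < p2" using lt assms by (auto simp: field_simps)
  have "s * (1 / p1 + 1 / p2) = 1" using assms by simp
  then have "1 / (p1 / s) + 1 / (p2 / s) = 1" by (simp add: distrib_left)
  then have "a powr s * b powr s \<le> (a powr s) powr (p1 / s) / (p1 / s) + (b powr s) powr (p2 / s) / (p2 / s)"
    using s assms by (intro Youngs_inequality) auto
  also have "\<dots> = a powr p1 * (s / p1) + b powr p2 * (s / p2)"
    using assms by (simp add: powr_powr)
  also have "\<dots> \<le> a powr p1 * 1 + b powr p2 * 1"
    using s assms by (intro add_mono mult_left_mono) auto
  finally show ?thesis using assms by (simp add: powr_mult)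
qed

lemma Lp_measurable [measurable_dest]: "f \<in> Lp N p \<Longrightarrow> f \<in> borel_measurable N"
  by (simp add: Lp_def)

lemma Lp_integrable: "f \<in> Lp N p \<Longrightarrow> integrable N (\<lambda>x. norm (f x) powr p)"
  by (simp add: Lp_def)

lemma Lp_mass_nonneg [simp]: "0 \<le> Lp_mass N p f"
  unfolding Lp_mass_def by (rule integral_nonneg_AE) simp

lemma Lp_mass_zero [simp]: "Lp_mass N p (\<lambda>x. 0) = 0"
  by (simp add: Lp_mass_def)

lemma Lp_dominated:
  assumes "f \<in> borel_measurable N" "integrable N w" "AE x in N. norm (f x) powr p \<le> w x"
  shows "f \<in> Lp N p" "Lp_mass N p f \<le> integral\<^sup>L N w"
proof -
  note [measurable] = assms(1)
  have "integrable N (\<lambda>x. norm (f x) powr p)"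
    by (rule Bochner_Integration.integrable_bound[OF assms(2)]) (use assms(3) in auto)
  then show "f \<in> Lp N p" "Lp_mass N p f \<le> integral\<^sup>L N w"
    using assms by (auto simp: Lp_def Lp_mass_def intro!: integral_mono_AE)
qed

lemma Lp_add:
  assumes "0 < p" "f \<in> Lp N p" "h \<in> Lp N p"
  shows "(\<lambda>x. f x + h x) \<in> Lp N p"
    and "Lp_mass N p (\<lambda>x. f x + h x) \<le> 2 powr p * (Lp_mass N p f + Lp_mass N p h)"
proof -
  note [measurable] = Lp_measurable[OF assms(2)] Lp_measurable[OF assms(3)]
  note [simp] = Lp_integrable[OF assms(2)] Lp_integrable[OF assms(3)]
  have i: "integrable N (\<lambda>x. 2 powr p * (norm (f x) powr p + norm (h x) powr p))" by auto
  note d = Lp_dominated[OF _ i, of "\<lambda>x. f x + h x"]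
  show "(\<lambda>x. f x + h x) \<in> Lp N p" by (rule d) (auto intro: norm_add_powr_le assms)
  have "Lp_mass N p (\<lambda>x. f x + h x) \<le> (\<integral>x. 2 powr p * (norm (f x) powr p + norm (h x) powr p) \<partial>N)"
    by (rule d) (auto intro: norm_add_powr_le assms)
  then show "Lp_mass N p (\<lambda>x. f x + h x) \<le> 2 powr p * (Lp_mass N p f + Lp_mass N p h)"
    by (simp add: Lp_mass_def)
qed

lemma Lp_scaleR:
  assumes "f \<in> Lp N p"
  shows "(\<lambda>x. c *\<^sub>R f x) \<in> Lp N p"
    and "Lp_mass N p (\<lambda>x. c *\<^sub>R f x) = \<bar>c\<bar> powr p * Lp_mass N p f"
  using assms by (auto simp: Lp_def Lp_mass_def powr_mult)

lemma Lp_diff: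
  assumes "0 < p" "f \<in> Lp N p" "h \<in> Lp N p"
  shows "(\<lambda>x. f x - h x) \<in> Lp N p"
    and "Lp_mass N p (\<lambda>x. f x - h x) \<le> 2 powr p * (Lp_mass N p f + Lp_mass N p h)"
  using Lp_add[OF assms(1,2) Lp_scaleR(1)[OF assms(3), of "-1"]] Lp_scaleR(2)[OF assms(3), of "-1"] by auto

lemma (in finite_measure) Lp_bounded:
  assumes "f \<in> borel_measurable M" "\<And>x. norm (f x) \<le> B" "0 \<le> p"
  shows "f \<in> Lp M p"
  by (rule Lp_dominated(1)[of _ _ "\<lambda>x. B powr p"]) (use assms in \<open>auto intro!: powr_mono2\<close>)

lemma Lp_cong_AE:
  assumes "f \<in> Lp N p" "h \<in> borel_measurable N" "AE x in N. f x = h x"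
  shows "h \<in> Lp N p"
  by (rule Lp_dominated(1)[OF assms(2) Lp_integrable[OF assms(1)]]) (use assms(3) in auto)

lemma Lp_mass_cong_AE:
  assumes "f \<in> borel_measurable N" "h \<in> borel_measurable N" "AE x in N. f x = h x"
  shows "Lp_mass N p f = Lp_mass N p h"
  unfolding Lp_mass_def by (rule integral_cong_AE) (use assms in auto)

lemma Lp_1_integrable:
  assumes "f \<in> Lp N 1" shows "integrable N f"
  using assms integrable_norm_iff[of f N] by (simp add: Lp_def)

lemma Lp_mass_zero_AE:
  assumes "f \<in> Lp N p" "Lp_mass N p f = 0"
  shows "AE x in N. f x = 0"
  using integral_nonneg_eq_0_iff_AE[OF Lp_integrable[OF assms(1)]] assms(2) by (auto simp: Lp_mass_def)

lemma Lp_tendsto_iff: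
  assumes "0 < p"
  shows "Lp_tendsto N p F f \<longleftrightarrow> (\<forall>n. F n \<in> Lp N p) \<and> f \<in> Lp N p \<and>
    (\<lambda>n. Lp_mass N p (\<lambda>x. F n x - f x)) \<longlonglongrightarrow> 0"
proof -
  have "((\<lambda>n. u n powr (1 / p)) \<longlonglongrightarrow> 0) = (u \<longlonglongrightarrow> 0)" if "\<And>n. 0 \<le> u n" for u :: "nat \<Rightarrow> real"
  proof
    assume "u \<longlonglongrightarrow> 0"
    then have "(\<lambda>n. u n powr (1 / p)) \<longlonglongrightarrow> 0 powr (1 / p)"
      by (rule tendsto_powr2) (use that assms in auto)
    then show "(\<lambda>n. u n powr (1 / p)) \<longlonglongrightarrow> 0" by simp
  next
    assume "(\<lambda>n. u n powr (1 / p)) \<longlonglongrightarrow> 0"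
    then have "(\<lambda>n. (u n powr (1 / p)) powr p) \<longlonglongrightarrow> 0 powr p"
      by (rule tendsto_powr2) (use that assms in auto)
    then show "u \<longlonglongrightarrow> 0" using that assms by (simp add: powr_powr)
  qed
  from this[of "\<lambda>n. Lp_mass N p (\<lambda>x. F n x - f x)"] show ?thesis
    unfolding Lp_tendsto_def Lp_norm_def Lp_mass_def[symmetric] by simp
qed

lemma Lp_tendsto_AE_subseq:
  assumes "0 < p" "Lp_tendsto N p F f"
  shows "\<exists>k. strict_mono k \<and> (AE x in N. (\<lambda>n. F (k n) x) \<longlonglongrightarrow> f x)"
proof -
  note c = assms(2)[unfolded Lp_tendsto_iff[OF assms(1)]]
  have d: "(\<lambda>x. F n x - f x) \<in> Lp N p" for n using c assms Lp_diff by blast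
  have "\<exists>k. strict_mono k \<and> (AE x in N. (\<lambda>n. norm (F (k n) x - f x) powr p) \<longlonglongrightarrow> 0)"
    by (rule tendsto_L1_AE_subseq) (use c Lp_integrable[OF d] in \<open>auto simp: Lp_mass_def\<close>)
  then obtain k where k: "strict_mono k" "AE x in N. (\<lambda>n. norm (F (k n) x - f x) powr p) \<longlonglongrightarrow> 0" by auto
  have "(\<lambda>n. F (k n) x) \<longlonglongrightarrow> f x" if "(\<lambda>n. norm (F (k n) x - f x) powr p) \<longlonglongrightarrow> 0" for x
  proof -
    have "(\<lambda>n. (norm (F (k n) x - f x) powr p) powr (1/p)) \<longlonglongrightarrow> 0 powr (1/p)"
      by (rule tendsto_powr2[OF that]) (use assms in auto)
    then have "(\<lambda>n. norm (F (k n) x - f x)) \<longlonglongrightarrow> 0" using assms by (simp add: powr_powr)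
    then show ?thesis using LIM_zero_cancel tendsto_norm_zero_iff by blast
  qed
  then show ?thesis using k by (intro exI[of _ k]) auto
qed

text \<open>
  The additive form of Hoelder's inequality, obtained by integrating Young's inequality pointwise.
  Applied to \<open>c A\<close> and \<open>B / c\<close> it yields the limit statement that follows.
\<close>

lemma Lp_Hoelder_member:
  assumes e: "0 < s" "0 < p1" "0 < p2" "1 / p1 + 1 / p2 = 1 / s"
    and "A \<in> Lp N p1" "B \<in> Lp N p2" "H \<in> borel_measurable N"
    and "AE x in N. norm (H x) \<le> norm (A x) * norm (B x)"
  shows "H \<in> Lp N s" "Lp_mass N s H \<le> Lp_mass N p1 A + Lp_mass N p2 B"
proof -
  have i: "integrable N (\<lambda>x. norm (A x) powr p1 + norm (B x) powr p2)"
    using assms by (auto dest: Lp_integrable)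
  have ae: "AE x in N. norm (H x) powr s \<le> norm (A x) powr p1 + norm (B x) powr p2"
    using assms(8)
  proof eventually_elim
    case (elim x)
    then have "norm (H x) powr s \<le> (norm (A x) * norm (B x)) powr s" using e by (intro powr_mono2) auto
    also have "\<dots> \<le> norm (A x) powr p1 + norm (B x) powr p2"
      using e by (intro mult_powr_le_Young) auto
    finally show ?case .
  qed
  show "H \<in> Lp N s" "Lp_mass N s H \<le> Lp_mass N p1 A + Lp_mass N p2 B"
    using Lp_dominated[OF assms(7) i ae] Lp_integrable[OF assms(5)] Lp_integrable[OF assms(6)]
    by (auto simp: Lp_mass_def)
qed

lemma Lp_Hoelder_tendsto_0:
  assumes e: "0 < s" "0 < p1" "0 < p2" "1 / p1 + 1 / p2 = 1 / s"
    and A: "\<And>n. A n \<in> Lp N p1" "Bseq (\<lambda>n. Lp_mass N p1 (A n))"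
    and B: "\<And>n. B n \<in> Lp N p2" "(\<lambda>n. Lp_mass N p2 (B n)) \<longlonglongrightarrow> 0"
    and H: "\<And>n. H n \<in> borel_measurable N"
      "\<And>n. AE x in N. norm (H n x) \<le> norm (A n x) * norm (B n x)"
  shows "(\<lambda>n. Lp_mass N s (H n)) \<longlonglongrightarrow> 0"
proof (rule LIMSEQ_I)
  fix \<epsilon> :: real assume "0 < \<epsilon>"
  obtain K where K: "0 < K" "\<And>n. Lp_mass N p1 (A n) \<le> K"
    using A(2) unfolding Bseq_def by (auto dest: abs_le_D1)
  \<comment> \<open>The weight c makes the contribution of A equal to \<open>\<epsilon> / 2\<close>; that of B then vanishes in the limit.\<close>
  define c where "c = (\<epsilon> / (2 * K)) powr (1 / p1)"
  have c: "0 < c" "c powr p1 * K = \<epsilon> / 2"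
    using \<open>0 < \<epsilon>\<close> K e by (auto simp: c_def powr_powr)
  have "(\<lambda>n. (1 / c) powr p2 * Lp_mass N p2 (B n)) \<longlonglongrightarrow> 0"
    using tendsto_mult_right_zero[OF B(2)] .
  from LIMSEQ_D[OF this, of "\<epsilon> / 2"] \<open>0 < \<epsilon>\<close>
  obtain n0 where n0: "\<And>n. n \<ge> n0 \<Longrightarrow> (1 / c) powr p2 * Lp_mass N p2 (B n) < \<epsilon> / 2" by fastforce
  have "norm (Lp_mass N s (H n) - 0) < \<epsilon>" if "n \<ge> n0" for n
  proof -
    have "Lp_mass N s (H n) \<le> Lp_mass N p1 (\<lambda>x. c *\<^sub>R A n x) + Lp_mass N p2 (\<lambda>x. (1 / c) *\<^sub>R B n x)"
      by (rule Lp_Hoelder_member(2)[OF e]) (use H c Lp_scaleR(1)[OF A(1)] Lp_scaleR(1)[OF B(1)] in auto)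
    also have "\<dots> = c powr p1 * Lp_mass N p1 (A n) + (1 / c) powr p2 * Lp_mass N p2 (B n)"
      using Lp_scaleR(2)[OF A(1)] Lp_scaleR(2)[OF B(1)] c by simp
    also have "\<dots> \<le> c powr p1 * K + (1 / c) powr p2 * Lp_mass N p2 (B n)"
      using K by (intro add_mono mult_left_mono) auto
    also have "\<dots> < \<epsilon>" using c n0[OF that] by simp
    finally show ?thesis by simp
  qed
  then show "\<exists>n0. \<forall>n\<ge>n0. norm (Lp_mass N s (H n) - 0) < \<epsilon>" by blast
qed

lemma Lp_tendsto_Bseq:
  assumes "0 < p" "Lp_tendsto N p F f"
  shows "Bseq (\<lambda>n. Lp_mass N p (F n))"
proof -
  note c = assms(2)[unfolded Lp_tendsto_iff[OF assms(1)]]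
  from convergent_imp_Bseq[OF convergentI] c
  have "Bseq (\<lambda>n. Lp_mass N p (\<lambda>x. F n x - f x))" by blast
  then obtain K where K: "\<And>n. Lp_mass N p (\<lambda>x. F n x - f x) \<le> K"
    unfolding Bseq_def by (auto dest: abs_le_D1)
  show ?thesis
  proof (rule BseqI')
    fix n
    have "Lp_mass N p (\<lambda>x. (F n x - f x) + f x) \<le> 2 powr p * (Lp_mass N p (\<lambda>x. F n x - f x) + Lp_mass N p f)"
      using Lp_diff c assms by (intro Lp_add) blast+
    also have "\<dots> \<le> 2 powr p * (K + Lp_mass N p f)"
      using K by (intro mult_left_mono add_mono) auto
    finally show "norm (Lp_mass N p (F n)) \<le> 2 powr p * (K + Lp_mass N p f)"
      by simp
  qed
qed

lemma Lp_tendsto_const: "f \<in> Lp N p \<Longrightarrow> 0 < p \<Longrightarrow> Lp_tendsto N p (\<lambda>n. f) f"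
  by (simp add: Lp_tendsto_iff)

lemma Lp_tendsto_add:
  assumes "0 < p" "Lp_tendsto N p F f" "Lp_tendsto N p G g"
  shows "Lp_tendsto N p (\<lambda>n x. F n x + G n x) (\<lambda>x. f x + g x)"
proof -
  note F = assms(2)[unfolded Lp_tendsto_iff[OF assms(1)]]
  note G = assms(3)[unfolded Lp_tendsto_iff[OF assms(1)]]
  have "(\<lambda>n. 2 powr p * (Lp_mass N p (\<lambda>x. F n x - f x) + Lp_mass N p (\<lambda>x. G n x - g x))) \<longlonglongrightarrow> 0"
    using tendsto_mult_right_zero[OF tendsto_add_zero] F G by blast
  moreover have "Lp_mass N p (\<lambda>x. (F n x + G n x) - (f x + g x)) \<le>
     2 powr p * (Lp_mass N p (\<lambda>x. F n x - f x) + Lp_mass N p (\<lambda>x. G n x - g x))" for n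
    using Lp_add(2)[OF assms(1) Lp_diff(1)[OF assms(1)] Lp_diff(1)[OF assms(1)], of "F n" N f "G n" g] F G
    by (simp add: add_diff_add)
  ultimately have "(\<lambda>n. Lp_mass N p (\<lambda>x. (F n x + G n x) - (f x + g x))) \<longlonglongrightarrow> 0"
    by (intro tendsto_0_le[where K=1 and g="\<lambda>n. Lp_mass N p (\<lambda>x. (F n x + G n x) - (f x + g x))"
        and f="\<lambda>n. 2 powr p * (Lp_mass N p (\<lambda>x. F n x - f x) + Lp_mass N p (\<lambda>x. G n x - g x))"])
       (auto simp: Lp_mass_nonneg intro!: always_eventually)
  then show ?thesis using F G by (auto simp: Lp_tendsto_iff[OF assms(1)] intro: Lp_add(1)[OF assms(1)])
qed

lemma Lp_tendsto_scaleR: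
  assumes "0 < p" "Lp_tendsto N p F f"
  shows "Lp_tendsto N p (\<lambda>n x. c *\<^sub>R F n x) (\<lambda>x. c *\<^sub>R f x)"
proof -
  note F = assms(2)[unfolded Lp_tendsto_iff[OF assms(1)]]
  have "Lp_mass N p (\<lambda>x. c *\<^sub>R F n x - c *\<^sub>R f x) = \<bar>c\<bar> powr p * Lp_mass N p (\<lambda>x. F n x - f x)" for n
    using Lp_scaleR(2)[OF Lp_diff(1)[OF assms(1)], of "F n" N f c] F
    by (simp add: scaleR_diff_right)
  then show ?thesis using F
    by (auto simp: Lp_tendsto_iff[OF assms(1)] intro!: Lp_scaleR(1) tendsto_mult_right_zero)
qed

lemma Lp_tendsto_diff:
  assumes "0 < p" "Lp_tendsto N p F f" "Lp_tendsto N p G g"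
  shows "Lp_tendsto N p (\<lambda>n x. F n x - G n x) (\<lambda>x. f x - g x)"
  using Lp_tendsto_add[OF assms(1,2) Lp_tendsto_scaleR[OF assms(1,3), of "-1"]] by simp

lemma Lp_tendsto_cong_AE:
  assumes "0 < p" "Lp_tendsto N p F f" "h \<in> borel_measurable N" "AE x in N. f x = h x"
  shows "Lp_tendsto N p F h"
proof -
  note F = assms(2)[unfolded Lp_tendsto_iff[OF assms(1)]]
  have "Lp_mass N p (\<lambda>x. F n x - f x) = Lp_mass N p (\<lambda>x. F n x - h x)" for n
    using F assms by (intro Lp_mass_cong_AE borel_measurable_diff) (auto dest: Lp_measurable)
  then show ?thesis using F Lp_cong_AE[OF _ assms(3,4)] by (simp add: Lp_tendsto_iff[OF assms(1)])
qed

lemma Lp_tendsto_unique: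
  assumes "0 < p" "Lp_tendsto N p F f" "Lp_tendsto N p F h"
  shows "AE x in N. f x = h x"
proof -
  have "Lp_tendsto N p (\<lambda>n x. 0) (\<lambda>x. f x - h x)" using Lp_tendsto_diff[OF assms] by simp
  then have "(\<lambda>x. f x - h x) \<in> Lp N p" "Lp_mass N p (\<lambda>x. h x - f x) = 0"
    by (auto simp: Lp_tendsto_iff[OF assms(1)] LIMSEQ_const_iff)
  moreover have "Lp_mass N p (\<lambda>x. h x - f x) = Lp_mass N p (\<lambda>x. f x - h x)"
    by (simp add: Lp_mass_def norm_minus_commute)
  ultimately have "(\<lambda>x. f x - h x) \<in> Lp N p" "Lp_mass N p (\<lambda>x. f x - h x) = 0" by simp_all
  from Lp_mass_zero_AE[OF this] show ?thesis by auto
qed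

lemma Lp_tendsto_subseq:
  assumes "Lp_tendsto N p F f" "strict_mono k"
  shows "Lp_tendsto N p (\<lambda>n. F (k n)) f"
  using assms LIMSEQ_subseq_LIMSEQ[of "\<lambda>n. Lp_norm N p (\<lambda>x. F n x - f x)"]
  by (auto simp: Lp_tendsto_def o_def)

text \<open>
  Splitting \<open>A\<^sub>n B\<^sub>n - a b = A\<^sub>n (B\<^sub>n - b) + (A\<^sub>n - a) b\<close>, each summand is a bounded sequence times a
  null sequence.
\<close>

lemma Lp_tendsto_scaleR_Hoelder:
  assumes e: "0 < s" "0 < p1" "0 < p2" "1 / p1 + 1 / p2 = 1 / s"
    and A: "Lp_tendsto N p1 A a" and B: "Lp_tendsto N p2 B b"
  shows "Lp_tendsto N s (\<lambda>n x. A n x *\<^sub>R B n x) (\<lambda>x. a x *\<^sub>R b x)"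
proof -
  note A' = A[unfolded Lp_tendsto_iff[OF e(2)]]
  note B' = B[unfolded Lp_tendsto_iff[OF e(3)]]
  have [measurable]: "A n \<in> borel_measurable N" "B n \<in> borel_measurable N"
     "a \<in> borel_measurable N" "b \<in> borel_measurable N" for n
    using A' B' by (auto dest: Lp_measurable)
  have e': "1 / p2 + 1 / p1 = 1 / s" using e by simp
  have m: "(\<lambda>x. A n x *\<^sub>R B n x) \<in> Lp N s" "(\<lambda>x. a x *\<^sub>R b x) \<in> Lp N s" for n
    using A' B' by (auto intro: Lp_Hoelder_member[OF e, of "A n" N "B n"] Lp_Hoelder_member[OF e, of a N b])
  have 1: "(\<lambda>n. Lp_mass N s (\<lambda>x. A n x *\<^sub>R (B n x - b x))) \<longlonglongrightarrow> 0"
    by (rule Lp_Hoelder_tendsto_0[OF e, where A=A and B="\<lambda>n x. B n x - b x"])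
       (use A' B' Lp_diff(1)[OF e(3), of "B _" N b] Lp_tendsto_Bseq[OF e(2) A] in auto)
  have 2: "(\<lambda>n. Lp_mass N s (\<lambda>x. (A n x - a x) *\<^sub>R b x)) \<longlonglongrightarrow> 0"
    by (rule Lp_Hoelder_tendsto_0[OF e(1,3,2) e', where A="\<lambda>n. b" and B="\<lambda>n x. A n x - a x"])
       (use A' B' Lp_diff(1)[OF e(2), of "A _" N a] in auto)
  have m1: "(\<lambda>x. A n x *\<^sub>R (B n x - b x)) \<in> Lp N s" for n
    using A' B' Lp_diff(1)[OF e(3), of "B n" N b] by (intro Lp_Hoelder_member[OF e, where A="A n" and B="\<lambda>x. B n x - b x"]) auto
  have m2: "(\<lambda>x. (A n x - a x) *\<^sub>R b x) \<in> Lp N s" for n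
    using A' B' Lp_diff(1)[OF e(2), of "A n" N a] by (intro Lp_Hoelder_member[OF e, where A="\<lambda>x. A n x - a x" and B=b]) auto
  have z: "(\<lambda>x. 0) \<in> Lp N s" using e by (simp add: Lp_def)
  have "Lp_tendsto N s (\<lambda>n x. A n x *\<^sub>R (B n x - b x) + (A n x - a x) *\<^sub>R b x) (\<lambda>x. 0 + 0)"
    by (rule Lp_tendsto_add) (use e 1 2 m1 m2 z in \<open>auto simp: Lp_tendsto_iff\<close>)
  from Lp_tendsto_add[OF e(1) this Lp_tendsto_const[OF m(2) e(1)]]
  show ?thesis by (simp add: algebra_simps)
qed

text \<open>
  Hoelder against the constant function 1, which lies in every \<open>L\<^sup>t\<close> because the measure is finite.
\<close>

lemma (in finite_measure) Lp_tendsto_lower_exponent: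
  assumes "0 < s" "s \<le> p" "Lp_tendsto M p F f"
  shows "Lp_tendsto M s F f"
proof (cases "s = p")
  case False
  define t where "t = 1 / (1 / s - 1 / p)"
  have "s < p" using assms False by simp
  then have sp: "0 < 1 / s - 1 / p" using assms(1) frac_less2[of 1 1 s p] by simp
  have t: "0 < t" "1 / t + 1 / p = 1 / s" unfolding t_def using sp by simp_all
  have p: "0 < p" using assms by simp
  have "Lp_tendsto M t (\<lambda>n x. 1 :: real) (\<lambda>x. 1)"
    using t by (intro Lp_tendsto_const Lp_bounded[of _ 1]) auto
  from Lp_tendsto_scaleR_Hoelder[OF assms(1) t(1) p t(2) this assms(3)] show ?thesis by simp
qed (use assms in simp)

lemma Lp_tendsto_integral:
  assumes "Lp_tendsto N 1 F f"
  shows "(\<lambda>n. \<integral>x. F n x \<partial>N) \<longlonglongrightarrow> (\<integral>x. f x \<partial>N)"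
proof -
  have F: "\<And>n. F n \<in> Lp N 1" "f \<in> Lp N 1" "(\<lambda>n. Lp_mass N 1 (\<lambda>x. F n x - f x)) \<longlonglongrightarrow> 0"
    using assms by (simp_all add: Lp_tendsto_iff)
  have i: "integrable N (F n)" "integrable N f" for n 
    by (rule Lp_1_integrable[OF F(1)]) (rule Lp_1_integrable[OF F(2)])
  have b: "norm (integral\<^sup>L N (F n) - integral\<^sup>L N f) \<le> Lp_mass N 1 (\<lambda>x. F n x - f x)" for n
    unfolding Bochner_Integration.integral_diff[OF i, symmetric] Lp_mass_def
    by (rule order_trans[OF integral_norm_bound]) simp
  have "(\<lambda>n. integral\<^sup>L N (F n) - integral\<^sup>L N f) \<longlonglongrightarrow> 0"
    by (rule Lim_null_comparison[OF always_eventually[OF allI[OF b]] F(3)])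
  then show ?thesis by (rule LIM_zero_cancel)
qed

lemma (in finite_measure) Lp_imp_integrable:
  assumes "f \<in> Lp M t" "1 \<le> t"
  shows "integrable M f"
proof -
  have "Lp_tendsto M 1 (\<lambda>n. f) f"
    using assms by (intro Lp_tendsto_lower_exponent[OF _ assms(2)] Lp_tendsto_const) auto
  then show ?thesis by (auto simp: Lp_tendsto_def intro: Lp_1_integrable)
qed

text \<open>
  In the product rule for \<open>\<theta>(g) u\<close> the factor \<open>\<theta>'(f\<^sub>n) u\<close> varies with the approximation and converges
  only almost everywhere. It is bounded, though, so the strongly convergent factor may be replaced by
  its limit inside the pairing before the bounded one is dealt with.
\<close>

lemma Lp_pairing_tendsto:
  fixes \<Psi> f :: "'a \<Rightarrow> 'b::{real_inner, banach, second_countable_topology}"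
  assumes p: "1 < p" and \<Psi>: "\<Psi> \<in> Lp N (p / (p - 1))"
    and v: "\<And>n. v n \<in> borel_measurable N" "\<And>n x. \<bar>v n x\<bar> \<le> B"
    and F: "Lp_tendsto N p F f"
  shows "(\<lambda>n. (\<integral>x. v n x * (F n x \<bullet> \<Psi> x) \<partial>N) - (\<integral>x. v n x * (f x \<bullet> \<Psi> x) \<partial>N)) \<longlonglongrightarrow> 0"
    and "integrable N (\<lambda>x. v n x * (F n x \<bullet> \<Psi> x))" "integrable N (\<lambda>x. f x \<bullet> \<Psi> x)"
proof -
  define t where "t = p / (p - 1)"
  have e: "0 < (1::real)" "0 < t" "0 < p" "1 / t + 1 / p = 1 / 1"
    using p by (auto simp: t_def field_simps)
  have F': "\<And>n. F n \<in> Lp N p" "f \<in> Lp N p" "(\<lambda>n. Lp_mass N p (\<lambda>x. F n x - f x)) \<longlonglongrightarrow> 0"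
    using F e by (auto simp: Lp_tendsto_iff)
  have [measurable]: "\<Psi> \<in> borel_measurable N" "F n \<in> borel_measurable N" "f \<in> borel_measurable N"
    "v n \<in> borel_measurable N" for n
    using F' \<Psi> v by (auto intro: Lp_measurable)
  have B: "0 \<le> B" using v(2)[of 0 undefined] by linarith
  have \<Psi>': "(\<lambda>x. B *\<^sub>R \<Psi> x) \<in> Lp N t" using \<Psi> by (auto simp: t_def intro: Lp_scaleR)
  have ineq: "norm (v n x * (a \<bullet> \<Psi> x)) \<le> norm (B *\<^sub>R \<Psi> x) * norm a" for n x a
  proof -
    have "norm (v n x * (a \<bullet> \<Psi> x)) \<le> B * (norm a * norm (\<Psi> x))"
      using v(2)[of n x] B Cauchy_Schwarz_ineq2[of a "\<Psi> x"] by (auto simp: abs_mult intro!: mult_mono)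
    then show ?thesis using B by (simp add: mult_ac)
  qed
  have i: "integrable N (\<lambda>x. v n x * (h x \<bullet> \<Psi> x))" if h: "h \<in> Lp N p" for n and h :: "'a \<Rightarrow> 'b"
  proof -
    have [measurable]: "h \<in> borel_measurable N" using h by (rule Lp_measurable)
    show ?thesis
      by (rule Lp_1_integrable, rule Lp_Hoelder_member(1)[OF e \<Psi>' h])
        (use ineq in \<open>auto intro!: AE_I2\<close>)
  qed
  then show "integrable N (\<lambda>x. v n x * (F n x \<bullet> \<Psi> x))" using F' by blast
  have "(\<lambda>x. f x \<bullet> \<Psi> x) \<in> Lp N 1"
    by (rule Lp_Hoelder_member(1)[OF e, of \<Psi>]) (use F' \<Psi> Cauchy_Schwarz_ineq2[of "f _" "\<Psi> _"] in \<open>auto simp: t_def mult.commute\<close>)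
  then show "integrable N (\<lambda>x. f x \<bullet> \<Psi> x)" by (rule Lp_1_integrable)
  have l: "(\<lambda>n. Lp_mass N 1 (\<lambda>x. v n x * ((F n x - f x) \<bullet> \<Psi> x))) \<longlonglongrightarrow> 0"
    by (rule Lp_Hoelder_tendsto_0[OF e, where A="\<lambda>n x. B *\<^sub>R \<Psi> x" and B="\<lambda>n x. F n x - f x"])
       (use \<Psi>' F' Lp_diff(1)[OF e(3)] ineq in \<open>auto intro!: AE_I2\<close>)
  have "norm ((\<integral>x. v n x * (F n x \<bullet> \<Psi> x) \<partial>N) - (\<integral>x. v n x * (f x \<bullet> \<Psi> x) \<partial>N)) \<le>
      Lp_mass N 1 (\<lambda>x. v n x * ((F n x - f x) \<bullet> \<Psi> x))" for n
    unfolding Bochner_Integration.integral_diff[OF i[OF F'(1)] i[OF F'(2)], symmetric] Lp_mass_def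
    by (rule order_trans[OF integral_norm_bound]) (simp add: algebra_simps inner_diff_left)
  then show "(\<lambda>n. (\<integral>x. v n x * (F n x \<bullet> \<Psi> x) \<partial>N) - (\<integral>x. v n x * (f x \<bullet> \<Psi> x) \<partial>N)) \<longlonglongrightarrow> 0"
    by (intro Lim_null_comparison[OF always_eventually l]) auto
qed

text \<open>
  Used with one and the same almost everywhere limit for all exponents at once, which is how a limit
  found in \<open>L\<^sup>1\<close> is recognised as a limit in \<open>L\<^sup>q\<close>.
\<close>

lemma Lp_Fatou:
  assumes q: "0 < q" and u: "\<And>n. u n \<in> Lp N q" "v \<in> borel_measurable N"
    and ae: "AE x in N. (\<lambda>n. u n x) \<longlonglongrightarrow> v x"
    and B: "\<forall>\<^sub>F n in sequentially. Lp_mass N q (u n) \<le> B"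
  shows "v \<in> Lp N q" "Lp_mass N q v \<le> B"
proof -
  have [measurable]: "u n \<in> borel_measurable N" "v \<in> borel_measurable N" for n
    using u by (auto dest: Lp_measurable)
  obtain n where "Lp_mass N q (u n) \<le> B" using eventually_happens[OF B] by auto
  then have B0: "0 \<le> B" using Lp_mass_nonneg[where N=N and p=q and f="u n"] by linarith
  have "(\<integral>\<^sup>+ x. ennreal (norm (v x) powr q) \<partial>N) \<le> (\<integral>\<^sup>+ x. liminf (\<lambda>n. ennreal (norm (u n x) powr q)) \<partial>N)"
  proof (rule nn_integral_mono_AE)
    show "AE x in N. ennreal (norm (v x) powr q) \<le> liminf (\<lambda>n. ennreal (norm (u n x) powr q))"
      using ae
    proof eventually_elim
      case (elim x)
      have "(\<lambda>n. norm (u n x) powr q) \<longlonglongrightarrow> norm (v x) powr q"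
        by (rule tendsto_powr2) (use elim q in \<open>auto intro: tendsto_norm\<close>)
      then have "(\<lambda>n. ennreal (norm (u n x) powr q)) \<longlonglongrightarrow> ennreal (norm (v x) powr q)" by simp
      from lim_imp_Liminf[OF sequentially_bot this] show ?case by simp
    qed
  qed
  also have "\<dots> \<le> liminf (\<lambda>n. \<integral>\<^sup>+ x. ennreal (norm (u n x) powr q) \<partial>N)"
    by (rule nn_integral_liminf) auto
  also have "\<dots> \<le> liminf (\<lambda>n. ennreal B)"
  proof (rule Liminf_mono)
    show "\<forall>\<^sub>F n in sequentially. (\<integral>\<^sup>+ x. ennreal (norm (u n x) powr q) \<partial>N) \<le> ennreal B"
      using B by eventually_elim
        (simp add: Lp_mass_def nn_integral_eq_integral[OF Lp_integrable[OF u(1)]] ennreal_leI)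
  qed
  also have "\<dots> = ennreal B" by (simp add: Liminf_const)
  finally have le: "(\<integral>\<^sup>+ x. ennreal (norm (v x) powr q) \<partial>N) \<le> ennreal B" .
  have i: "integrable N (\<lambda>x. norm (v x) powr q)"
    by (rule integrableI_bounded) (use le B0 in \<open>auto simp: less_top[symmetric] top_unique\<close>)
  then show "v \<in> Lp N q" by (simp add: Lp_def)
  show "Lp_mass N q v \<le> B"
    using le B0 by (simp add: Lp_mass_def nn_integral_eq_integral[OF i])
qed

text \<open>
  The core of the Riesz-Fischer theorem: consecutive differences along a fast subsequence have
  summable \<open>L\<^sup>1\<close> masses, so the telescoping series converges absolutely almost everywhere.
\<close>

lemma Lp_Cauchy_AE_limit:
  fixes \<phi> :: "nat \<Rightarrow> 'a \<Rightarrow> real"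
  assumes m: "\<And>n. \<phi> n \<in> Lp N 1"
    and cau: "\<And>e. 0 < e \<Longrightarrow> \<exists>n0. \<forall>m\<ge>n0. \<forall>n\<ge>n0. Lp_mass N 1 (\<lambda>x. \<phi> m x - \<phi> n x) \<le> e"
  obtains s \<psi> where "filterlim s at_top sequentially" "\<psi> \<in> borel_measurable N"
    "AE x in N. (\<lambda>k. \<phi> (s k) x) \<longlonglongrightarrow> \<psi> x"
proof -
  have [measurable]: "\<phi> n \<in> borel_measurable N" for n using m by (rule Lp_measurable)
  have "\<forall>k. \<exists>n0. \<forall>m\<ge>n0. \<forall>n\<ge>n0. Lp_mass N 1 (\<lambda>x. \<phi> m x - \<phi> n x) \<le> (1/2) ^ k"
    using cau by simp
  then obtain t where t: "\<And>k m n. t k \<le> m \<Longrightarrow> t k \<le> n \<Longrightarrow> Lp_mass N 1 (\<lambda>x. \<phi> m x - \<phi> n x) \<le> (1/2) ^ k"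
    by metis
  \<comment> \<open>The sum makes s exceed all earlier thresholds, the summand k makes it tend to infinity.\<close>
  define s where "s k = (\<Sum>j\<le>k. t j) + k" for k
  have "t k \<le> (\<Sum>j\<le>k. t j)" for k by (intro member_le_sum) auto
  then have s: "t k \<le> s k" "t k \<le> s (Suc k)" "k \<le> s k" for k
    by (auto simp: s_def intro: trans_le_add1 le_SucI)
  have lim: "filterlim s at_top sequentially"
    using s(3) by (intro filterlim_at_top_mono[OF filterlim_ident] always_eventually) auto
  define d where "d = (\<lambda>k x. \<phi> (s (Suc k)) x - \<phi> (s k) x)"
  have [measurable]: "d k \<in> borel_measurable N" for k unfolding d_def by measurable
  have di: "integrable N (d k)" for k
    unfolding d_def using m by (intro Bochner_Integration.integrable_diff Lp_1_integrable)
  have d: "(\<integral>\<^sup>+x. ennreal \<bar>d k x\<bar> \<partial>N) \<le> ennreal ((1/2) ^ k)" for k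
  proof -
    have "(\<integral>\<^sup>+x. ennreal \<bar>d k x\<bar> \<partial>N) = ennreal (\<integral>x. \<bar>d k x\<bar> \<partial>N)"
      using di by (intro nn_integral_eq_integral) auto
    moreover have "(\<integral>x. \<bar>d k x\<bar> \<partial>N) \<le> (1/2) ^ k"
      using t[OF s(2) s(1)] by (simp add: Lp_mass_def d_def)
    ultimately show ?thesis by (simp add: ennreal_leI)
  qed
  have "(\<integral>\<^sup>+x. (\<Sum>k. ennreal \<bar>d k x\<bar>) \<partial>N) = (\<Sum>k. \<integral>\<^sup>+x. ennreal \<bar>d k x\<bar> \<partial>N)"
    by (rule nn_integral_suminf) auto
  also have "\<dots> \<le> (\<Sum>k. ennreal ((1/2) ^ k))" by (intro suminf_le d) auto
  also have "\<dots> = ennreal (\<Sum>k. (1/2) ^ k)" by (intro suminf_ennreal2) (auto intro: summable_geometric)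
  also have "\<dots> < \<infinity>" by simp
  finally have "AE x in N. (\<Sum>k. ennreal \<bar>d k x\<bar>) \<noteq> \<infinity>"
    by (intro nn_integral_PInf_AE) auto
  then have conv: "AE x in N. convergent (\<lambda>k. \<phi> (s k) x)"
  proof eventually_elim
    case (elim x)
    then have "summable (\<lambda>k. \<bar>d k x\<bar>)" by (intro summable_suminf_not_top) auto
    then have "summable (\<lambda>k. d k x)" by (rule summable_rabs_cancel)
    then have "convergent (\<lambda>n. (\<Sum>k<n. d k x) + \<phi> (s 0) x)"
      by (intro convergent_add convergent_const) (simp add: summable_iff_convergent)
    moreover have "(\<Sum>k<n. d k x) + \<phi> (s 0) x = \<phi> (s n) x" for n
      unfolding d_def using sum_lessThan_telescope[of "\<lambda>k. \<phi> (s k) x" n] by simp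
    ultimately show ?case by simp
  qed
  show ?thesis
  proof (rule that[OF lim, of "\<lambda>x. lim (\<lambda>k. \<phi> (s k) x)"])
    show "(\<lambda>x. lim (\<lambda>k. \<phi> (s k) x)) \<in> borel_measurable N" by measurable
    show "AE x in N. (\<lambda>k. \<phi> (s k) x) \<longlonglongrightarrow> lim (\<lambda>k. \<phi> (s k) x)"
      using conv by eventually_elim (simp add: convergent_LIMSEQ_iff)
  qed
qed

section \<open>Auxiliary facts of real analysis\<close>

text \<open>
  A scaled arctangent. A smooth function with this derivative bound on \<open>[a, b]\<close> and total variation
  proportional to \<open>b - a\<close> replaces the primitive of the indicator of \<open>[a, b]\<close>, at the price of the
  harmless constant \<open>\<pi>\<close>, and stays within the reach of the classical chain rule.
\<close>

lemma layer_cutoff: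
  fixes a b :: real
  assumes "a < b"
  obtains \<theta> \<theta>' where "\<And>t. (\<theta> has_real_derivative \<theta>' t) (at t)" "continuous_on UNIV \<theta>'"
    "\<And>t. \<bar>\<theta> t\<bar> \<le> pi * (b - a)" "\<And>t. 0 \<le> \<theta>' t" "\<And>t. \<theta>' t \<le> 2"
    "\<And>t. a \<le> t \<Longrightarrow> t \<le> b \<Longrightarrow> 1 \<le> \<theta>' t"
proof -
  have pos: "0 < 1 + y\<^sup>2" for y :: real by (simp add: add_pos_nonneg)
  define s where "s = (\<lambda>t. (t - a) / (b - a))"
  have ds: "(s has_real_derivative 1 / (b - a)) (at t)" for t
    unfolding s_def by (intro DERIV_cdivide) (auto intro!: derivative_eq_intros)
  have cs: "continuous_on UNIV s" unfolding s_def using assms by (intro continuous_intros) auto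
  show ?thesis
  proof (rule that)
    fix t
    have "((\<lambda>t. 2 * (b - a) * arctan (s t)) has_real_derivative
        2 * (b - a) * (inverse (1 + (s t)\<^sup>2) * (1 / (b - a)))) (at t)"
      by (intro DERIV_cmult DERIV_chain2[OF DERIV_arctan ds])
    moreover have "2 * c * (i * (1 / c)) = 2 * i" if "c \<noteq> 0" for c i :: real
      using that by simp
    from this[of "b - a"] have "2 * (b - a) * (inverse (1 + (s t)\<^sup>2) * (1 / (b - a))) = 2 / (1 + (s t)\<^sup>2)"
      using assms unfolding divide_inverse[of 2] by simp
    ultimately show "((\<lambda>t. 2 * (b - a) * arctan (s t)) has_real_derivative 2 / (1 + (s t)\<^sup>2)) (at t)"
      by simp
    have *: "\<bar>2 * c * y\<bar> \<le> pi * c" if "0 < c" "2 * \<bar>y\<bar> \<le> pi" for c y :: real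
      using mult_right_mono[OF that(2), of c] that(1) by (simp add: abs_mult mult_ac)
    show "\<bar>2 * (b - a) * arctan (s t)\<bar> \<le> pi * (b - a)"
      by (rule *) (use assms arctan_bounded[of "s t"] in \<open>auto simp: abs_le_iff\<close>)
    show "0 \<le> 2 / (1 + (s t)\<^sup>2)" using pos[of "s t"] by simp
    show "2 / (1 + (s t)\<^sup>2) \<le> 2" using pos[of "s t"] by (simp add: pos_divide_le_eq)
    show "1 \<le> 2 / (1 + (s t)\<^sup>2)" if "a \<le> t" "t \<le> b"
    proof -
      have "0 \<le> s t" "s t \<le> 1" using that assms by (auto simp: s_def divide_le_eq)
      then have "(s t)\<^sup>2 \<le> 1" by (intro power_le_one)
      then show ?thesis using pos[of "s t"] by (simp add: pos_le_divide_eq)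
    qed
  next
    show "continuous_on UNIV (\<lambda>t. 2 / (1 + (s t)\<^sup>2))"
      using pos by (intro continuous_intros cs ballI) (metis less_irrefl)
  qed
qed

text \<open>
  The two terms that arise when \<open>u = w\<^sup>q\<close> with \<open>w = (1 + y\<^sup>2)\<^bsup>1/2\<^esup>\<close> is inserted into the layer
  inequality, where \<open>d\<close> is the size of the gradient of \<open>y\<close> and \<open>z\<close> that of \<open>\<Psi>\<close> or \<open>M\<^sup>*\<Psi>\<close>. Young's
  inequality with the exponents \<open>p / q\<close> and \<open>p / (p - q)\<close> applies because \<open>w\<^bsup>q-1\<^esup> d\<close> is at most the
  \<open>q\<close>-th power of the larger of \<open>w\<close> and \<open>d\<close>.
\<close>

lemma regularised_power_bounds:
  fixes y d z q p t :: real
  assumes q: "1 \<le> q" "q < p" and t: "t = p / (p - q)" and nn: "0 \<le> d" "0 \<le> z"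
  defines "w \<equiv> sqrt (1 + y\<^sup>2)"
  shows "w powr q * z \<le> 2 powr p * (1 + \<bar>y\<bar> powr p) + z powr t"
    and "w powr (q - 1) * d * z \<le> 2 powr p * (1 + \<bar>y\<bar> powr p) + d powr p + z powr t"
proof -
  have e: "0 < (1::real)" "0 < p / q" "0 < t" "1 / (p / q) + 1 / t = 1 / 1"
    using q by (auto simp: t field_simps)
  have w1: "1 \<le> w" by (simp add: w_def)
  have wy: "w \<le> 1 + \<bar>y\<bar>"
    unfolding w_def by (rule real_le_lsqrt) (auto simp: power2_sum)
  have wp: "w powr p \<le> 2 powr p * (1 + \<bar>y\<bar> powr p)"
  proof -
    have "w powr p \<le> norm (1 + \<bar>y\<bar>) powr p" using w1 wy q by (intro powr_mono2) auto
    also have "\<dots> \<le> 2 powr p * (norm (1::real) powr p + norm \<bar>y\<bar> powr p)"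
      using q by (intro norm_add_powr_le) auto
    finally show ?thesis by simp
  qed
  have Y: "m powr q * z \<le> m powr p + z powr t" if "0 < m" for m
  proof -
    have "(m powr q * z) powr 1 \<le> (m powr q) powr (p / q) + z powr t"
      using nn by (intro mult_powr_le_Young e) auto
    then show ?thesis using q nn by (simp add: powr_powr)
  qed
  show "w powr q * z \<le> 2 powr p * (1 + \<bar>y\<bar> powr p) + z powr t"
    using Y[of w] w1 wp by linarith
  define m where "m = max w d"
  have m: "0 < m" "w \<le> m" "d \<le> m" using w1 by (auto simp: m_def)
  have "w powr (q - 1) * d \<le> m powr (q - 1) * m"
    using q m w1 nn by (intro mult_mono powr_mono2) auto
  also have "\<dots> = m powr q" using m by (simp add: powr_mult_base mult.commute)
  finally have "w powr (q - 1) * d * z \<le> m powr q * z" using nn by (intro mult_right_mono)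
  also have "\<dots> \<le> m powr p + z powr t" using Y m by simp
  also have "m powr p \<le> w powr p + d powr p" by (auto simp: m_def max_def)
  finally show "w powr (q - 1) * d * z \<le> 2 powr p * (1 + \<bar>y\<bar> powr p) + d powr p + z powr t"
    using wp by linarith
qed

text \<open>
  The power \<open>\<bar>y\<bar>\<^sup>q\<close> has a kink at 0 when \<open>q = 1\<close>; replacing \<open>\<bar>y\<bar>\<close> by \<open>(1 + y\<^sup>2)\<^bsup>1/2\<^esup>\<close> removes it, and
  the derivative is at most \<open>q\<close> times the \<open>(q - 1)\<close>-st power of this quantity.
\<close>

lemma regularised_power_derivative:
  fixes q :: real
  shows "((\<lambda>y. sqrt (1 + y\<^sup>2) powr q) has_real_derivative
      q * sqrt (1 + y\<^sup>2) powr (q - 1) * (y / sqrt (1 + y\<^sup>2))) (at y)"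
    and "continuous_on UNIV (\<lambda>y::real. q * sqrt (1 + y\<^sup>2) powr (q - 1) * (y / sqrt (1 + y\<^sup>2)))"
    and "1 \<le> q \<Longrightarrow> \<bar>q * sqrt (1 + y\<^sup>2) powr (q - 1) * (y / sqrt (1 + y\<^sup>2))\<bar> \<le> q * sqrt (1 + y\<^sup>2) powr (q - 1)"
proof -
  have pos: "0 < 1 + y\<^sup>2" "0 < sqrt (1 + y\<^sup>2)" for y :: real by (auto simp: add_pos_nonneg)
  have "((\<lambda>y. 1 + y\<^sup>2) has_real_derivative 2 * y) (at y)"
    by (auto intro!: derivative_eq_intros)
  then have "((\<lambda>y. sqrt (1 + y\<^sup>2)) has_real_derivative inverse (sqrt (1 + y\<^sup>2)) / 2 * (2 * y)) (at y)"
    by (rule DERIV_chain2[where f=sqrt and g="\<lambda>y. 1 + y\<^sup>2", OF DERIV_real_sqrt[OF pos(1)]])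
  then have d: "((\<lambda>y. sqrt (1 + y\<^sup>2) powr q) has_real_derivative
      q * sqrt (1 + y\<^sup>2) powr (q - 1) * (inverse (sqrt (1 + y\<^sup>2)) / 2 * (2 * y))) (at y)"
    by (rule DERIV_chain2[where f="\<lambda>z. z powr q" and g="\<lambda>y. sqrt (1 + y\<^sup>2)",
          OF has_real_derivative_powr[OF pos(2)]])
  show "((\<lambda>y. sqrt (1 + y\<^sup>2) powr q) has_real_derivative
      q * sqrt (1 + y\<^sup>2) powr (q - 1) * (y / sqrt (1 + y\<^sup>2))) (at y)"
  proof -
    have "inverse s / 2 * (2 * y) = y / s" for s :: real by (simp add: field_simps)
    with d show ?thesis by simp
  qed
  have ne: "sqrt (1 + y\<^sup>2) \<noteq> 0" for y :: real using pos(2)[of y] by linarith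
  show "continuous_on UNIV (\<lambda>y::real. q * sqrt (1 + y\<^sup>2) powr (q - 1) * (y / sqrt (1 + y\<^sup>2)))"
  proof -
    have cw: "continuous_on UNIV (\<lambda>y::real. sqrt (1 + y\<^sup>2))" by (intro continuous_intros)
    have "continuous_on UNIV (\<lambda>y::real. sqrt (1 + y\<^sup>2) powr (q - 1))"
      by (rule continuous_on_powr[OF cw continuous_on_const]) (use ne in blast)
    moreover have "continuous_on UNIV (\<lambda>y::real. y / sqrt (1 + y\<^sup>2))"
      by (rule continuous_on_divide[OF continuous_on_id cw]) (use ne in blast)
    ultimately show ?thesis by (intro continuous_on_mult continuous_on_const)
  qed
  have "\<bar>y\<bar> \<le> sqrt (1 + y\<^sup>2)" by (rule real_le_rsqrt) simp
  then have le1: "\<bar>y / sqrt (1 + y\<^sup>2)\<bar> \<le> 1" using pos(2)[of y] by (simp add: abs_divide divide_le_eq)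
  show "\<bar>q * sqrt (1 + y\<^sup>2) powr (q - 1) * (y / sqrt (1 + y\<^sup>2))\<bar> \<le> q * sqrt (1 + y\<^sup>2) powr (q - 1)" if "1 \<le> q"
    using mult_left_mono[OF le1, of "q * sqrt (1 + y\<^sup>2) powr (q - 1)"] that
    by (simp add: abs_mult)
qed

text \<open>
  The second premise on \<open>e\<close> says that the difference quotients of \<open>G n\<close> at \<open>r\<close> converge to those of
  \<open>F\<close> uniformly in \<open>s\<close>, so the limits in \<open>n\<close> and in \<open>s\<close> may be exchanged.
\<close>

lemma has_real_derivative_uniform_limit:
  fixes F :: "real \<Rightarrow> real" and G :: "nat \<Rightarrow> real \<Rightarrow> real"
  assumes G: "\<And>n. (G n has_real_derivative d n) (at r)" and d: "d \<longlonglongrightarrow> L"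
    and e: "e \<longlonglongrightarrow> 0" "\<And>n s. \<bar>(F s - F r) - (G n s - G n r)\<bar> \<le> e n * \<bar>s - r\<bar>"
  shows "(F has_real_derivative L) (at r)"
  unfolding has_field_derivative_iff
proof (rule tendstoI)
  fix \<epsilon> :: real assume "0 < \<epsilon>"
  then have e3: "0 < \<epsilon> / 3" by simp
  have "\<forall>\<^sub>F n in sequentially. e n < \<epsilon> / 3 \<and> dist (d n) L < \<epsilon> / 3"
    using order_tendstoD(2)[OF e(1) e3] tendstoD[OF d e3] by eventually_elim auto
  then obtain n where n: "e n < \<epsilon> / 3" "dist (d n) L < \<epsilon> / 3"
    using eventually_happens'[OF sequentially_bot] by blast
  have "\<forall>\<^sub>F y in at r. dist ((G n y - G n r) / (y - r)) (d n) < \<epsilon> / 3"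
    using tendstoD[OF G[of n, unfolded has_field_derivative_iff] e3] .
  moreover have "\<forall>\<^sub>F y in at r. y \<noteq> r" by (simp add: eventually_at_filter)
  ultimately show "\<forall>\<^sub>F y in at r. dist ((F y - F r) / (y - r)) L < \<epsilon>"
  proof eventually_elim
    case (elim y)
    have "(F y - F r) / (y - r) - (G n y - G n r) / (y - r) = ((F y - F r) - (G n y - G n r)) / (y - r)"
      by (simp add: diff_divide_distrib)
    then have "\<bar>(F y - F r) / (y - r) - (G n y - G n r) / (y - r)\<bar> \<le> e n"
      using e(2)[of y n] elim(2) by (simp add: abs_divide divide_le_eq)
    then show ?case using elim(1) n unfolding dist_real_def by linarith
  qed
qed

lemma open_indicator_approx:
  fixes G :: "'a::metric_space set"
  assumes "open G"
  obtains \<rho> :: "nat \<Rightarrow> 'a \<Rightarrow> real" where "\<And>n. continuous_on UNIV (\<rho> n)" "\<And>n x. 0 \<le> \<rho> n x"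
    "\<And>n x. \<rho> n x \<le> indicator G x" "\<And>x. (\<lambda>n. \<rho> n x) \<longlonglongrightarrow> indicator G x"
proof (cases "G = UNIV")
  case True
  then show ?thesis by (intro that[of "\<lambda>n x. 1"]) auto
next
  case False
  then have ne: "- G \<noteq> {}" by auto
  define \<rho> where "\<rho> = (\<lambda>(n::nat) x. min 1 (real n * infdist x (- G)))"
  have out: "infdist x (- G) = 0" if "x \<notin> G" for x using that by simp
  have inside: "0 < infdist x (- G)" if "x \<in> G" for x
    using that in_closed_iff_infdist_zero[of "- G" x] assms ne infdist_nonneg[of x "- G"]
    by (auto simp: closed_def less_le)
  show ?thesis
  proof (rule that[of \<rho>])
    show "continuous_on UNIV (\<rho> n)" for n unfolding \<rho>_def by (intro continuous_intros)
    show "0 \<le> \<rho> n x" for n x by (simp add: \<rho>_def infdist_nonneg)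
    show "\<rho> n x \<le> indicator G x" for n x using out[of x] by (cases "x \<in> G") (auto simp: \<rho>_def)
    show "(\<lambda>n. \<rho> n x) \<longlonglongrightarrow> indicator G x" for x
    proof (cases "x \<in> G")
      case True
      obtain n0 :: nat where "1 < real n0 * infdist x (- G)" using ex_less_of_nat_mult[OF inside[OF True]] by blast
      then have "1 \<le> real n * infdist x (- G)" if "n0 \<le> n" for n
        using mult_right_mono[of "real n0" "real n" "infdist x (- G)"] that infdist_nonneg[of x "- G"] by simp
      then have "\<forall>\<^sub>F n in sequentially. \<rho> n x = 1"
        unfolding eventually_sequentially by (intro exI[of _ n0]) (auto simp: \<rho>_def min_def)
      then show ?thesis using True by (simp add: tendsto_eventually)
    next
      case False
      then show ?thesis using out[of x] by (simp add: \<rho>_def)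
    qed
  qed
qed

section \<open>Bounded functions with bounded continuous gradient\<close>

lemma GDERIV_unique:
  fixes f :: "'a::real_inner \<Rightarrow> real"
  assumes "GDERIV f x :> v" "GDERIV f x :> w"
  shows "v = w"
proof -
  have "(\<lambda>h. h \<bullet> v) = (\<lambda>h. h \<bullet> w)"
    using assms unfolding gderiv_def by (rule has_derivative_unique)
  then have "(v - w) \<bullet> v = (v - w) \<bullet> w" by metis
  then have "(v - w) \<bullet> (v - w) = 0" by (simp add: inner_diff_right)
  then show ?thesis by simp
qed

lemma grad_eq: "GDERIV \<phi> x :> v \<Longrightarrow> grad \<phi> x = v"
  unfolding grad_def by (rule the_equality) (auto intro: GDERIV_unique)

lemma Cb1_GDERIV: "\<phi> \<in> Cb1 \<Longrightarrow> GDERIV \<phi> x :> grad \<phi> x"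
  by (simp add: Cb1_def)

lemma Cb1_continuous: "\<phi> \<in> Cb1 \<Longrightarrow> continuous_on UNIV \<phi>"
  by (auto simp: continuous_on_eq_continuous_at Cb1_def gderiv_def intro: has_derivative_continuous)

lemma Cb1_continuous_grad: "\<phi> \<in> Cb1 \<Longrightarrow> continuous_on UNIV (grad \<phi>)"
  by (simp add: Cb1_def)

lemma Cb1_bounded:
  assumes "\<phi> \<in> Cb1"
  obtains B where "0 \<le> B" "\<And>x. \<bar>\<phi> x\<bar> \<le> B" "\<And>x. norm (grad \<phi> x) \<le> B"
proof -
  obtain B1 B2 where "\<And>x. \<bar>\<phi> x\<bar> \<le> B1" "\<And>x. norm (grad \<phi> x) \<le> B2"
    using assms by (auto simp: Cb1_def bounded_iff)
  then have "\<bar>\<phi> x\<bar> \<le> max B1 B2" "norm (grad \<phi> x) \<le> max B1 B2" for x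
    by (auto intro: max.coboundedI1 max.coboundedI2)
  moreover from this(1)[of 0] have "0 \<le> max B1 B2" by linarith
  ultimately show ?thesis by (intro that)
qed

lemma Cb1I:
  assumes "\<And>x. GDERIV \<phi> x :> G x" "continuous_on UNIV G" "\<And>x. \<bar>\<phi> x\<bar> \<le> B" "\<And>x. norm (G x) \<le> C"
  shows "\<phi> \<in> Cb1" "grad \<phi> = G"
proof -
  show "grad \<phi> = G" using assms(1) grad_eq by blast
  then show "\<phi> \<in> Cb1" using assms by (auto simp: Cb1_def bounded_iff)
qed

lemma Cb1_add:
  assumes "\<phi> \<in> Cb1" "\<eta> \<in> Cb1"
  shows "(\<lambda>x. \<phi> x + \<eta> x) \<in> Cb1" "grad (\<lambda>x. \<phi> x + \<eta> x) = (\<lambda>x. grad \<phi> x + grad \<eta> x)"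
proof -
  obtain B where B: "\<And>x. \<bar>\<phi> x\<bar> \<le> B" "\<And>x. norm (grad \<phi> x) \<le> B" using Cb1_bounded[OF assms(1)] by metis
  obtain C where C: "\<And>x. \<bar>\<eta> x\<bar> \<le> C" "\<And>x. norm (grad \<eta> x) \<le> C" using Cb1_bounded[OF assms(2)] by metis
  have 1: "\<bar>\<phi> x + \<eta> x\<bar> \<le> B + C" for x using B(1)[of x] C(1)[of x] by linarith
  have 2: "norm (grad \<phi> x + grad \<eta> x) \<le> B + C" for x
    using B(2)[of x] C(2)[of x] norm_triangle_ineq[of "grad \<phi> x" "grad \<eta> x"] by linarith
  note I = Cb1I[OF GDERIV_add[OF Cb1_GDERIV Cb1_GDERIV]
      continuous_on_add[OF Cb1_continuous_grad Cb1_continuous_grad] 1 2]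
  show "(\<lambda>x. \<phi> x + \<eta> x) \<in> Cb1" "grad (\<lambda>x. \<phi> x + \<eta> x) = (\<lambda>x. grad \<phi> x + grad \<eta> x)"
    by (rule I; use assms in simp)+
qed

lemma Cb1_mult:
  assumes "\<phi> \<in> Cb1" "\<eta> \<in> Cb1"
  shows "(\<lambda>x. \<phi> x * \<eta> x) \<in> Cb1"
    "grad (\<lambda>x. \<phi> x * \<eta> x) = (\<lambda>x. \<phi> x *\<^sub>R grad \<eta> x + \<eta> x *\<^sub>R grad \<phi> x)"
proof -
  obtain B where B: "0 \<le> B" "\<And>x. \<bar>\<phi> x\<bar> \<le> B" "\<And>x. norm (grad \<phi> x) \<le> B" using Cb1_bounded[OF assms(1)] by metis
  obtain C where C: "0 \<le> C" "\<And>x. \<bar>\<eta> x\<bar> \<le> C" "\<And>x. norm (grad \<eta> x) \<le> C" using Cb1_bounded[OF assms(2)] by metis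
  have 1: "\<bar>\<phi> x * \<eta> x\<bar> \<le> B * C" for x using B C by (auto simp: abs_mult intro!: mult_mono)
  have 2: "norm (\<phi> x *\<^sub>R grad \<eta> x + \<eta> x *\<^sub>R grad \<phi> x) \<le> B * C + C * B" for x
    using B C by (intro order_trans[OF norm_triangle_ineq] add_mono) (auto intro!: mult_mono)
  have c: "continuous_on UNIV (\<lambda>x. \<phi> x *\<^sub>R grad \<eta> x + \<eta> x *\<^sub>R grad \<phi> x)"
    using assms by (intro continuous_intros Cb1_continuous Cb1_continuous_grad)
  note I = Cb1I[OF GDERIV_mult[OF Cb1_GDERIV[OF assms(1)] Cb1_GDERIV[OF assms(2)]] c 1 2]
  show "(\<lambda>x. \<phi> x * \<eta> x) \<in> Cb1"
    "grad (\<lambda>x. \<phi> x * \<eta> x) = (\<lambda>x. \<phi> x *\<^sub>R grad \<eta> x + \<eta> x *\<^sub>R grad \<phi> x)" by (rule I)+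
qed

text \<open>
  Boundedness comes from compactness: \<open>\<phi>\<close> takes its values in a compact interval, on which the
  continuous functions \<open>\<theta>\<close> and \<open>\<theta>'\<close> are bounded.
\<close>

lemma Cb1_compose:
  assumes "\<phi> \<in> Cb1" and d: "\<And>y. (\<theta> has_real_derivative \<theta>' y) (at y)" and c: "continuous_on UNIV \<theta>'"
  shows "(\<lambda>x. \<theta> (\<phi> x)) \<in> Cb1" "grad (\<lambda>x. \<theta> (\<phi> x)) = (\<lambda>x. \<theta>' (\<phi> x) *\<^sub>R grad \<phi> x)"
proof -
  obtain B where B: "0 \<le> B" "\<And>x. \<bar>\<phi> x\<bar> \<le> B" "\<And>x. norm (grad \<phi> x) \<le> B" using Cb1_bounded[OF assms(1)] by metis
  have "continuous_on UNIV \<theta>" using d DERIV_isCont continuous_on_eq_continuous_at by blast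
  then have "compact (\<theta> ` {-B..B})" "compact (\<theta>' ` {-B..B})"
    using c by (auto intro!: compact_continuous_image continuous_on_subset[of UNIV])
  then obtain B1 B2 where b: "\<And>y. \<bar>y\<bar> \<le> B \<Longrightarrow> \<bar>\<theta> y\<bar> \<le> B1" "\<And>y. \<bar>y\<bar> \<le> B \<Longrightarrow> \<bar>\<theta>' y\<bar> \<le> B2"
    using compact_imp_bounded[of "\<theta> ` {-B..B}"] compact_imp_bounded[of "\<theta>' ` {-B..B}"]
    unfolding bounded_iff by (fastforce simp: abs_le_iff)
  have 2: "norm (\<theta>' (\<phi> x) *\<^sub>R grad \<phi> x) \<le> B2 * B" for x
    using B b(2)[OF B(2)] by (auto intro!: mult_mono order_trans[OF abs_ge_zero b(2)[OF B(2)]])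
  have c': "continuous_on UNIV (\<lambda>x. \<theta>' (\<phi> x) *\<^sub>R grad \<phi> x)"
    using assms by (intro continuous_intros Cb1_continuous_grad continuous_on_compose2[OF c Cb1_continuous]) auto
  note I = Cb1I[OF GDERIV_DERIV_compose[OF Cb1_GDERIV[OF assms(1)] d] c' b(1)[OF B(2)] 2]
  show "(\<lambda>x. \<theta> (\<phi> x)) \<in> Cb1" "grad (\<lambda>x. \<theta> (\<phi> x)) = (\<lambda>x. \<theta>' (\<phi> x) *\<^sub>R grad \<phi> x)"
    by (rule I)+
qed

lemma Cb1_const: "(\<lambda>x. c) \<in> Cb1" "grad (\<lambda>x. c) = (\<lambda>x. 0)"
  using Cb1I[OF GDERIV_const, of c "\<bar>c\<bar>" 0] by simp_all

lemma Cb1_scale: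
  assumes "\<phi> \<in> Cb1"
  shows "(\<lambda>x. c * \<phi> x) \<in> Cb1" "grad (\<lambda>x. c * \<phi> x) = (\<lambda>x. c *\<^sub>R grad \<phi> x)"
  using Cb1_mult[OF Cb1_const(1)[of c] assms] by (simp_all add: Cb1_const)

lemma Cb1_diff:
  assumes "\<phi> \<in> Cb1" "\<eta> \<in> Cb1"
  shows "(\<lambda>x. \<phi> x - \<eta> x) \<in> Cb1" "grad (\<lambda>x. \<phi> x - \<eta> x) = (\<lambda>x. grad \<phi> x - grad \<eta> x)"
  using Cb1_add[OF assms(1) Cb1_scale(1)[OF assms(2), of "-1"]] Cb1_scale(2)[OF assms(2), of "-1"] by simp_all

section \<open>The closure of the gradient and its Sobolev spaces\<close>

locale gradient_setting =
  fixes R :: "'a::{real_inner, banach, polish_space} \<Rightarrow> 'a" and \<nu> :: "'a measure"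
  assumes prob_space_nu: "prob_space \<nu>"
    and sets_nu [measurable_cong]: "sets \<nu> = sets borel"
    and bounded_linear_R: "bounded_linear R"
    and closable: "\<And>p. 1 < p \<Longrightarrow> closable_grad R \<nu> p"
begin

sublocale prob_space \<nu> by (rule prob_space_nu)

lemma space_nu [simp]: "space \<nu> = UNIV"
  using sets_eq_imp_space_eq[OF sets_nu] by simp

lemma continuous_on_R: "continuous_on A R"
  using bounded_linear_R by (rule linear_continuous_on)

lemma Cb1_measurable:
  assumes "\<phi> \<in> Cb1"
  shows "\<phi> \<in> borel_measurable borel" "(\<lambda>x. R (grad \<phi> x)) \<in> borel_measurable borel"
  using Cb1_continuous[OF assms] continuous_on_compose2[OF continuous_on_R Cb1_continuous_grad[OF assms] subset_UNIV]
  by (auto intro: borel_measurable_continuous_onI)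

lemma Cb1_bounded_R:
  assumes "\<phi> \<in> Cb1"
  obtains B where "0 \<le> B" "\<And>x. \<bar>\<phi> x\<bar> \<le> B" "\<And>x. norm (R (grad \<phi> x)) \<le> B"
proof -
  obtain B where B: "0 \<le> B" "\<And>x. \<bar>\<phi> x\<bar> \<le> B" "\<And>x. norm (grad \<phi> x) \<le> B"
    using Cb1_bounded[OF assms] by metis
  obtain K where K: "0 \<le> K" "\<And>v. norm (R v) \<le> norm v * K"
    using bounded_linear.nonneg_bounded[OF bounded_linear_R] by metis
  have "norm (R (grad \<phi> x)) \<le> max B (B * K)" for x
    using K(2)[of "grad \<phi> x"] mult_right_mono[OF B(3) K(1), of x] by linarith
  moreover have "\<bar>\<phi> x\<bar> \<le> max B (B * K)" for x using B(2)[of x] by linarith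
  ultimately show ?thesis using B(1) by (intro that[of "max B (B * K)"]) auto
qed

lemma Cb1_Lp:
  assumes "\<phi> \<in> Cb1" "0 \<le> p"
  shows "\<phi> \<in> Lp \<nu> p" "(\<lambda>x. R (grad \<phi> x)) \<in> Lp \<nu> p"
proof -
  obtain B where B: "\<And>x. \<bar>\<phi> x\<bar> \<le> B" "\<And>x. norm (R (grad \<phi> x)) \<le> B" using Cb1_bounded_R[OF assms(1)] by metis
  have [measurable]: "\<phi> \<in> borel_measurable borel" "(\<lambda>x. R (grad \<phi> x)) \<in> borel_measurable borel"
    using Cb1_measurable[OF assms(1)] .
  show "\<phi> \<in> Lp \<nu> p" by (rule Lp_bounded[of _ B]) (use B assms in auto)
  show "(\<lambda>x. R (grad \<phi> x)) \<in> Lp \<nu> p" by (rule Lp_bounded[of _ B]) (use B assms in auto)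
qed

lemma M_graph_Lp:
  assumes "(f, F) \<in> M_graph R \<nu> p"
  shows "f \<in> Lp \<nu> p" "F \<in> Lp \<nu> p"
  using assms by (auto simp: M_graph_def Lp_tendsto_def)

lemma M_graphI:
  assumes "\<And>n. \<phi> n \<in> Cb1" "Lp_tendsto \<nu> p \<phi> f" "Lp_tendsto \<nu> p (\<lambda>n x. R (grad (\<phi> n) x)) F"
  shows "(f, F) \<in> M_graph R \<nu> p"
  using assms by (auto simp: M_graph_def)

lemma M_graphE:
  assumes "(f, F) \<in> M_graph R \<nu> p"
  obtains \<phi> where "\<And>n. \<phi> n \<in> Cb1" "Lp_tendsto \<nu> p \<phi> f" "Lp_tendsto \<nu> p (\<lambda>n x. R (grad (\<phi> n) x)) F"
  using assms by (auto simp: M_graph_def)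

lemma M_graph_Cb1:
  assumes "\<phi> \<in> Cb1" "0 < p"
  shows "(\<phi>, \<lambda>x. R (grad \<phi> x)) \<in> M_graph R \<nu> p"
  using assms Cb1_Lp[OF assms(1), of p] unfolding M_graph_def
  by (auto intro!: exI[of _ "\<lambda>n. \<phi>"] Lp_tendsto_const)

lemma M_graph_add:
  assumes "0 < p" "(f, F) \<in> M_graph R \<nu> p" "(h, H) \<in> M_graph R \<nu> p"
  shows "(\<lambda>x. f x + h x, \<lambda>x. F x + H x) \<in> M_graph R \<nu> p"
proof -
  obtain \<phi> where \<phi>: "\<And>n. \<phi> n \<in> Cb1" "Lp_tendsto \<nu> p \<phi> f" "Lp_tendsto \<nu> p (\<lambda>n x. R (grad (\<phi> n) x)) F"
    using assms(2) by (rule M_graphE) blast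
  obtain \<eta> where \<eta>: "\<And>n. \<eta> n \<in> Cb1" "Lp_tendsto \<nu> p \<eta> h" "Lp_tendsto \<nu> p (\<lambda>n x. R (grad (\<eta> n) x)) H"
    using assms(3) by (rule M_graphE) blast
  show ?thesis unfolding M_graph_def
    using Lp_tendsto_add[OF assms(1) \<phi>(2) \<eta>(2)] Lp_tendsto_add[OF assms(1) \<phi>(3) \<eta>(3)]
    by (auto intro!: exI[of _ "\<lambda>n x. \<phi> n x + \<eta> n x"]
        simp: Cb1_add \<phi>(1) \<eta>(1) linear_add[OF bounded_linear.linear[OF bounded_linear_R]])
qed

lemma M_graph_scale:
  assumes "0 < p" "(f, F) \<in> M_graph R \<nu> p"
  shows "(\<lambda>x. c * f x, \<lambda>x. c *\<^sub>R F x) \<in> M_graph R \<nu> p"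
proof -
  obtain \<phi> where \<phi>: "\<And>n. \<phi> n \<in> Cb1" "Lp_tendsto \<nu> p \<phi> f" "Lp_tendsto \<nu> p (\<lambda>n x. R (grad (\<phi> n) x)) F"
    using assms(2) by (rule M_graphE) blast
  show ?thesis unfolding M_graph_def
    using Lp_tendsto_scaleR[OF assms(1) \<phi>(2), of c] Lp_tendsto_scaleR[OF assms(1) \<phi>(3), of c]
    by (auto intro!: exI[of _ "\<lambda>n x. c * \<phi> n x"]
        simp: Cb1_scale \<phi>(1) linear_cmul[OF bounded_linear.linear[OF bounded_linear_R]])
qed

lemma M_graph_diff:
  assumes "0 < p" "(f, F) \<in> M_graph R \<nu> p" "(h, H) \<in> M_graph R \<nu> p"
  shows "(\<lambda>x. f x - h x, \<lambda>x. F x - H x) \<in> M_graph R \<nu> p"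
  using M_graph_add[OF assms(1,2) M_graph_scale[OF assms(1,3), of "-1"]] by simp

lemma M_graph_cong_AE:
  assumes "0 < p" "(f, F) \<in> M_graph R \<nu> p" "H \<in> borel_measurable \<nu>" "AE x in \<nu>. F x = H x"
  shows "(f, H) \<in> M_graph R \<nu> p"
  using assms Lp_tendsto_cong_AE[OF assms(1) _ assms(3,4)] by (auto simp: M_graph_def)

lemma M_graph_lower_exponent:
  assumes "0 < s" "s \<le> p" "(f, F) \<in> M_graph R \<nu> p"
  shows "(f, F) \<in> M_graph R \<nu> s"
  using assms(3)
  by (rule M_graphE) (rule M_graphI, (assumption | rule Lp_tendsto_lower_exponent[OF assms(1,2)])+)

lemma M_graph_unique:
  assumes "1 < p" "(f, F) \<in> M_graph R \<nu> p" "(f, H) \<in> M_graph R \<nu> p"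
  shows "AE x in \<nu>. F x = H x"
proof -
  have "(\<lambda>x. f x - f x, \<lambda>x. F x - H x) \<in> M_graph R \<nu> p"
    using assms by (intro M_graph_diff) auto
  then obtain \<phi> where "\<And>n. \<phi> n \<in> Cb1" "Lp_tendsto \<nu> p \<phi> (\<lambda>x. f x - f x)"
      "Lp_tendsto \<nu> p (\<lambda>n x. R (grad (\<phi> n) x)) (\<lambda>x. F x - H x)"
    by (rule M_graphE) blast
  then have "AE x in \<nu>. F x - H x = 0"
    using closable[OF assms(1), unfolded closable_grad_def, rule_format, of \<phi> "\<lambda>x. F x - H x"] by simp
  then show ?thesis by simp
qed

lemma Mp_graph: "f \<in> W1p R \<nu> p \<Longrightarrow> (f, Mp R \<nu> p f) \<in> M_graph R \<nu> p"
  unfolding W1p_def Mp_def by (auto intro: someI[where P="\<lambda>F. (f, F) \<in> M_graph R \<nu> p"])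

lemma M_graph_W1p: "(f, F) \<in> M_graph R \<nu> p \<Longrightarrow> f \<in> W1p R \<nu> p"
  by (auto simp: W1p_def)

lemma Mp_eq_AE: "1 < p \<Longrightarrow> (f, F) \<in> M_graph R \<nu> p \<Longrightarrow> AE x in \<nu>. Mp R \<nu> p f x = F x"
  using M_graph_unique Mp_graph M_graph_W1p by blast

lemma W1p_norm_eq:
  assumes "1 < p" "(f, F) \<in> M_graph R \<nu> p"
  shows "W1p_norm R \<nu> p f = Lp_mass \<nu> p f powr (1 / p) + Lp_mass \<nu> p F powr (1 / p)"
  using Lp_mass_cong_AE[OF _ _ Mp_eq_AE[OF assms], of p] M_graph_Lp[OF assms(2)]
    M_graph_Lp[OF Mp_graph[OF M_graph_W1p[OF assms(2)]]]
  unfolding W1p_norm_def Lp_norm_def Lp_mass_def[symmetric] by (simp add: Lp_measurable)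

text \<open>
  Each of the two masses is at most \<open>c\<^sup>p\<close>, and \<open>2 c\<^sup>p \<le> (2 c)\<^sup>p\<close>.
\<close>

lemma M_graph_mass_le:
  assumes "1 < p" "(f, F) \<in> M_graph R \<nu> p" "W1p_norm R \<nu> p f \<le> c"
  shows "Lp_mass \<nu> p f + Lp_mass \<nu> p F \<le> (2 * c) powr p"
proof -
  note n = assms(3)[unfolded W1p_norm_eq[OF assms(1,2)]]
  have c: "0 \<le> c" using n by (smt (verit) powr_ge_zero)
  have *: "m \<le> c powr p" if "0 \<le> m" "m powr (1 / p) \<le> c" for m
  proof -
    have "(m powr (1 / p)) powr p \<le> c powr p" using that assms by (intro powr_mono2) auto
    then show ?thesis using that assms by (simp add: powr_powr)
  qed
  have "Lp_mass \<nu> p f \<le> c powr p" "Lp_mass \<nu> p F \<le> c powr p"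
    by (rule *; use n in \<open>smt (verit) Lp_mass_nonneg powr_ge_zero\<close>)+
  moreover have "2 * c powr p \<le> (2 * c) powr p"
  proof -
    have "2 powr 1 \<le> 2 powr p" using assms(1) by (intro powr_mono) auto
    then show ?thesis using c by (simp add: powr_mult mult_right_mono)
  qed
  ultimately show ?thesis by linarith
qed

text \<open>
  By closability the operator sends \<open>\<phi>\<^sub>n - f\<close> to \<open>R\<nabla>\<phi>\<^sub>n - F\<close> almost everywhere, whichever
  representative \<open>F\<close> is used. Convergence in the graph norm thus splits into two convergences in
  \<open>L\<^sup>p\<close>.
\<close>

lemma W1p_tendsto_iff:
  assumes p: "1 < p" and \<phi>: "\<And>n. \<phi> n \<in> Cb1" and f: "(f, F) \<in> M_graph R \<nu> p"
  shows "W1p_tendsto R \<nu> p \<phi> f \<longleftrightarrow>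
    Lp_tendsto \<nu> p \<phi> f \<and> Lp_tendsto \<nu> p (\<lambda>n x. R (grad (\<phi> n) x)) F"
proof -
  have 0: "0 < p" using p by simp
  have g: "(\<lambda>x. \<phi> n x - f x, \<lambda>x. R (grad (\<phi> n) x) - F x) \<in> M_graph R \<nu> p" for n
    by (rule M_graph_diff[OF 0 M_graph_Cb1[OF \<phi> 0] f])
  have "\<phi> n \<in> W1p R \<nu> p" "f \<in> W1p R \<nu> p" for n
    using M_graph_W1p M_graph_Cb1[OF \<phi> 0] f by blast+
  then have "W1p_tendsto R \<nu> p \<phi> f \<longleftrightarrow> (\<lambda>n. Lp_norm \<nu> p (\<lambda>x. \<phi> n x - f x) +
      Lp_norm \<nu> p (\<lambda>x. R (grad (\<phi> n) x) - F x)) \<longlonglongrightarrow> 0"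
    by (simp add: W1p_tendsto_def W1p_norm_eq[OF p g] Lp_norm_def Lp_mass_def)
  also have "\<dots> \<longleftrightarrow> (\<lambda>n. Lp_norm \<nu> p (\<lambda>x. \<phi> n x - f x)) \<longlonglongrightarrow> 0 \<and>
      (\<lambda>n. Lp_norm \<nu> p (\<lambda>x. R (grad (\<phi> n) x) - F x)) \<longlonglongrightarrow> 0" (is "?s \<longlonglongrightarrow> 0 \<longleftrightarrow> ?u \<longlonglongrightarrow> 0 \<and> ?v \<longlonglongrightarrow> 0")
  proof (intro iffI conjI)
    assume "?s \<longlonglongrightarrow> 0"
    then show "?u \<longlonglongrightarrow> 0" "?v \<longlonglongrightarrow> 0"
      by (rule Lim_null_comparison[rotated]; simp add: Lp_norm_def)+
  qed (auto intro: tendsto_add_zero)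
  also have "\<dots> \<longleftrightarrow> Lp_tendsto \<nu> p \<phi> f \<and> Lp_tendsto \<nu> p (\<lambda>n x. R (grad (\<phi> n) x)) F"
    using Cb1_Lp[OF \<phi>] M_graph_Lp[OF f] p by (simp add: Lp_tendsto_def)
  finally show ?thesis .
qed

lemma W1p_approx:
  assumes "1 < p" "f \<in> W1p R \<nu> p"
  obtains \<phi> where "\<And>n. \<phi> n \<in> Cb1" "W1p_tendsto R \<nu> p \<phi> f"
  using M_graphE[OF Mp_graph[OF assms(2)]] W1p_tendsto_iff[OF assms(1) _ Mp_graph[OF assms(2)]] by metis

lemma M_graph_mult:
  assumes s: "0 < s" "0 < p1" "0 < p2" "1 / p1 + 1 / p2 = 1 / s"
    and \<phi>: "\<And>n. \<phi> n \<in> Cb1" "Lp_tendsto \<nu> p1 \<phi> f" "Lp_tendsto \<nu> p1 (\<lambda>n x. R (grad (\<phi> n) x)) F"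
    and \<eta>: "\<And>n. \<eta> n \<in> Cb1" "Lp_tendsto \<nu> p2 \<eta> h" "Lp_tendsto \<nu> p2 (\<lambda>n x. R (grad (\<eta> n) x)) H"
  shows "Lp_tendsto \<nu> s (\<lambda>n x. \<phi> n x * \<eta> n x) (\<lambda>x. f x * h x)"
    "Lp_tendsto \<nu> s (\<lambda>n x. R (grad (\<lambda>x. \<phi> n x * \<eta> n x) x)) (\<lambda>x. f x *\<^sub>R H x + h x *\<^sub>R F x)"
    "(\<lambda>x. f x * h x, \<lambda>x. f x *\<^sub>R H x + h x *\<^sub>R F x) \<in> M_graph R \<nu> s"
proof -
  have s': "1 / p2 + 1 / p1 = 1 / s" using s by simp
  show 1: "Lp_tendsto \<nu> s (\<lambda>n x. \<phi> n x * \<eta> n x) (\<lambda>x. f x * h x)"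
    using Lp_tendsto_scaleR_Hoelder[OF s \<phi>(2) \<eta>(2)] by simp
  have "R (\<phi> n x *\<^sub>R grad (\<eta> n) x + \<eta> n x *\<^sub>R grad (\<phi> n) x) =
     \<phi> n x *\<^sub>R R (grad (\<eta> n) x) + \<eta> n x *\<^sub>R R (grad (\<phi> n) x)" for n x
    using bounded_linear.linear[OF bounded_linear_R] by (simp add: linear_add linear_cmul)
  then show 2: "Lp_tendsto \<nu> s (\<lambda>n x. R (grad (\<lambda>x. \<phi> n x * \<eta> n x) x)) (\<lambda>x. f x *\<^sub>R H x + h x *\<^sub>R F x)"
    using Lp_tendsto_add[OF s(1) Lp_tendsto_scaleR_Hoelder[OF s \<phi>(2) \<eta>(3)]
        Lp_tendsto_scaleR_Hoelder[OF s(1,3,2) s' \<eta>(2) \<phi>(3)]]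
    by (simp add: Cb1_mult[OF \<phi>(1) \<eta>(1)])
  show "(\<lambda>x. f x * h x, \<lambda>x. f x *\<^sub>R H x + h x *\<^sub>R F x) \<in> M_graph R \<nu> s"
    by (rule M_graphI[OF Cb1_mult(1)[OF \<phi>(1) \<eta>(1)] 1 2])
qed

text \<open>
  Up to constants the \<open>p\<close>-th power of the Sobolev norm, with the derivative passed as an argument so
  that any representative of it may be used.
\<close>

abbreviation energy :: "real \<Rightarrow> ('a \<Rightarrow> real) \<Rightarrow> ('a \<Rightarrow> 'a) \<Rightarrow> real" where
  "energy p f F \<equiv> Lp_mass \<nu> p f + Lp_mass \<nu> p F"

lemma energy_diff_tendsto:
  assumes p: "0 < p"
    and \<phi>: "Lp_tendsto \<nu> p \<phi> f" "Lp_tendsto \<nu> p \<Phi> F"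
  shows "(\<lambda>n. energy p (\<lambda>x. \<phi> n x - f x) (\<lambda>x. \<Phi> n x - F x)) \<longlonglongrightarrow> 0"
  using \<phi> by (intro tendsto_add_zero) (auto simp: Lp_tendsto_iff[OF p])

lemma energy_diff_le:
  assumes p: "0 < p"
    and "u \<in> Lp \<nu> p" "v \<in> Lp \<nu> p" "U \<in> Lp \<nu> p" "V \<in> Lp \<nu> p"
  shows "energy p (\<lambda>x. u x - v x) (\<lambda>x. U x - V x) \<le> 2 powr p * (energy p u U + energy p v V)"
  using Lp_diff(2)[OF p assms(2,3)] Lp_diff(2)[OF p assms(4,5)] by (simp add: algebra_simps)

text \<open>
  Approximating sequences may have a larger energy than their limit, but at most by the factor of the
  quasi-triangle inequality, which is absorbed by doubling \<open>c\<close>.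
\<close>

lemma energy_eventually_less:
  assumes p: "0 < p" and \<phi>: "Lp_tendsto \<nu> p \<phi> f" "Lp_tendsto \<nu> p \<Phi> F"
    and c: "energy p f F < c powr p" "0 < c"
  shows "\<forall>\<^sub>F n in sequentially. energy p (\<phi> n) (\<Phi> n) \<le> (2 * c) powr p"
proof -
  have m: "\<phi> n \<in> Lp \<nu> p" "f \<in> Lp \<nu> p" "\<Phi> n \<in> Lp \<nu> p" "F \<in> Lp \<nu> p" for n
    using \<phi> by (auto simp: Lp_tendsto_def)
  have "\<forall>\<^sub>F n in sequentially. energy p (\<lambda>x. \<phi> n x - f x) (\<lambda>x. \<Phi> n x - F x) < c powr p - energy p f F"
    using order_tendstoD(2)[OF energy_diff_tendsto[OF p \<phi>]] c by simp
  then show ?thesis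
  proof eventually_elim
    case (elim n)
    have "energy p (\<lambda>x. (\<phi> n x - f x) + f x) (\<lambda>x. (\<Phi> n x - F x) + F x) \<le>
       2 powr p * (energy p (\<lambda>x. \<phi> n x - f x) (\<lambda>x. \<Phi> n x - F x) + energy p f F)"
      using Lp_add(2)[OF p Lp_diff(1)[OF p m(1)[of n] m(2)] m(2)] Lp_add(2)[OF p Lp_diff(1)[OF p m(3)[of n] m(4)] m(4)]
      by (simp add: algebra_simps)
    also have "\<dots> \<le> 2 powr p * c powr p" using elim by (intro mult_left_mono) auto
    finally show ?case using c by (simp add: powr_mult)
  qed
qed

end

section \<open>The mass of a Sobolev function between two level sets\<close>

locale level_set_setting = gradient_setting +
  fixes g :: "'a \<Rightarrow> real"
  assumes g_measurable [measurable]: "g \<in> borel_measurable borel"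
    and g_W1p: "\<And>p. 1 < p \<Longrightarrow> g \<in> W1p R \<nu> p"
    and Mg_nonzero: "AE x in \<nu>. M_all R \<nu> g x \<noteq> 0"
    and normalised_Mg_adjoint: "\<And>p. 1 < p \<Longrightarrow>
      (\<lambda>x. (1 / (norm (M_all R \<nu> g x))\<^sup>2) *\<^sub>R M_all R \<nu> g x) \<in> dom_Mp_adjoint R \<nu> p"
begin

abbreviation Mg :: "'a \<Rightarrow> 'a" where "Mg \<equiv> M_all R \<nu> g"

definition normalised_Mg :: "'a \<Rightarrow> 'a" where
  "normalised_Mg x = (1 / (norm (Mg x))\<^sup>2) *\<^sub>R Mg x"

text \<open>
  \<open>M_all\<close> is a choice among common representatives, so one has to be exhibited. The representative for
  \<open>p = 2\<close> serves: for \<open>q \<ge> 2\<close> convergence in \<open>L\<^sup>q\<close> implies convergence in \<open>L\<^sup>2\<close>, and closability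
  identifies the two derivatives; smaller exponents are covered by larger ones.
\<close>

lemma Mg_graph:
  assumes "1 < p"
  shows "(g, Mg) \<in> M_graph R \<nu> p"
proof -
  define F where "F = Mp R \<nu> 2 g"
  have F2: "(g, F) \<in> M_graph R \<nu> 2" unfolding F_def by (rule Mp_graph[OF g_W1p]) simp
  have large: "(g, F) \<in> M_graph R \<nu> q" if "2 \<le> q" for q
  proof (rule M_graph_cong_AE[OF _ Mp_graph[OF g_W1p]])
    have "(g, Mp R \<nu> q g) \<in> M_graph R \<nu> 2"
      by (rule M_graph_lower_exponent[OF _ that Mp_graph[OF g_W1p]]) (use that in auto)
    from M_graph_unique[OF _ this F2] show "AE x in \<nu>. Mp R \<nu> q g x = F x" by simp
    show "F \<in> borel_measurable \<nu>" using M_graph_Lp(2)[OF F2] by (rule Lp_measurable)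
  qed (use that in linarith)+
  have "(g, F) \<in> M_graph R \<nu> q" if "1 < q" for q
    by (rule M_graph_lower_exponent[OF _ _ large[of "max 2 q"]]) (use that in auto)
  then have "\<forall>p>1. (g, F) \<in> M_graph R \<nu> p" by simp
  then have "\<forall>p>1. (g, Mg) \<in> M_graph R \<nu> p"
    unfolding M_all_def by (rule someI[where P="\<lambda>F. \<forall>p>1. (g, F) \<in> M_graph R \<nu> p" and x=F])
  from this[rule_format, OF assms] show ?thesis .
qed

lemma inner_normalised_Mg: "AE x in \<nu>. Mg x \<bullet> normalised_Mg x = 1"
  using Mg_nonzero by eventually_elim (simp add: normalised_Mg_def dot_square_norm)

text \<open>
  The function \<open>h\<close> is \<open>M\<^sup>*\<Psi>\<close> for the exponent \<open>p\<close>. It is kept local to each exponent, since in every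
  application a single exponent serves for \<open>\<Psi>\<close>, for \<open>h\<close> and for the approximation of \<open>g\<close>.
\<close>

lemma normalised_Mg_adjointE:
  assumes "1 < p"
  obtains h :: "'a \<Rightarrow> real" where "normalised_Mg \<in> Lp \<nu> (p / (p - 1))" "h \<in> Lp \<nu> (p / (p - 1))"
    "\<And>u. u \<in> Cb1 \<Longrightarrow> (\<integral>x. R (grad u x) \<bullet> normalised_Mg x \<partial>\<nu>) = (\<integral>x. u x * h x \<partial>\<nu>)"
proof -
  have n: "normalised_Mg \<in> dom_Mp_adjoint R \<nu> p"
    using normalised_Mg_adjoint[OF assms] by (simp add: normalised_Mg_def[abs_def])
  then obtain h where h: "h \<in> Lp \<nu> (p / (p - 1))"
    "\<And>u. u \<in> W1p R \<nu> p \<Longrightarrow> (\<integral>x. Mp R \<nu> p u x \<bullet> normalised_Mg x \<partial>\<nu>) = (\<integral>x. u x * h x \<partial>\<nu>)"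
    unfolding dom_Mp_adjoint_def by blast
  have L: "normalised_Mg \<in> Lp \<nu> (p / (p - 1))" using n by (simp add: dom_Mp_adjoint_def)
  have [measurable]: "normalised_Mg \<in> borel_measurable \<nu>" using L by (rule Lp_measurable)
  show ?thesis
  proof (rule that[OF L h(1)])
    fix u :: "'a \<Rightarrow> real" assume u: "u \<in> Cb1"
    have g: "(u, \<lambda>x. R (grad u x)) \<in> M_graph R \<nu> p" using M_graph_Cb1[OF u] assms by simp
    have [measurable]: "(\<lambda>x. R (grad u x)) \<in> borel_measurable \<nu>" "Mp R \<nu> p u \<in> borel_measurable \<nu>"
      by (rule Lp_measurable[OF M_graph_Lp(2)[OF g]])
        (rule Lp_measurable[OF M_graph_Lp(2)[OF Mp_graph[OF M_graph_W1p[OF g]]]])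
    have "(\<integral>x. R (grad u x) \<bullet> normalised_Mg x \<partial>\<nu>) = (\<integral>x. Mp R \<nu> p u x \<bullet> normalised_Mg x \<partial>\<nu>)"
      by (rule integral_cong_AE) (use Mp_eq_AE[OF assms g] in auto)
    then show "(\<integral>x. R (grad u x) \<bullet> normalised_Mg x \<partial>\<nu>) = (\<integral>x. u x * h x \<partial>\<nu>)"
      using h(2)[OF M_graph_W1p[OF g]] by simp
  qed
qed

text \<open>
  Integration by parts with the cutoff \<open>\<theta>(g)\<close>. The function \<open>g\<close> is approximated by smooth \<open>f\<^sub>n\<close>, so that
  \<open>\<theta>(f\<^sub>n) u\<close> is smooth and the adjoint identity applies to it. The resulting bound
  does not depend on \<open>n\<close>; only its left-hand side has to be passed to the limit, where
  \<open>\<langle>Mg, \<Psi>\<rangle> = 1\<close> leaves \<open>\<integral> \<theta>'(g) u d\<nu>\<close>.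
\<close>

lemma layer_by_parts:
  assumes p: "1 < p"
    and h: "h \<in> Lp \<nu> (p / (p - 1))"
      "\<And>u. u \<in> Cb1 \<Longrightarrow> (\<integral>x. R (grad u x) \<bullet> normalised_Mg x \<partial>\<nu>) = (\<integral>x. u x * h x \<partial>\<nu>)"
    and \<Psi>: "normalised_Mg \<in> Lp \<nu> (p / (p - 1))"
    and u: "u \<in> Cb1" "\<And>x. 0 \<le> u x" and ab: "a < b"
  shows "(LINT x:{x. a < g x \<and> g x \<le> b}|\<nu>. u x) \<le>
    pi * (b - a) * (\<integral>x. u x * \<bar>h x\<bar> + norm (R (grad u x)) * norm (normalised_Mg x) \<partial>\<nu>)"
proof -
  obtain \<theta> \<theta>' where \<theta>: "\<And>t. (\<theta> has_real_derivative \<theta>' t) (at t)" "continuous_on UNIV \<theta>'"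
    "\<And>t. \<bar>\<theta> t\<bar> \<le> pi * (b - a)" "\<And>t. 0 \<le> \<theta>' t" "\<And>t. \<theta>' t \<le> 2"
    "\<And>t. a \<le> t \<Longrightarrow> t \<le> b \<Longrightarrow> 1 \<le> \<theta>' t"
    using layer_cutoff[OF ab] by blast
  note d = \<theta>(1) and c\<theta>' = \<theta>(2) and \<theta>_le = \<theta>(3) and \<theta>'0 = \<theta>(4) and \<theta>'2 = \<theta>(5) and \<theta>'1 = \<theta>(6)
  have c\<theta>: "continuous_on UNIV \<theta>"
    by (auto simp: continuous_on_eq_continuous_at intro: DERIV_isCont[OF d])
  note [measurable] = borel_measurable_continuous_onI[OF c\<theta>'] borel_measurable_continuous_onI[OF c\<theta>]
    Cb1_measurable[OF u(1)] Lp_measurable[OF h(1)] Lp_measurable[OF \<Psi>]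

  obtain f0 where f0: "\<And>n. f0 n \<in> Cb1" "Lp_tendsto \<nu> p f0 g" "Lp_tendsto \<nu> p (\<lambda>n x. R (grad (f0 n) x)) Mg"
    using Mg_graph[OF p] by (rule M_graphE) blast
  obtain k where k: "strict_mono k" "AE x in \<nu>. (\<lambda>n. f0 (k n) x) \<longlonglongrightarrow> g x"
    using Lp_tendsto_AE_subseq[OF _ f0(2)] p by auto
  define f where "f n = f0 (k n)" for n
  have f: "\<And>n. f n \<in> Cb1" "AE x in \<nu>. (\<lambda>n. f n x) \<longlonglongrightarrow> g x"
     "Lp_tendsto \<nu> p (\<lambda>n x. R (grad (f n) x)) Mg"
    using f0 k Lp_tendsto_subseq[OF f0(3) k(1)] by (auto simp: f_def)
  note [measurable] = Cb1_measurable[OF f(1)]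
  obtain B where B: "0 \<le> B" "\<And>x. \<bar>u x\<bar> \<le> B" "\<And>x. norm (R (grad u x)) \<le> B"
    using Cb1_bounded_R[OF u(1)] by metis
  have t1: "1 \<le> p / (p - 1)" using p by (simp add: field_simps)
  have ih: "integrable \<nu> h" and i\<Psi>: "integrable \<nu> normalised_Mg"
    using Lp_imp_integrable h \<Psi> t1 by auto
  have ib: "integrable \<nu> (\<lambda>x. u x * \<bar>h x\<bar> + norm (R (grad u x)) * norm (normalised_Mg x))"
    by (rule Bochner_Integration.integrable_bound[of _ "\<lambda>x. B * \<bar>h x\<bar> + B * norm (normalised_Mg x)"])
       (use ih i\<Psi> B u(2) in \<open>auto intro!: AE_I2 add_mono mult_mono\<close>)
  define v where "v = (\<lambda>n x. \<theta>' (f n x) * u x)"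
  have vm: "v n \<in> borel_measurable \<nu>" for n unfolding v_def by measurable
  have tB: "\<bar>\<theta>' t * u x\<bar> \<le> 2 * B" for t x
    unfolding abs_mult using \<theta>'0[of t] \<theta>'2[of t] B(2) by (intro mult_mono) simp_all
  then have vB: "\<bar>v n x\<bar> \<le> 2 * B" for n x by (simp add: v_def)
  note lim = Lp_pairing_tendsto[where v=v, OF p \<Psi> vm vB f(3)]

  let ?I = "\<integral>x. u x * \<bar>h x\<bar> + norm (R (grad u x)) * norm (normalised_Mg x) \<partial>\<nu>"
  have est: "(\<integral>x. v n x * (R (grad (f n) x) \<bullet> normalised_Mg x) \<partial>\<nu>) \<le> pi * (b - a) * ?I" for n
  proof -
    define w where "w = (\<lambda>x. \<theta> (f n x) * u x)"
    note comp = Cb1_compose[OF f(1)[of n] d c\<theta>']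
    have w: "w \<in> Cb1" unfolding w_def by (rule Cb1_mult[OF comp(1) u(1)])
    have gw: "R (grad w x) = \<theta> (f n x) *\<^sub>R R (grad u x) + v n x *\<^sub>R R (grad (f n) x)" for x
      unfolding w_def v_def Cb1_mult(2)[OF comp(1) u(1)] comp(2)
      using bounded_linear.linear[OF bounded_linear_R] by (simp add: linear_add linear_cmul mult.commute)
    have i1: "integrable \<nu> (\<lambda>x. \<theta> (f n x) * (R (grad u x) \<bullet> normalised_Mg x))"
    proof (rule Bochner_Integration.integrable_bound[of _ "\<lambda>x. (pi * (b - a) * B) * norm (normalised_Mg x)"])
      show "AE x in \<nu>. norm (\<theta> (f n x) * (R (grad u x) \<bullet> normalised_Mg x)) \<le> norm (pi * (b - a) * B * norm (normalised_Mg x))"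
      proof (rule AE_I2)
        fix x
        have *: "\<bar>R (grad u x) \<bullet> normalised_Mg x\<bar> \<le> B * norm (normalised_Mg x)"
          using Cauchy_Schwarz_ineq2[of "R (grad u x)" "normalised_Mg x"] B(3)[of x]
          by (meson mult_right_mono norm_ge_zero order_trans)
        show "norm (\<theta> (f n x) * (R (grad u x) \<bullet> normalised_Mg x)) \<le> norm (pi * (b - a) * B * norm (normalised_Mg x))"
          using mult_mono[OF \<theta>_le[of "f n x"] *] ab B(1) by (simp add: abs_mult mult_ac)
      qed
    qed (use i\<Psi> in auto)
    have i2: "integrable \<nu> (\<lambda>x. w x * h x)"
      by (rule Bochner_Integration.integrable_bound[of _ "\<lambda>x. (pi * (b - a) * B) * norm (h x)"])
         (use ih \<theta>_le B ab in \<open>auto simp: w_def abs_mult intro!: AE_I2 mult_mono\<close>)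
    have "(\<integral>x. \<theta> (f n x) * (R (grad u x) \<bullet> normalised_Mg x) + v n x * (R (grad (f n) x) \<bullet> normalised_Mg x) \<partial>\<nu>)
       = (\<integral>x. w x * h x \<partial>\<nu>)"
      using h(2)[OF w] by (simp add: gw inner_add_left)
    then have "(\<integral>x. v n x * (R (grad (f n) x) \<bullet> normalised_Mg x) \<partial>\<nu>) =
       (\<integral>x. w x * h x - \<theta> (f n x) * (R (grad u x) \<bullet> normalised_Mg x) \<partial>\<nu>)"
      using i1 i2 lim(2)[of n] by simp
    also have "\<dots> \<le> (\<integral>x. pi * (b - a) * (u x * \<bar>h x\<bar> + norm (R (grad u x)) * norm (normalised_Mg x)) \<partial>\<nu>)"
    proof (rule integral_mono)
      fix x
      have "w x * h x \<le> pi * (b - a) * (u x * \<bar>h x\<bar>)"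
      proof -
        have "w x * h x \<le> \<bar>\<theta> (f n x)\<bar> * (u x * \<bar>h x\<bar>)"
          using abs_ge_self[of "w x * h x"] u(2)[of x] by (simp add: w_def abs_mult mult_ac)
        also have "\<dots> \<le> pi * (b - a) * (u x * \<bar>h x\<bar>)"
          using \<theta>_le u(2) by (intro mult_right_mono) auto
        finally show ?thesis .
      qed
      moreover have "- (\<theta> (f n x) * (R (grad u x) \<bullet> normalised_Mg x)) \<le>
        pi * (b - a) * (norm (R (grad u x)) * norm (normalised_Mg x))"
      proof -
        have "- (\<theta> (f n x) * (R (grad u x) \<bullet> normalised_Mg x)) \<le>
            \<bar>\<theta> (f n x)\<bar> * \<bar>R (grad u x) \<bullet> normalised_Mg x\<bar>"
          by (metis abs_ge_minus_self abs_mult)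
        also have "\<dots> \<le> pi * (b - a) * (norm (R (grad u x)) * norm (normalised_Mg x))"
          using \<theta>_le ab Cauchy_Schwarz_ineq2 by (intro mult_mono) auto
        finally show ?thesis .
      qed
      ultimately show "w x * h x - \<theta> (f n x) * (R (grad u x) \<bullet> normalised_Mg x) \<le>
         pi * (b - a) * (u x * \<bar>h x\<bar> + norm (R (grad u x)) * norm (normalised_Mg x))"
        by (simp add: distrib_left)
    qed (use i1 i2 ib in auto)
    finally show ?thesis by simp
  qed
  have conv: "(\<lambda>n. (\<integral>x. v n x * (Mg x \<bullet> normalised_Mg x) \<partial>\<nu>)) \<longlonglongrightarrow> (\<integral>x. \<theta>' (g x) * u x \<partial>\<nu>)"
  proof (rule integral_dominated_convergence[where w="\<lambda>x. 2 * B"])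
    show "AE x in \<nu>. (\<lambda>n. v n x * (Mg x \<bullet> normalised_Mg x)) \<longlonglongrightarrow> \<theta>' (g x) * u x"
      using f(2) inner_normalised_Mg
    proof eventually_elim
      case (elim x)
      have "isCont \<theta>' (g x)" using c\<theta>' by (simp add: continuous_on_eq_continuous_at)
      then have "(\<lambda>n. \<theta>' (f n x)) \<longlonglongrightarrow> \<theta>' (g x)" using elim(1) by (rule isCont_tendsto_compose)
      then show ?case using elim(2) by (auto simp: v_def intro: tendsto_mult_right)
    qed
    show "AE x in \<nu>. norm (v n x * (Mg x \<bullet> normalised_Mg x)) \<le> 2 * B" for n
      using inner_normalised_Mg by eventually_elim (simp add: vB)
    show "(\<lambda>x. v n x * (Mg x \<bullet> normalised_Mg x)) \<in> borel_measurable \<nu>" for n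
      using vm lim(3) by auto
  qed auto
  have "(\<lambda>n. (\<integral>x. v n x * (R (grad (f n) x) \<bullet> normalised_Mg x) \<partial>\<nu>)) \<longlonglongrightarrow> (\<integral>x. \<theta>' (g x) * u x \<partial>\<nu>)"
    using tendsto_add[OF lim(1) conv] by simp
  then have "(\<integral>x. \<theta>' (g x) * u x \<partial>\<nu>) \<le> pi * (b - a) * ?I"
    by (rule LIMSEQ_le_const2) (use est in auto)
  moreover have "(LINT x:{x. a < g x \<and> g x \<le> b}|\<nu>. u x) \<le> (\<integral>x. \<theta>' (g x) * u x \<partial>\<nu>)"
    unfolding set_lebesgue_integral_def
  proof (rule integral_mono)
    show "integrable \<nu> (\<lambda>x. indicator {x. a < g x \<and> g x \<le> b} x *\<^sub>R u x)"
      by (rule integrable_const_bound[of _ B]) (use B in \<open>auto simp: indicator_def intro!: AE_I2\<close>)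
    show "integrable \<nu> (\<lambda>x. \<theta>' (g x) * u x)"
      by (rule integrable_const_bound[of _ "2 * B"])
        (use tB in auto)
    show "indicator {x. a < g x \<and> g x \<le> b} x *\<^sub>R u x \<le> \<theta>' (g x) * u x" for x
    proof (cases "a < g x \<and> g x \<le> b")
      case True
      then show ?thesis using mult_right_mono[OF \<theta>'1[of "g x"] u(2)[of x]] by simp
    next
      case False
      then show ?thesis using \<theta>'0[of "g x"] u(2)[of x] by simp
    qed
  qed
  ultimately show ?thesis by (rule order_trans[rotated])
qed

text \<open>
  Here \<open>layer_by_parts\<close> is used with the exponent \<open>p / q\<close>, whose conjugate is \<open>p / (p - q)\<close>, the
  exponent required of \<open>\<Psi>\<close> and \<open>M\<^sup>*\<Psi>\<close> by Young's inequality.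
\<close>

lemma layer_estimate_unit:
  assumes q: "1 \<le> q" "q < p"
  obtains K where "0 \<le> K" "\<And>h a b. h \<in> Cb1 \<Longrightarrow> energy p h (\<lambda>x. R (grad h x)) \<le> 1 \<Longrightarrow> a < b \<Longrightarrow>
     (LINT x:{x. a < g x \<and> g x \<le> b}|\<nu>. \<bar>h x\<bar> powr q) \<le> K * (b - a)"
proof -
  define p0 t where "p0 = p / q" and "t = p / (p - q)"
  have p0: "1 < p0" "p0 / (p0 - 1) = t" and pq: "0 < p" "0 < p - q" "0 < q"
    using q by (auto simp: p0_def t_def field_simps)
  obtain h0 where h0: "normalised_Mg \<in> Lp \<nu> t" "h0 \<in> Lp \<nu> t"
    "\<And>u. u \<in> Cb1 \<Longrightarrow> (\<integral>x. R (grad u x) \<bullet> normalised_Mg x \<partial>\<nu>) = (\<integral>x. u x * h0 x \<partial>\<nu>)"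
    by (rule normalised_Mg_adjointE[OF p0(1), unfolded p0(2)]) (rule that)
  define K where "K = pi * (2 powr p * 2 + Lp_mass \<nu> t h0 + q * (2 powr p * 2 + 1 + Lp_mass \<nu> t normalised_Mg))"
  have "0 \<le> K" using pq by (simp add: K_def)
  moreover have "(LINT x:{x. a < g x \<and> g x \<le> b}|\<nu>. \<bar>h x\<bar> powr q) \<le> K * (b - a)"
    if h: "h \<in> Cb1" "energy p h (\<lambda>x. R (grad h x)) \<le> 1" and ab: "a < b" for h a b
  proof -
    define w where "w = (\<lambda>x. sqrt (1 + (h x)\<^sup>2))"
    define u where "u = (\<lambda>x. w x powr q)"
    note comp = Cb1_compose[OF h(1) regularised_power_derivative(1,2), of q]
    have u: "u \<in> Cb1" unfolding u_def w_def by (rule comp(1))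
    have w1: "1 \<le> w x" for x by (simp add: w_def)
    have gu: "norm (R (grad u x)) \<le> q * w x powr (q - 1) * norm (R (grad h x))" for x
      unfolding u_def w_def comp(2) linear_cmul[OF bounded_linear.linear[OF bounded_linear_R]] norm_scaleR
      using regularised_power_derivative(3)[OF q(1)] by (intro mult_right_mono) auto
    have hu: "\<bar>h x\<bar> powr q \<le> u x" for x
      unfolding u_def using pq by (intro powr_mono2) (auto simp: w_def intro!: real_le_rsqrt)
    let ?A = "\<lambda>x. 2 powr p * (1 + \<bar>h x\<bar> powr p)"
    let ?D = "\<lambda>x. norm (R (grad h x)) powr p"
    let ?Z = "\<lambda>x. norm (normalised_Mg x) powr t"
    have pw: "u x * \<bar>h0 x\<bar> + norm (R (grad u x)) * norm (normalised_Mg x) \<le>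
       ?A x + \<bar>h0 x\<bar> powr t + q * (?A x + ?D x + ?Z x)" for x
    proof (rule add_mono)
      show "u x * \<bar>h0 x\<bar> \<le> ?A x + \<bar>h0 x\<bar> powr t"
        unfolding u_def w_def by (rule regularised_power_bounds(1)[OF q t_def, of 0]) auto
      have "norm (R (grad u x)) * norm (normalised_Mg x) \<le>
         q * w x powr (q - 1) * norm (R (grad h x)) * norm (normalised_Mg x)"
        using gu by (intro mult_right_mono) auto
      also have "\<dots> = q * (w x powr (q - 1) * norm (R (grad h x)) * norm (normalised_Mg x))"
        by (simp only: mult_ac)
      also have "\<dots> \<le> q * (?A x + ?D x + ?Z x)"
        unfolding w_def using pq
        by (intro mult_left_mono regularised_power_bounds(2)[OF q t_def]) auto
      finally show "norm (R (grad u x)) * norm (normalised_Mg x) \<le> q * (?A x + ?D x + ?Z x)" .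
    qed
    have i: "integrable \<nu> (\<lambda>x. \<bar>h x\<bar> powr p)" "integrable \<nu> ?D" "integrable \<nu> ?Z"
        "integrable \<nu> (\<lambda>x. \<bar>h0 x\<bar> powr t)"
      using Cb1_Lp[OF h(1), of p] h0 pq by (auto simp: Lp_def)
    have ir: "integrable \<nu> (\<lambda>x. ?A x + \<bar>h0 x\<bar> powr t + q * (?A x + ?D x + ?Z x))"
      using i by (intro Bochner_Integration.integrable_add integrable_mult_right) auto
    have m: "Lp_mass \<nu> p h \<le> 1" "Lp_mass \<nu> p (\<lambda>x. R (grad h x)) \<le> 1"
      using h(2) Lp_mass_nonneg[where N=\<nu> and p=p and f=h]
        Lp_mass_nonneg[where N=\<nu> and p=p and f="\<lambda>x. R (grad h x)"] by linarith+
    have "(\<integral>x. u x * \<bar>h0 x\<bar> + norm (R (grad u x)) * norm (normalised_Mg x) \<partial>\<nu>) \<le>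
       (\<integral>x. ?A x + \<bar>h0 x\<bar> powr t + q * (?A x + ?D x + ?Z x) \<partial>\<nu>)"
      by (rule integral_mono_AE'[OF ir])
        (use pw pq in \<open>auto intro!: AE_I2 add_nonneg_nonneg mult_nonneg_nonneg\<close>)
    also have "\<dots> = 2 powr p * (1 + Lp_mass \<nu> p h) + Lp_mass \<nu> t h0
       + q * (2 powr p * (1 + Lp_mass \<nu> p h) + Lp_mass \<nu> p (\<lambda>x. R (grad h x)) + Lp_mass \<nu> t normalised_Mg)"
      using i prob_space by (simp add: Lp_mass_def)
    also have "\<dots> \<le> 2 powr p * (1 + 1) + Lp_mass \<nu> t h0 + q * (2 powr p * (1 + 1) + 1 + Lp_mass \<nu> t normalised_Mg)"
      using m pq by (intro add_mono mult_left_mono) auto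
    finally have I: "(\<integral>x. u x * \<bar>h0 x\<bar> + norm (R (grad u x)) * norm (normalised_Mg x) \<partial>\<nu>) \<le> \<dots>" .
    have "(LINT x:{x. a < g x \<and> g x \<le> b}|\<nu>. \<bar>h x\<bar> powr q) \<le> (LINT x:{x. a < g x \<and> g x \<le> b}|\<nu>. u x)"
    proof -
      have iu: "integrable \<nu> (\<lambda>x. indicator {x. a < g x \<and> g x \<le> b} x *\<^sub>R u x)"
        using Lp_imp_integrable[OF Cb1_Lp(1)[OF u], of 1] by (intro integrable_mult_indicator) auto
      show ?thesis unfolding set_lebesgue_integral_def
        by (rule integral_mono_AE'[OF iu]) (use hu in \<open>auto simp: indicator_def u_def\<close>)
    qed
    also have "\<dots> \<le> pi * (b - a) * (\<integral>x. u x * \<bar>h0 x\<bar> + norm (R (grad u x)) * norm (normalised_Mg x) \<partial>\<nu>)"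
      by (rule layer_by_parts[OF p0(1)]) (use h0 u ab in \<open>auto simp: p0(2) u_def\<close>)
    also have "\<dots> \<le> pi * (b - a) * (2 powr p * (1 + 1) + Lp_mass \<nu> t h0 + q * (2 powr p * (1 + 1) + 1 + Lp_mass \<nu> t normalised_Mg))"
      using I ab by (intro mult_left_mono) auto
    also have "\<dots> = K * (b - a)" by (simp add: K_def mult_ac)
    finally show ?thesis .
  qed
  ultimately show ?thesis by (rule that)
qed

text \<open>
  Homogeneity: apply the previous estimate to \<open>h / c\<close>.
\<close>

lemma layer_estimate:
  assumes q: "1 \<le> q" "q < p"
  obtains K where "0 \<le> K" "\<And>h c a b. h \<in> Cb1 \<Longrightarrow> 0 < c \<Longrightarrow>
     energy p h (\<lambda>x. R (grad h x)) \<le> c powr p \<Longrightarrow> a < b \<Longrightarrow>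
     (LINT x:{x. a < g x \<and> g x \<le> b}|\<nu>. \<bar>h x\<bar> powr q) \<le> K * c powr q * (b - a)"
proof -
  obtain K where K: "0 \<le> K" "\<And>h a b. h \<in> Cb1 \<Longrightarrow> energy p h (\<lambda>x. R (grad h x)) \<le> 1 \<Longrightarrow> a < b \<Longrightarrow>
     (LINT x:{x. a < g x \<and> g x \<le> b}|\<nu>. \<bar>h x\<bar> powr q) \<le> K * (b - a)"
    by (rule layer_estimate_unit[OF q]) (rule that)
  have "(LINT x:{x. a < g x \<and> g x \<le> b}|\<nu>. \<bar>h x\<bar> powr q) \<le> K * c powr q * (b - a)"
    if h: "h \<in> Cb1" and c: "0 < c" and e: "energy p h (\<lambda>x. R (grad h x)) \<le> c powr p" and ab: "a < b" for h c a b
  proof -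
    define k where "k = (\<lambda>x. (1 / c) * h x)"
    note s = Cb1_scale[OF h, of "1 / c"]
    have k: "k \<in> Cb1" unfolding k_def by (rule s(1))
    have gk: "(\<lambda>x. R (grad k x)) = (\<lambda>x. (1 / c) *\<^sub>R R (grad h x))"
      unfolding k_def s(2) using bounded_linear.linear[OF bounded_linear_R] by (simp add: linear_cmul)
    have p: "0 \<le> p" using q by simp
    have "energy p k (\<lambda>x. R (grad k x)) = \<bar>1 / c\<bar> powr p * energy p h (\<lambda>x. R (grad h x))"
      unfolding gk Lp_scaleR(2)[OF Cb1_Lp(2)[OF h p]] distrib_left
      using Lp_scaleR(2)[OF Cb1_Lp(1)[OF h p], of "1 / c"] by (simp add: k_def)
    also have "\<dots> \<le> \<bar>1 / c\<bar> powr p * c powr p" using e by (intro mult_left_mono) auto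
    also have "\<dots> = 1" using c by (simp flip: powr_mult)
    finally have "(LINT x:{x. a < g x \<and> g x \<le> b}|\<nu>. \<bar>k x\<bar> powr q) \<le> K * (b - a)"
      by (rule K(2)[OF k _ ab])
    moreover have "\<bar>k x\<bar> powr q = (1 / c) powr q * \<bar>h x\<bar> powr q" for x
    proof -
      have "\<bar>k x\<bar> = (1 / c) * \<bar>h x\<bar>" using c by (simp add: k_def abs_mult)
      then show ?thesis by (simp only: powr_mult)
    qed
    ultimately have le: "(1 / c) powr q * (LINT x:{x. a < g x \<and> g x \<le> b}|\<nu>. \<bar>h x\<bar> powr q) \<le> K * (b - a)"
      by simp
    have 1: "c powr q * (1 / c) powr q = 1" using c by (simp flip: powr_mult)
    have "c powr q * ((1 / c) powr q * y) = y" for y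
      unfolding mult.assoc[symmetric] 1 by (rule mult_1)
    with mult_left_mono[OF le, of "c powr q"]
    have "(LINT x:{x. a < g x \<and> g x \<le> b}|\<nu>. \<bar>h x\<bar> powr q) \<le> c powr q * (K * (b - a))"
      by (simp only: powr_ge_zero)
    then show ?thesis by (simp only: mult_ac)
  qed
  with K(1) show ?thesis by (rule that)
qed

text \<open>
  Both sides of the layer estimate with \<open>q = 1\<close> are stable under approximation in \<open>W\<^sup>1\<^sup>,\<^sup>p\<close>. The constant
  doubles because the energy of the approximating functions is only controlled by \<open>(2 c)\<^sup>p\<close>.
\<close>

lemma layer_estimate_W1p:
  assumes p: "1 < p"
  obtains K where "0 \<le> K" "\<And>f F c a b. (f, F) \<in> M_graph R \<nu> p \<Longrightarrow> 0 < c \<Longrightarrow>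
     energy p f F < c powr p \<Longrightarrow> a < b \<Longrightarrow>
     (LINT x:{x. a < g x \<and> g x \<le> b}|\<nu>. \<bar>f x\<bar>) \<le> K * c * (b - a)"
proof -
  obtain K where K: "0 \<le> K" "\<And>h c a b. h \<in> Cb1 \<Longrightarrow> 0 < c \<Longrightarrow>
     energy p h (\<lambda>x. R (grad h x)) \<le> c powr p \<Longrightarrow> a < b \<Longrightarrow>
     (LINT x:{x. a < g x \<and> g x \<le> b}|\<nu>. \<bar>h x\<bar> powr 1) \<le> K * c powr 1 * (b - a)"
    by (rule layer_estimate[OF order_refl p]) (rule that)
  have "(LINT x:{x. a < g x \<and> g x \<le> b}|\<nu>. \<bar>f x\<bar>) \<le> 2 * K * c * (b - a)"
    if f: "(f, F) \<in> M_graph R \<nu> p" and c: "0 < c" and e: "energy p f F < c powr p" and ab: "a < b" for f F c a b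
  proof -
    let ?A = "{x. a < g x \<and> g x \<le> b}"
    have p0: "0 < p" using p by simp
    obtain \<phi> where \<phi>: "\<And>n. \<phi> n \<in> Cb1" "Lp_tendsto \<nu> p \<phi> f" "Lp_tendsto \<nu> p (\<lambda>n x. R (grad (\<phi> n) x)) F"
      using f by (rule M_graphE) blast
    have "Lp_tendsto \<nu> 1 \<phi> f" by (rule Lp_tendsto_lower_exponent[OF _ _ \<phi>(2)]) (use p in auto)
    then have L1: "\<And>n. \<phi> n \<in> Lp \<nu> 1" "f \<in> Lp \<nu> 1" "(\<lambda>n. Lp_mass \<nu> 1 (\<lambda>x. \<phi> n x - f x)) \<longlonglongrightarrow> 0"
      by (simp_all add: Lp_tendsto_iff)
    have [measurable]: "f \<in> borel_measurable \<nu>" "\<phi> n \<in> borel_measurable \<nu>" for n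
      using L1 by (auto intro: Lp_measurable)
    have i: "integrable \<nu> (\<phi> n)" "integrable \<nu> f" for n using L1 by (simp_all add: Lp_1_integrable)
    have iA: "integrable \<nu> (\<lambda>x. indicator ?A x *\<^sub>R h x)" if "integrable \<nu> h" for h :: "'a \<Rightarrow> real"
      by (rule integrable_mult_indicator[OF _ that]) simp
    have "(LINT x:?A|\<nu>. \<bar>f x\<bar>) \<le> (LINT x:?A|\<nu>. \<bar>\<phi> n x\<bar>) + Lp_mass \<nu> 1 (\<lambda>x. \<phi> n x - f x)" for n
    proof -
      have "(LINT x:?A|\<nu>. \<bar>f x\<bar>) \<le> (\<integral>x. indicator ?A x *\<^sub>R \<bar>\<phi> n x\<bar> + \<bar>\<phi> n x - f x\<bar> \<partial>\<nu>)"
        unfolding set_lebesgue_integral_def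
        by (rule integral_mono) (use i iA[of "\<lambda>x. \<bar>f x\<bar>"] iA[of "\<lambda>x. \<bar>\<phi> n x\<bar>"] in \<open>auto simp: indicator_def\<close>)
      also have "\<dots> = (LINT x:?A|\<nu>. \<bar>\<phi> n x\<bar>) + (\<integral>x. \<bar>\<phi> n x - f x\<bar> \<partial>\<nu>)"
        unfolding set_lebesgue_integral_def
        by (rule Bochner_Integration.integral_add) (use i iA[of "\<lambda>x. \<bar>\<phi> n x\<bar>"] in auto)
      finally show ?thesis by (simp add: Lp_mass_def)
    qed
    note split = this
    have "\<forall>\<^sub>F n in sequentially. (LINT x:?A|\<nu>. \<bar>f x\<bar>) \<le> K * (2 * c) * (b - a) + Lp_mass \<nu> 1 (\<lambda>x. \<phi> n x - f x)"
      using energy_eventually_less[OF p0 \<phi>(2,3) e c]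
    proof eventually_elim
      case (elim n)
      have "(LINT x:?A|\<nu>. \<bar>\<phi> n x\<bar>) \<le> K * (2 * c) * (b - a)"
        using K(2)[OF \<phi>(1) _ elim ab] c by simp
      then show ?case using split[of n] by linarith
    qed
    note ev = this
    have "(\<lambda>n. K * (2 * c) * (b - a) + Lp_mass \<nu> 1 (\<lambda>x. \<phi> n x - f x)) \<longlonglongrightarrow> K * (2 * c) * (b - a) + 0"
      using L1(3) by (intro tendsto_add tendsto_const)
    from tendsto_lowerbound[OF this ev sequentially_bot]
    have "(LINT x:?A|\<nu>. \<bar>f x\<bar>) \<le> K * (2 * c) * (b - a) + 0" .
    then show ?thesis by (simp add: mult_ac)
  qed
  note * = this
  have "0 \<le> 2 * K" using K(1) by simp
  from this * show ?thesis by (rule that)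
qed

lemma level_integral_diff:
  fixes f :: "'a \<Rightarrow> real"
  assumes "integrable \<nu> f" "a \<le> b"
  shows "(LINT x:{x. g x \<le> b}|\<nu>. f x) - (LINT x:{x. g x \<le> a}|\<nu>. f x) =
    (LINT x:{x. a < g x \<and> g x \<le> b}|\<nu>. f x)"
proof -
  have i: "integrable \<nu> (\<lambda>x. indicator {x. g x \<le> c} x *\<^sub>R f x)" for c
    by (rule integrable_mult_indicator[OF _ assms(1)]) simp
  show ?thesis
    unfolding set_lebesgue_integral_def Bochner_Integration.integral_diff[OF i i, symmetric]
    by (rule Bochner_Integration.integral_cong) (use assms(2) in \<open>auto simp: indicator_def\<close>)
qed

lemma level_integral_Lipschitz:
  fixes f :: "'a \<Rightarrow> real"
  assumes f: "integrable \<nu> f"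
    and L: "\<And>a b. a < b \<Longrightarrow> (LINT x:{x. a < g x \<and> g x \<le> b}|\<nu>. \<bar>f x\<bar>) \<le> C * (b - a)"
  shows "\<bar>(LINT x:{x. g x \<le> s}|\<nu>. f x) - (LINT x:{x. g x \<le> r}|\<nu>. f x)\<bar> \<le> C * \<bar>s - r\<bar>"
proof -
  have *: "\<bar>(LINT x:{x. g x \<le> b}|\<nu>. f x) - (LINT x:{x. g x \<le> a}|\<nu>. f x)\<bar> \<le> C * (b - a)" if "a < b" for a b
  proof -
    have "\<bar>LINT x:{x. a < g x \<and> g x \<le> b}|\<nu>. f x\<bar> \<le> (LINT x:{x. a < g x \<and> g x \<le> b}|\<nu>. \<bar>f x\<bar>)"
      unfolding set_lebesgue_integral_def
      using integral_abs_bound[of \<nu> "\<lambda>x. indicator {x. a < g x \<and> g x \<le> b} x *\<^sub>R f x"]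
      by (simp add: abs_mult)
    also have "\<dots> \<le> C * (b - a)" by (rule L[OF that])
    finally show ?thesis using level_integral_diff[OF f, of a b] that by simp
  qed
  consider "r < s" | "s < r" | "s = r" by linarith
  then show ?thesis
  proof cases
    case 1 then show ?thesis using *[of r s] by simp
  next
    case 2 then show ?thesis using *[of s r] by (simp add: abs_minus_commute)
  qed simp
qed

end

section \<open>Traces on the surface\<close>

locale surface_setting = level_set_setting +
  fixes r :: real and \<sigma> :: "'a measure"
  assumes surface: "is_surface_measure \<nu> g r \<sigma>"
begin

sublocale sigma: finite_measure \<sigma>
  using surface by (simp add: is_surface_measure_def)

lemma sets_sigma [measurable_cong, simp]: "sets \<sigma> = sets borel"
  using surface by (simp add: is_surface_measure_def)

lemma space_sigma [simp]: "space \<sigma> = UNIV"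
  using sets_eq_imp_space_eq[OF sets_sigma] by simp

lemma level_derivative_Cb:
  "\<rho> \<in> Cb \<Longrightarrow> ((\<lambda>s. LINT x:{x. g x \<le> s}|\<nu>. \<rho> x) has_real_derivative (\<integral>x. \<rho> x \<partial>\<sigma>)) (at r)"
  using surface by (simp add: is_surface_measure_def)

lemma Cb_integrable:
  assumes "\<rho> \<in> Cb"
  shows "\<rho> \<in> borel_measurable borel" "integrable \<nu> \<rho>" "integrable \<sigma> \<rho>"
proof -
  obtain B where B: "\<And>x. \<bar>\<rho> x\<bar> \<le> B" using assms by (auto simp: Cb_def bounded_iff)
  show m [measurable]: "\<rho> \<in> borel_measurable borel"
    using assms by (auto simp: Cb_def intro: borel_measurable_continuous_onI)
  show "integrable \<nu> \<rho>" by (rule integrable_const_bound[of _ B]) (use B in auto)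
  show "integrable \<sigma> \<rho>" by (rule sigma.integrable_const_bound[of _ B]) (use B in auto)
qed

text \<open>
  The left-hand side is the derivative at \<open>r\<close> of the integral of \<open>\<rho>\<close> over the sublevel sets, and the
  premise bounds the difference quotients from the right.
\<close>

lemma surface_integral_le:
  assumes \<rho>: "\<rho> \<in> Cb"
    and L: "\<And>s. r < s \<Longrightarrow> (LINT x:{x. r < g x \<and> g x \<le> s}|\<nu>. \<rho> x) \<le> C * (s - r)"
  shows "(\<integral>x. \<rho> x \<partial>\<sigma>) \<le> C"
proof -
  let ?F = "\<lambda>s. LINT x:{x. g x \<le> s}|\<nu>. \<rho> x"
  have "((\<lambda>s. (?F s - ?F r) / (s - r)) \<longlongrightarrow> (\<integral>x. \<rho> x \<partial>\<sigma>)) (at_right r)"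
    using level_derivative_Cb[OF \<rho>] unfolding has_field_derivative_iff
    by (rule filterlim_mono) (simp_all add: at_le)
  moreover have "\<forall>\<^sub>F s in at_right r. (?F s - ?F r) / (s - r) \<le> C"
    unfolding eventually_at_filter
  proof (intro always_eventually allI impI)
    fix s assume "s \<in> {r<..}"
    then have s: "r < s" by simp
    show "(?F s - ?F r) / (s - r) \<le> C"
      using L[OF s] level_integral_diff[OF Cb_integrable(2)[OF \<rho>], of r s] s by (simp add: divide_le_eq)
  qed
  ultimately show ?thesis by (rule tendsto_upperbound) simp
qed

lemma Cb1_Cb_powr:
  assumes "h \<in> Cb1" "0 < q"
  shows "(\<lambda>x. \<bar>h x\<bar> powr q) \<in> Cb"
proof -
  obtain B where B: "\<And>x. \<bar>h x\<bar> \<le> B" using Cb1_bounded[OF assms(1)] by metis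
  have "continuous_on UNIV (\<lambda>x. \<bar>h x\<bar> powr q)"
    using assms by (intro continuous_on_powr' continuous_on_rabs Cb1_continuous continuous_on_const) auto
  moreover have "norm (\<bar>h x\<bar> powr q) \<le> B powr q" for x
    using B assms by (auto intro!: powr_mono2)
  ultimately show ?thesis unfolding Cb_def bounded_iff by blast
qed

lemma Cb1_Cb: "h \<in> Cb1 \<Longrightarrow> h \<in> Cb"
  using Cb1_continuous by (auto simp: Cb_def Cb1_def)

lemma Cb1_Lp_sigma:
  assumes "h \<in> Cb1" "0 \<le> q"
  shows "h \<in> Lp \<sigma> q"
proof -
  obtain B where B: "\<And>x. \<bar>h x\<bar> \<le> B" using Cb1_bounded[OF assms(1)] by metis
  show ?thesis by (rule sigma.Lp_bounded[of _ B]) (use B assms Cb1_measurable[OF assms(1)] in auto)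
qed

text \<open>
  The function \<open>\<bar>h\<bar>\<^sup>q\<close> is bounded and continuous, so \<open>\<sigma>\<close> integrates it by differentiating layer masses.
\<close>

lemma surface_estimate:
  assumes q: "1 \<le> q" "q < p"
  obtains K where "0 \<le> K" "\<And>h c. h \<in> Cb1 \<Longrightarrow> 0 < c \<Longrightarrow>
     energy p h (\<lambda>x. R (grad h x)) \<le> c powr p \<Longrightarrow> Lp_mass \<sigma> q h \<le> K * c powr q"
proof -
  obtain K where K: "0 \<le> K" "\<And>h c a b. h \<in> Cb1 \<Longrightarrow> 0 < c \<Longrightarrow>
     energy p h (\<lambda>x. R (grad h x)) \<le> c powr p \<Longrightarrow> a < b \<Longrightarrow>
     (LINT x:{x. a < g x \<and> g x \<le> b}|\<nu>. \<bar>h x\<bar> powr q) \<le> K * c powr q * (b - a)"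
    by (rule layer_estimate[OF q]) (rule that)
  have "Lp_mass \<sigma> q h \<le> K * c powr q"
    if h: "h \<in> Cb1" "0 < c" "energy p h (\<lambda>x. R (grad h x)) \<le> c powr p" for h c
    using surface_integral_le[OF Cb1_Cb_powr[OF h(1)] K(2)[OF h]] q by (simp add: Lp_mass_def)
  with K(1) show ?thesis by (rule that)
qed

lemma surface_mass_small:
  assumes q: "1 \<le> q" "q < p" and e: "0 < e"
  obtains \<delta> where "0 < \<delta>"
    "\<And>h. h \<in> Cb1 \<Longrightarrow> energy p h (\<lambda>x. R (grad h x)) \<le> \<delta> \<Longrightarrow> Lp_mass \<sigma> q h \<le> e"
proof -
  obtain K where K: "0 \<le> K" "\<And>h c. h \<in> Cb1 \<Longrightarrow> 0 < c \<Longrightarrow>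
     energy p h (\<lambda>x. R (grad h x)) \<le> c powr p \<Longrightarrow> Lp_mass \<sigma> q h \<le> K * c powr q"
    by (rule surface_estimate[OF q]) (rule that)
  define c where "c = (e / (K + 1)) powr (1 / q)"
  have ek: "0 < e / (K + 1)" using K(1) e by (intro divide_pos_pos) auto
  then have c: "0 < c" unfolding c_def powr_gt_zero by linarith
  have "c powr q = (e / (K + 1)) powr 1" using q unfolding c_def powr_powr by simp
  also have "\<dots> = e / (K + 1)" by (rule powr_one) (use ek in linarith)
  finally have "c powr q = e / (K + 1)" .
  then have "K * c powr q \<le> e" using K(1) e by (simp add: pos_divide_le_eq mult_right_mono)
  show ?thesis
  proof (rule that[of "c powr p"])
    show "0 < c powr p" using c by simp
    fix h assume h: "h \<in> Cb1" "energy p h (\<lambda>x. R (grad h x)) \<le> c powr p"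
    show "Lp_mass \<sigma> q h \<le> e" using K(2)[OF h(1) c h(2)] \<open>K * c powr q \<le> e\<close> by linarith
  qed
qed

lemma surface_mass_tendsto_0:
  assumes q: "1 \<le> q" "q < p"
    and h: "\<And>n. h n \<in> Cb1" "(\<lambda>n. energy p (h n) (\<lambda>x. R (grad (h n) x))) \<longlonglongrightarrow> 0"
  shows "(\<lambda>n. Lp_mass \<sigma> q (h n)) \<longlonglongrightarrow> 0"
proof (rule tendstoI)
  fix e :: real assume "0 < e"
  then have e2: "0 < e / 2" by simp
  obtain \<delta> where \<delta>: "0 < \<delta>"
    "\<And>h. h \<in> Cb1 \<Longrightarrow> energy p h (\<lambda>x. R (grad h x)) \<le> \<delta> \<Longrightarrow> Lp_mass \<sigma> q h \<le> e / 2"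
    by (rule surface_mass_small[OF q e2]) (rule that)
  show "\<forall>\<^sub>F n in sequentially. dist (Lp_mass \<sigma> q (h n)) 0 < e"
    using order_tendstoD(2)[OF h(2) \<delta>(1)]
  proof eventually_elim
    case (elim n)
    then show ?case using \<delta>(2)[OF h(1)[of n]] \<open>0 < e\<close> by simp
  qed
qed

text \<open>
  The energy of \<open>\<phi>\<^sub>m - \<phi>\<^sub>n\<close> is small because both functions are close to \<open>f\<close>.
\<close>

lemma surface_Cauchy:
  assumes q: "1 \<le> q" "q < p" and e: "0 < e"
    and \<phi>: "\<And>n. \<phi> n \<in> Cb1" "Lp_tendsto \<nu> p \<phi> f" "Lp_tendsto \<nu> p (\<lambda>n x. R (grad (\<phi> n) x)) F"
  obtains n0 where "\<And>m n. n0 \<le> m \<Longrightarrow> n0 \<le> n \<Longrightarrow> Lp_mass \<sigma> q (\<lambda>x. \<phi> m x - \<phi> n x) \<le> e"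
proof -
  obtain \<delta> where \<delta>: "0 < \<delta>"
    "\<And>h. h \<in> Cb1 \<Longrightarrow> energy p h (\<lambda>x. R (grad h x)) \<le> \<delta> \<Longrightarrow> Lp_mass \<sigma> q h \<le> e"
    by (rule surface_mass_small[OF q e]) (rule that)
  have p: "0 < p" using q by simp
  let ?E = "\<lambda>n. energy p (\<lambda>x. \<phi> n x - f x) (\<lambda>x. R (grad (\<phi> n) x) - F x)"
  have "(\<lambda>n. 2 powr p * ?E n) \<longlonglongrightarrow> 2 powr p * 0"
    by (intro tendsto_mult_left energy_diff_tendsto p \<phi>)
  then have "\<forall>\<^sub>F n in sequentially. 2 powr p * ?E n < \<delta> / 2"
    by (rule order_tendstoD(2)) (use \<delta>(1) in simp)
  then obtain n0 where n0: "\<And>n. n0 \<le> n \<Longrightarrow> 2 powr p * ?E n < \<delta> / 2"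
    unfolding eventually_sequentially by blast
  have L: "\<phi> n \<in> Lp \<nu> p" "f \<in> Lp \<nu> p" "(\<lambda>x. R (grad (\<phi> n) x)) \<in> Lp \<nu> p" "F \<in> Lp \<nu> p" for n
    using \<phi>(2,3) by (simp_all add: Lp_tendsto_def)
  show ?thesis
  proof (rule that[of n0])
    fix m n assume mn: "n0 \<le> m" "n0 \<le> n"
    note d = Cb1_diff[OF \<phi>(1)[of m] \<phi>(1)[of n]]
    have "energy p (\<lambda>x. \<phi> m x - \<phi> n x) (\<lambda>x. R (grad (\<lambda>x. \<phi> m x - \<phi> n x) x)) \<le> 2 powr p * (?E m + ?E n)"
      using energy_diff_le[OF p Lp_diff(1)[OF p L(1,2)] Lp_diff(1)[OF p L(1,2)]
          Lp_diff(1)[OF p L(3,4)] Lp_diff(1)[OF p L(3,4)], of m n m n]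
      by (simp add: d(2) linear_diff[OF bounded_linear.linear[OF bounded_linear_R]])
    also have "\<dots> \<le> \<delta>" using n0[OF mn(1)] n0[OF mn(2)] by (simp add: distrib_left)
    finally show "Lp_mass \<sigma> q (\<lambda>x. \<phi> m x - \<phi> n x) \<le> e" by (rule \<delta>(2)[OF d(1)])
  qed
qed

text \<open>
  One \<open>\<psi>\<close> serves for all \<open>q\<close>: it is the \<open>\<sigma>\<close>-almost everywhere limit of a subsequence of one fixed
  approximating sequence, which is Cauchy in each \<open>L\<^sup>q(\<sigma>)\<close>, and Fatou's lemma identifies its limit there.
  Any other approximating sequence differs from this one by a sequence of vanishing energy.
\<close>

lemma trace_exists:
  assumes p: "1 < p" and f: "f \<in> W1p R \<nu> p"
  shows "\<exists>\<psi>. \<forall>q \<eta>. 1 \<le> q \<longrightarrow> q < p \<longrightarrow> (\<forall>n. \<eta> n \<in> Cb1) \<longrightarrow>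
    W1p_tendsto R \<nu> p \<eta> f \<longrightarrow> Lp_tendsto \<sigma> q \<eta> \<psi>"
proof -
  define F where "F = Mp R \<nu> p f"
  have fF: "(f, F) \<in> M_graph R \<nu> p" unfolding F_def using f by (rule Mp_graph)
  have p0: "0 < p" using p by simp
  obtain \<phi> where \<phi>: "\<And>n. \<phi> n \<in> Cb1" "Lp_tendsto \<nu> p \<phi> f" "Lp_tendsto \<nu> p (\<lambda>n x. R (grad (\<phi> n) x)) F"
    using fF by (rule M_graphE) (rule that)
  have cau: "\<exists>n0. \<forall>m\<ge>n0. \<forall>n\<ge>n0. Lp_mass \<sigma> q (\<lambda>x. \<phi> m x - \<phi> n x) \<le> e"
    if "1 \<le> q" "q < p" "0 < e" for q e :: real
    by (rule surface_Cauchy[OF that \<phi>]) blast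
  obtain s \<psi> where s: "filterlim s at_top sequentially" and \<psi>: "\<psi> \<in> borel_measurable \<sigma>"
    and ae: "AE x in \<sigma>. (\<lambda>k. \<phi> (s k) x) \<longlonglongrightarrow> \<psi> x"
    by (rule Lp_Cauchy_AE_limit[of \<phi> \<sigma>, OF Cb1_Lp_sigma[OF \<phi>(1)] cau[OF order_refl p]]) (auto intro: that)
  have main: "Lp_tendsto \<sigma> q \<phi> \<psi>" if q: "1 \<le> q" "q < p" for q
  proof -
    have q0: "0 < q" using q by simp
    have L: "\<phi> n \<in> Lp \<sigma> q" for n using \<phi>(1) q0 by (intro Cb1_Lp_sigma) auto
    have tail: "\<exists>n0. \<forall>n\<ge>n0. (\<lambda>x. \<psi> x - \<phi> n x) \<in> Lp \<sigma> q \<and> Lp_mass \<sigma> q (\<lambda>x. \<psi> x - \<phi> n x) \<le> e" if e: "0 < e" for e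
    proof -
      obtain n0 where n0: "\<And>m n. n0 \<le> m \<Longrightarrow> n0 \<le> n \<Longrightarrow> Lp_mass \<sigma> q (\<lambda>x. \<phi> m x - \<phi> n x) \<le> e"
        using cau[OF q e] by blast
      have "(\<lambda>x. \<psi> x - \<phi> n x) \<in> Lp \<sigma> q \<and> Lp_mass \<sigma> q (\<lambda>x. \<psi> x - \<phi> n x) \<le> e" if n: "n0 \<le> n" for n
      proof -
        have u: "(\<lambda>x. \<phi> (s k) x - \<phi> n x) \<in> Lp \<sigma> q" for k by (rule Lp_diff(1)[OF q0 L L])
        have v: "(\<lambda>x. \<psi> x - \<phi> n x) \<in> borel_measurable \<sigma>"
          by (rule borel_measurable_diff[OF \<psi> Lp_measurable[OF L]])
        have ae': "AE x in \<sigma>. (\<lambda>k. \<phi> (s k) x - \<phi> n x) \<longlonglongrightarrow> \<psi> x - \<phi> n x"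
          using ae by eventually_elim (rule tendsto_diff[OF _ tendsto_const])
        have "\<forall>\<^sub>F k in sequentially. n0 \<le> s k" using s by (simp add: filterlim_at_top)
        then have B: "\<forall>\<^sub>F k in sequentially. Lp_mass \<sigma> q (\<lambda>x. \<phi> (s k) x - \<phi> n x) \<le> e"
          by eventually_elim (rule n0[OF _ n])
        show ?thesis using Lp_Fatou[OF q0 u v ae' B] by simp
      qed
      then show ?thesis by blast
    qed
    obtain n0 where n0: "(\<lambda>x. \<psi> x - \<phi> n0 x) \<in> Lp \<sigma> q" using tail[OF zero_less_one] by blast
    have \<psi>q: "\<psi> \<in> Lp \<sigma> q" using Lp_add(1)[OF q0 n0 L[of n0]] by simp
    have sym: "Lp_mass \<sigma> q (\<lambda>x. \<phi> n x - \<psi> x) = Lp_mass \<sigma> q (\<lambda>x. \<psi> x - \<phi> n x)" for n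
      by (simp add: Lp_mass_def abs_minus_commute)
    have "(\<lambda>n. Lp_mass \<sigma> q (\<lambda>x. \<phi> n x - \<psi> x)) \<longlonglongrightarrow> 0"
    proof (rule LIMSEQ_I)
      fix e :: real assume e: "0 < e"
      then obtain n0 where n0: "\<And>n. n0 \<le> n \<Longrightarrow> Lp_mass \<sigma> q (\<lambda>x. \<psi> x - \<phi> n x) \<le> e / 2"
        using tail[of "e / 2"] by auto
      have "norm (Lp_mass \<sigma> q (\<lambda>x. \<phi> n x - \<psi> x) - 0) < e" if "n0 \<le> n" for n
        using n0[OF that] e by (simp add: sym)
      then show "\<exists>n0. \<forall>n\<ge>n0. norm (Lp_mass \<sigma> q (\<lambda>x. \<phi> n x - \<psi> x) - 0) < e" by blast
    qed
    then show ?thesis using L \<psi>q by (simp add: Lp_tendsto_iff[OF q0])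
  qed
  show ?thesis
  proof (intro exI[of _ \<psi>] allI impI)
    fix q \<eta> assume q: "1 \<le> q" "q < p" and "\<forall>n. \<eta> n \<in> Cb1" "W1p_tendsto R \<nu> p \<eta> f"
    then have \<eta>: "\<And>n. \<eta> n \<in> Cb1" "W1p_tendsto R \<nu> p \<eta> f" by simp_all
    have q0: "0 < q" using q by simp
    have \<eta>': "Lp_tendsto \<nu> p \<eta> f" "Lp_tendsto \<nu> p (\<lambda>n x. R (grad (\<eta> n) x)) F"
      using W1p_tendsto_iff[OF p \<eta>(1) fF] \<eta>(2) by simp_all
    note d = Cb1_diff[OF \<eta>(1) \<phi>(1)]
    have "(\<lambda>n. energy p (\<lambda>x. \<eta> n x - \<phi> n x) (\<lambda>x. R (grad (\<lambda>x. \<eta> n x - \<phi> n x) x))) \<longlonglongrightarrow> 0"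
      using energy_diff_tendsto[OF p0 Lp_tendsto_diff[OF p0 \<eta>'(1) \<phi>(2)] Lp_tendsto_diff[OF p0 \<eta>'(2) \<phi>(3)]]
      by (simp add: d(2) linear_diff[OF bounded_linear.linear[OF bounded_linear_R]])
    then have z: "(\<lambda>n. Lp_mass \<sigma> q (\<lambda>x. \<eta> n x - \<phi> n x)) \<longlonglongrightarrow> 0"
      by (rule surface_mass_tendsto_0[OF q d(1)])
    have "Lp_tendsto \<sigma> q (\<lambda>n x. \<eta> n x - \<phi> n x) (\<lambda>x. 0)"
      using z Cb1_Lp_sigma[OF d(1)] Cb1_Lp_sigma[OF Cb1_const(1)] q0 by (simp add: Lp_tendsto_iff[OF q0])
    from Lp_tendsto_add[OF q0 this main[OF q]] show "Lp_tendsto \<sigma> q \<eta> \<psi>" by simp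
  qed
qed

lemma trace_unique:
  assumes p: "1 < p" and f: "f \<in> W1p R \<nu> p"
    and "is_trace R \<nu> \<sigma> p f \<psi>" "is_trace R \<nu> \<sigma> p f \<psi>'"
  shows "AE x in \<sigma>. \<psi>' x = \<psi> x"
proof -
  obtain \<phi> where \<phi>: "\<And>n. \<phi> n \<in> Cb1" "W1p_tendsto R \<nu> p \<phi> f" by (rule W1p_approx[OF p f]) (rule that)
  have "Lp_tendsto \<sigma> 1 \<phi> \<psi>'" "Lp_tendsto \<sigma> 1 \<phi> \<psi>" using assms(3,4) \<phi> by (auto simp: is_trace_def)
  then show ?thesis by (rule Lp_tendsto_unique[OF zero_less_one])
qed

lemma trace_op_is_trace:
  assumes p: "1 < p" and f: "f \<in> W1p R \<nu> p"
  shows "is_trace R \<nu> \<sigma> p f (trace_op R \<nu> \<sigma> p f)"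
proof -
  obtain \<psi> where \<psi>: "\<And>q \<eta>. 1 \<le> q \<Longrightarrow> q < p \<Longrightarrow> (\<And>n. \<eta> n \<in> Cb1) \<Longrightarrow>
    W1p_tendsto R \<nu> p \<eta> f \<Longrightarrow> Lp_tendsto \<sigma> q \<eta> \<psi>"
    using trace_exists[OF p f] by blast
  obtain \<phi> where \<phi>: "\<And>n. \<phi> n \<in> Cb1" "W1p_tendsto R \<nu> p \<phi> f" by (rule W1p_approx[OF p f]) (rule that)
  have "\<psi> \<in> Lp \<sigma> 1" using \<psi>[OF order_refl p \<phi>] by (simp add: Lp_tendsto_def)
  then have "is_trace R \<nu> \<sigma> p f \<psi>" using \<psi>[OF order_refl p] by (simp add: is_trace_def)
  then show ?thesis unfolding trace_op_def by (rule someI[where P="is_trace R \<nu> \<sigma> p f"])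
qed

lemma trace_op_limit:
  assumes q: "1 \<le> q" "q < p" and f: "f \<in> W1p R \<nu> p"
    and \<phi>: "\<And>n. \<phi> n \<in> Cb1" "W1p_tendsto R \<nu> p \<phi> f"
  shows "Lp_tendsto \<sigma> q \<phi> (trace_op R \<nu> \<sigma> p f)"
proof -
  have p: "1 < p" using q by simp
  obtain \<psi> where \<psi>: "\<And>q \<eta>. 1 \<le> q \<Longrightarrow> q < p \<Longrightarrow> (\<And>n. \<eta> n \<in> Cb1) \<Longrightarrow>
    W1p_tendsto R \<nu> p \<eta> f \<Longrightarrow> Lp_tendsto \<sigma> q \<eta> \<psi>"
    using trace_exists[OF p f] by blast
  have t: "trace_op R \<nu> \<sigma> p f \<in> Lp \<sigma> 1" "Lp_tendsto \<sigma> 1 \<phi> (trace_op R \<nu> \<sigma> p f)"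
    using trace_op_is_trace[OF p f] \<phi> by (auto simp: is_trace_def)
  have "AE x in \<sigma>. \<psi> x = trace_op R \<nu> \<sigma> p f x"
    by (rule Lp_tendsto_unique[OF zero_less_one \<psi>[OF order_refl p \<phi>] t(2)])
  with Lp_measurable[OF t(1)] show ?thesis
    using q by (intro Lp_tendsto_cong_AE[OF _ \<psi>[OF q \<phi>]]) auto
qed

lemma trace_op_AE_subseq:
  fixes k :: "nat \<Rightarrow> nat"
  assumes p: "1 < p" and f: "f \<in> W1p R \<nu> p"
    and \<phi>: "\<And>n. \<phi> n \<in> Cb1" "W1p_tendsto R \<nu> p \<phi> f" and k: "strict_mono k"
  obtains k' where "strict_mono k'" "AE x in \<sigma>. (\<lambda>n. \<phi> (k (k' n)) x) \<longlonglongrightarrow> trace_op R \<nu> \<sigma> p f x"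
  using Lp_tendsto_AE_subseq[OF zero_less_one Lp_tendsto_subseq[OF trace_op_limit[OF order_refl p f \<phi>] k]]
  by (auto intro: that)

lemma trace_op_add:
  assumes p: "1 < p" and f: "f \<in> W1p R \<nu> p" and h: "h \<in> W1p R \<nu> p"
  shows "AE x in \<sigma>. trace_op R \<nu> \<sigma> p (\<lambda>y. f y + h y) x = trace_op R \<nu> \<sigma> p f x + trace_op R \<nu> \<sigma> p h x"
proof -
  have p0: "0 < p" using p by simp
  obtain \<phi> where \<phi>: "\<And>n. \<phi> n \<in> Cb1" "W1p_tendsto R \<nu> p \<phi> f" by (rule W1p_approx[OF p f]) (rule that)
  obtain \<eta> where \<eta>: "\<And>n. \<eta> n \<in> Cb1" "W1p_tendsto R \<nu> p \<eta> h" by (rule W1p_approx[OF p h]) (rule that)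
  note \<phi>' = W1p_tendsto_iff[OF p \<phi>(1) Mp_graph[OF f], THEN iffD1, OF \<phi>(2)]
  note \<eta>' = W1p_tendsto_iff[OF p \<eta>(1) Mp_graph[OF h], THEN iffD1, OF \<eta>(2)]
  note a = Cb1_add[OF \<phi>(1) \<eta>(1)]
  note g = M_graph_add[OF p0 Mp_graph[OF f] Mp_graph[OF h]]
  have "W1p_tendsto R \<nu> p (\<lambda>n x. \<phi> n x + \<eta> n x) (\<lambda>x. f x + h x)"
    using W1p_tendsto_iff[OF p a(1) g] Lp_tendsto_add[OF p0 conjunct1[OF \<phi>'] conjunct1[OF \<eta>']]
      Lp_tendsto_add[OF p0 conjunct2[OF \<phi>'] conjunct2[OF \<eta>']]
    by (simp add: a(2) linear_add[OF bounded_linear.linear[OF bounded_linear_R]])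
  from trace_op_limit[OF order_refl p M_graph_W1p[OF g] a(1) this]
    Lp_tendsto_add[OF zero_less_one trace_op_limit[OF order_refl p f \<phi>] trace_op_limit[OF order_refl p h \<eta>]]
  show ?thesis by (rule Lp_tendsto_unique[OF zero_less_one])
qed

lemma trace_op_scale:
  assumes p: "1 < p" and f: "f \<in> W1p R \<nu> p"
  shows "AE x in \<sigma>. trace_op R \<nu> \<sigma> p (\<lambda>y. c * f y) x = c * trace_op R \<nu> \<sigma> p f x"
proof -
  have p0: "0 < p" using p by simp
  obtain \<phi> where \<phi>: "\<And>n. \<phi> n \<in> Cb1" "W1p_tendsto R \<nu> p \<phi> f" by (rule W1p_approx[OF p f]) (rule that)
  note \<phi>' = W1p_tendsto_iff[OF p \<phi>(1) Mp_graph[OF f], THEN iffD1, OF \<phi>(2)]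
  note a = Cb1_scale[OF \<phi>(1), of c]
  note g = M_graph_scale[OF p0 Mp_graph[OF f], of c]
  have "W1p_tendsto R \<nu> p (\<lambda>n x. c * \<phi> n x) (\<lambda>x. c * f x)"
    using W1p_tendsto_iff[OF p a(1) g] Lp_tendsto_scaleR[OF p0 conjunct1[OF \<phi>'], of c]
      Lp_tendsto_scaleR[OF p0 conjunct2[OF \<phi>'], of c]
    by (simp add: a(2) linear_cmul[OF bounded_linear.linear[OF bounded_linear_R]])
  from trace_op_limit[OF order_refl p M_graph_W1p[OF g] a(1) this]
    Lp_tendsto_scaleR[OF zero_less_one trace_op_limit[OF order_refl p f \<phi>], of c]
  show ?thesis unfolding real_scaleR_def by (rule Lp_tendsto_unique[OF zero_less_one])
qed

text \<open>
  For \<open>c\<close> slightly above twice the Sobolev norm of \<open>f\<close>, approximating functions eventually have energy at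
  most \<open>(2 c)\<^sup>p\<close>, and the surface estimate passes to the limit.
\<close>

lemma trace_op_bound:
  assumes q: "1 \<le> q" "q < p"
  obtains C where "\<And>f. f \<in> W1p R \<nu> p \<Longrightarrow> Lp_norm \<sigma> q (trace_op R \<nu> \<sigma> p f) \<le> C * W1p_norm R \<nu> p f"
proof -
  have p: "1 < p" "0 < p" and q0: "0 < q" using q by simp_all
  obtain K where K: "0 \<le> K" "\<And>h c. h \<in> Cb1 \<Longrightarrow> 0 < c \<Longrightarrow>
     energy p h (\<lambda>x. R (grad h x)) \<le> c powr p \<Longrightarrow> Lp_mass \<sigma> q h \<le> K * c powr q"
    by (rule surface_estimate[OF q]) (rule that)
  define C where "C = 4 * K powr (1 / q)"
  have C: "0 \<le> C" by (simp add: C_def)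
  have step: "Lp_norm \<sigma> q (trace_op R \<nu> \<sigma> p f) \<le> C * c"
    if f: "f \<in> W1p R \<nu> p" and c: "0 < c" and e: "energy p f (Mp R \<nu> p f) < c powr p" for f c
  proof -
    let ?T = "trace_op R \<nu> \<sigma> p f"
    obtain \<phi> where \<phi>: "\<And>n. \<phi> n \<in> Cb1" "W1p_tendsto R \<nu> p \<phi> f" by (rule W1p_approx[OF p(1) f]) (rule that)
    note \<phi>' = W1p_tendsto_iff[OF p(1) \<phi>(1) Mp_graph[OF f], THEN iffD1, OF \<phi>(2)]
    have T: "\<phi> n \<in> Lp \<sigma> q" "?T \<in> Lp \<sigma> q" "(\<lambda>n. Lp_mass \<sigma> q (\<lambda>x. \<phi> n x - ?T x)) \<longlonglongrightarrow> 0" for n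
      using trace_op_limit[OF q f \<phi>] by (simp_all add: Lp_tendsto_iff[OF q0])
    have le: "Lp_mass \<sigma> q ?T \<le> 2 powr q * (Lp_mass \<sigma> q (\<phi> n) + Lp_mass \<sigma> q (\<lambda>x. \<phi> n x - ?T x))" for n
      using Lp_diff(2)[OF q0 T(1) Lp_diff(1)[OF q0 T(1,2)], of n n] by simp
    have "\<forall>\<^sub>F n in sequentially. Lp_mass \<sigma> q ?T \<le>
        2 powr q * (K * (2 * c) powr q + Lp_mass \<sigma> q (\<lambda>x. \<phi> n x - ?T x))"
      using energy_eventually_less[OF p(2) conjunct1[OF \<phi>'] conjunct2[OF \<phi>'] e c]
    proof eventually_elim
      case (elim n)
      have "0 < 2 * c" using c by simp
      from K(2)[OF \<phi>(1) this elim] have "2 powr q * (Lp_mass \<sigma> q (\<phi> n) + Lp_mass \<sigma> q (\<lambda>x. \<phi> n x - ?T x)) \<le>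
          2 powr q * (K * (2 * c) powr q + Lp_mass \<sigma> q (\<lambda>x. \<phi> n x - ?T x))"
        by (intro mult_left_mono add_right_mono) auto
      with le[of n] show ?case by (rule order_trans)
    qed
    note ev = this
    have "(\<lambda>n. 2 powr q * (K * (2 * c) powr q + Lp_mass \<sigma> q (\<lambda>x. \<phi> n x - ?T x))) \<longlonglongrightarrow>
        2 powr q * (K * (2 * c) powr q + 0)"
      by (intro tendsto_mult_left tendsto_add tendsto_const T(3))
    from tendsto_lowerbound[OF this ev sequentially_bot]
    have "Lp_mass \<sigma> q ?T \<le> K * (2 powr q * (2 * c) powr q)" by (simp add: mult_ac)
    also have "2 powr q * (2 * c) powr q = (4 * c) powr q" by (simp flip: powr_mult)
    finally have "Lp_mass \<sigma> q ?T powr (1 / q) \<le> (K * (4 * c) powr q) powr (1 / q)"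
      using q0 by (intro powr_mono2) auto
    also have "\<dots> = K powr (1 / q) * (4 * c)" using q0 c by (simp add: powr_mult powr_powr)
    finally show ?thesis by (simp add: Lp_norm_def Lp_mass_def C_def mult_ac)
  qed
  show ?thesis
  proof (rule that[of "2 * C"])
    fix f assume f: "f \<in> W1p R \<nu> p"
    have W: "0 \<le> W1p_norm R \<nu> p f" by (simp add: W1p_norm_def Lp_norm_def)
    show "Lp_norm \<sigma> q (trace_op R \<nu> \<sigma> p f) \<le> 2 * C * W1p_norm R \<nu> p f"
    \<comment> \<open>The energy has to stay strictly below the p-th power of the constant c that is used,
        hence the excess d over twice the norm.\<close>
    proof (rule field_le_epsilon)
      fix e :: real assume e: "0 < e"
      define d where "d = e / (C + 1)"
      have d: "0 < d" "C * d \<le> e" using C e by (auto simp: d_def pos_divide_le_eq mult_right_mono)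
      have "energy p f (Mp R \<nu> p f) \<le> (2 * W1p_norm R \<nu> p f) powr p"
        by (rule M_graph_mass_le[OF p(1) Mp_graph[OF f] order_refl])
      also have "\<dots> < (2 * W1p_norm R \<nu> p f + d) powr p" using W d p by (intro powr_less_mono2) auto
      finally have "Lp_norm \<sigma> q (trace_op R \<nu> \<sigma> p f) \<le> C * (2 * W1p_norm R \<nu> p f + d)"
        using step[OF f, of "2 * W1p_norm R \<nu> p f + d"] W d by linarith
      then show "Lp_norm \<sigma> q (trace_op R \<nu> \<sigma> p f) \<le> 2 * C * W1p_norm R \<nu> p f + e"
        using d by (simp add: distrib_left)
    qed
  qed
qed

lemma trace_op_bounded_operator:
  assumes q: "1 \<le> q" "q < p"
  shows "bounded_operator_W1p_Lq R \<nu> p \<sigma> q (trace_op R \<nu> \<sigma> p)"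
proof -
  have p: "1 < p" using q by simp
  obtain C where C: "\<And>f. f \<in> W1p R \<nu> p \<Longrightarrow> Lp_norm \<sigma> q (trace_op R \<nu> \<sigma> p f) \<le> C * W1p_norm R \<nu> p f"
    by (rule trace_op_bound[OF q]) (rule that)
  have "trace_op R \<nu> \<sigma> p f \<in> Lp \<sigma> q" if f: "f \<in> W1p R \<nu> p" for f
  proof -
    obtain \<phi> where \<phi>: "\<And>n. \<phi> n \<in> Cb1" "W1p_tendsto R \<nu> p \<phi> f" by (rule W1p_approx[OF p f]) (rule that)
    show ?thesis using trace_op_limit[OF q f \<phi>] by (simp add: Lp_tendsto_def)
  qed
  with C show ?thesis
    unfolding bounded_operator_W1p_Lq_def using trace_op_add[OF p] trace_op_scale[OF p] by blast
qed

text \<open>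
  Products of the approximating functions approximate the product in \<open>W\<^sup>1\<^sup>,\<^sup>s\<close>, where
  \<open>1 / s = 1 / p1 + 1 / p2\<close>. Along a common subsequence all three sequences converge
  \<open>\<sigma>\<close>-almost everywhere to the respective traces.
\<close>

lemma trace_op_mult:
  assumes p: "1 < p1" "1 < p2" "1 / p1 + 1 / p2 < 1"
    and f: "f \<in> W1p R \<nu> p1" and h: "h \<in> W1p R \<nu> p2"
  shows "AE x in \<sigma>. trace_op R \<nu> \<sigma> (1 / (1 / p1 + 1 / p2)) (\<lambda>y. f y * h y) x =
    trace_op R \<nu> \<sigma> p1 f x * trace_op R \<nu> \<sigma> p2 h x"
proof -
  define s where "s = 1 / (1 / p1 + 1 / p2)"
  have sum: "0 < 1 / p1 + 1 / p2" using p by (simp add: add_pos_pos)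
  have e: "0 < s" "0 < p1" "0 < p2" "1 / p1 + 1 / p2 = 1 / s" and s: "1 < s"
    using p sum by (auto simp: s_def)
  obtain \<phi> where \<phi>: "\<And>n. \<phi> n \<in> Cb1" "W1p_tendsto R \<nu> p1 \<phi> f" by (rule W1p_approx[OF p(1) f]) (rule that)
  obtain \<eta> where \<eta>: "\<And>n. \<eta> n \<in> Cb1" "W1p_tendsto R \<nu> p2 \<eta> h" by (rule W1p_approx[OF p(2) h]) (rule that)
  note \<phi>' = W1p_tendsto_iff[OF p(1) \<phi>(1) Mp_graph[OF f], THEN iffD1, OF \<phi>(2)]
  note \<eta>' = W1p_tendsto_iff[OF p(2) \<eta>(1) Mp_graph[OF h], THEN iffD1, OF \<eta>(2)]
  note m = M_graph_mult[OF e \<phi>(1) conjunct1[OF \<phi>'] conjunct2[OF \<phi>'] \<eta>(1) conjunct1[OF \<eta>'] conjunct2[OF \<eta>']]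
  note c = Cb1_mult(1)[OF \<phi>(1) \<eta>(1)]
  have W: "W1p_tendsto R \<nu> s (\<lambda>n x. \<phi> n x * \<eta> n x) (\<lambda>x. f x * h x)"
    using W1p_tendsto_iff[OF s c m(3)] m(1,2) by simp
  note fh = M_graph_W1p[OF m(3)]
  obtain k1 where k1: "strict_mono k1" "AE x in \<sigma>. (\<lambda>n. \<phi> (k1 n) x) \<longlonglongrightarrow> trace_op R \<nu> \<sigma> p1 f x"
    using Lp_tendsto_AE_subseq[OF zero_less_one trace_op_limit[OF order_refl p(1) f \<phi>]] by blast
  obtain k2 where k2: "strict_mono k2" "AE x in \<sigma>. (\<lambda>n. \<eta> (k1 (k2 n)) x) \<longlonglongrightarrow> trace_op R \<nu> \<sigma> p2 h x"
    by (rule trace_op_AE_subseq[OF p(2) h \<eta> k1(1)]) (rule that)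
  have k12: "strict_mono (\<lambda>n. k1 (k2 n))" using strict_mono_o[OF k1(1) k2(1)] by (simp add: o_def)
  obtain k3 where k3: "strict_mono k3"
    "AE x in \<sigma>. (\<lambda>n. \<phi> (k1 (k2 (k3 n))) x * \<eta> (k1 (k2 (k3 n))) x) \<longlonglongrightarrow> trace_op R \<nu> \<sigma> s (\<lambda>x. f x * h x) x"
    by (rule trace_op_AE_subseq[OF s fh c W k12]) (rule that)
  have "AE x in \<sigma>. trace_op R \<nu> \<sigma> s (\<lambda>x. f x * h x) x = trace_op R \<nu> \<sigma> p1 f x * trace_op R \<nu> \<sigma> p2 h x"
    using k1(2) k2(2) k3(2)
  proof eventually_elim
    case (elim x)
    have "(\<lambda>n. \<phi> (k1 (k2 (k3 n))) x) \<longlonglongrightarrow> trace_op R \<nu> \<sigma> p1 f x"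
      using LIMSEQ_subseq_LIMSEQ[OF elim(1) strict_mono_o[OF k2(1) k3(1)]] by (simp add: o_def)
    moreover have "(\<lambda>n. \<eta> (k1 (k2 (k3 n))) x) \<longlonglongrightarrow> trace_op R \<nu> \<sigma> p2 h x"
      using LIMSEQ_subseq_LIMSEQ[OF elim(2) k3(1)] by (simp add: o_def)
    ultimately have "(\<lambda>n. \<phi> (k1 (k2 (k3 n))) x * \<eta> (k1 (k2 (k3 n))) x) \<longlonglongrightarrow>
        trace_op R \<nu> \<sigma> p1 f x * trace_op R \<nu> \<sigma> p2 h x"
      by (rule tendsto_mult)
    with elim(3) show ?case by (rule LIMSEQ_unique)
  qed
  then show ?thesis by (simp add: s_def)
qed

text \<open>
  By the layer estimate for \<open>\<phi>\<^sub>n - f\<close> the difference quotients of the two level functions differ by a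
  multiple of the \<open>p\<close>-th root of its energy, uniformly in \<open>s\<close>, and the derivatives \<open>\<integral> \<phi>\<^sub>n d\<sigma>\<close> converge to the
  integral of the trace.
\<close>

lemma level_derivative_W1p:
  assumes p: "1 < p" and f: "f \<in> W1p R \<nu> p"
  shows "((\<lambda>s. LINT x:{x. g x \<le> s}|\<nu>. f x) has_real_derivative (\<integral>x. trace_op R \<nu> \<sigma> p f x \<partial>\<sigma>)) (at r)"
proof -
  have p0: "0 < p" using p by simp
  obtain K where K: "0 \<le> K" "\<And>f F c a b. (f, F) \<in> M_graph R \<nu> p \<Longrightarrow> 0 < c \<Longrightarrow>
     energy p f F < c powr p \<Longrightarrow> a < b \<Longrightarrow>
     (LINT x:{x. a < g x \<and> g x \<le> b}|\<nu>. \<bar>f x\<bar>) \<le> K * c * (b - a)"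
    by (rule layer_estimate_W1p[OF p]) (rule that)
  obtain \<phi> where \<phi>: "\<And>n. \<phi> n \<in> Cb1" "W1p_tendsto R \<nu> p \<phi> f" by (rule W1p_approx[OF p f]) (rule that)
  note \<phi>' = W1p_tendsto_iff[OF p \<phi>(1) Mp_graph[OF f], THEN iffD1, OF \<phi>(2)]
  let ?F = "Mp R \<nu> p f"
  define E where "E n = energy p (\<lambda>x. \<phi> n x - f x) (\<lambda>x. R (grad (\<phi> n) x) - ?F x)" for n
  have E: "E \<longlonglongrightarrow> 0" unfolding E_def using \<phi>' by (intro energy_diff_tendsto p0) auto
  \<comment> \<open>The additional null sequence makes c positive and the energy strictly less than its p-th power.\<close>
  define c where "c n = (E n + 1 / real (Suc n)) powr (1 / p)" for n
  have E0: "0 \<le> E n" for n by (simp add: E_def)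
  have pos: "0 < E n + 1 / real (Suc n)" for n using E0[of n] by (intro add_nonneg_pos) auto
  then have c: "0 < c n" for n unfolding c_def powr_gt_zero using less_imp_neq[OF pos[of n]] by simp
  have cp: "E n < c n powr p" for n using p0 pos[of n] by (simp add: c_def powr_powr)
  have "(\<lambda>n. E n + 1 / real (Suc n)) \<longlonglongrightarrow> 0 + 0"
    using LIMSEQ_Suc[OF lim_1_over_n] by (intro tendsto_add E) simp
  then have "c \<longlonglongrightarrow> 0 powr (1 / p)"
    unfolding c_def using pos p0 by (intro tendsto_powr2 always_eventually) (auto intro: less_imp_le)
  then have c0: "(\<lambda>n. K * c n) \<longlonglongrightarrow> 0" using tendsto_mult_right_zero by simp
  have L1: "\<phi> n \<in> Lp \<nu> p" "f \<in> Lp \<nu> p" for n using \<phi>' by (auto simp: Lp_tendsto_def)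
  have i: "integrable \<nu> (\<phi> n)" "integrable \<nu> f" for n
    using Lp_imp_integrable[OF L1(1)] Lp_imp_integrable[OF L1(2)] p by simp_all
  have iA: "integrable \<nu> (\<lambda>x. indicator {x. g x \<le> s} x *\<^sub>R h x)" if "integrable \<nu> h" for h :: "'a \<Rightarrow> real" and s
    by (rule integrable_mult_indicator[OF _ that]) simp
  let ?G = "\<lambda>h s. LINT x:{x. g x \<le> s}|\<nu>. (h x :: real)"
  have diff: "?G (\<lambda>x. \<phi> n x - f x) s = ?G (\<phi> n) s - ?G f s" for n s
    unfolding set_lebesgue_integral_def
      Bochner_Integration.integral_diff[OF iA[OF i(1)] iA[OF i(2)], symmetric]
    by (simp add: right_diff_distrib)
  show ?thesis
  proof (rule has_real_derivative_uniform_limit[where G="\<lambda>n. ?G (\<phi> n)", OF level_derivative_Cb[OF Cb1_Cb[OF \<phi>(1)]] _ c0])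
    show "(\<lambda>n. \<integral>x. \<phi> n x \<partial>\<sigma>) \<longlonglongrightarrow> (\<integral>x. trace_op R \<nu> \<sigma> p f x \<partial>\<sigma>)"
      by (rule Lp_tendsto_integral[OF trace_op_limit[OF order_refl p f \<phi>]])
    fix n s
    have g: "(\<lambda>x. \<phi> n x - f x, \<lambda>x. R (grad (\<phi> n) x) - ?F x) \<in> M_graph R \<nu> p"
      by (rule M_graph_diff[OF p0 M_graph_Cb1[OF \<phi>(1) p0] Mp_graph[OF f]])
    have "\<bar>?G (\<lambda>x. \<phi> n x - f x) s - ?G (\<lambda>x. \<phi> n x - f x) r\<bar> \<le> K * c n * \<bar>s - r\<bar>"
      by (rule level_integral_Lipschitz[OF Bochner_Integration.integrable_diff[OF i]
            K(2)[OF g c cp[unfolded E_def]]])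
    then show "\<bar>?G f s - ?G f r - (?G (\<phi> n) s - ?G (\<phi> n) r)\<bar> \<le> K * c n * \<bar>s - r\<bar>"
      unfolding diff by (simp add: abs_le_iff algebra_simps)
  qed
qed

end

section \<open>Capacity and quasicontinuity\<close>

context gradient_setting
begin

lemma W1p_norm_nonneg: "0 \<le> W1p_norm R \<nu> p f"
  by (simp add: W1p_norm_def Lp_norm_def)

lemma capacity_open_lessE:
  assumes "1 < p" "capacity_open R \<nu> p U < \<epsilon>"
  obtains f where "f \<in> W1p R \<nu> p" "AE x in \<nu>. indicator U x \<le> f x" "W1p_norm R \<nu> p f < \<epsilon>"
proof -
  let ?S = "{W1p_norm R \<nu> p f |f. f \<in> W1p R \<nu> p \<and> (AE x in \<nu>. indicator U x \<le> f x)}"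
  have "(\<lambda>x. 1) \<in> W1p R \<nu> p"
    using assms(1) by (intro M_graph_W1p[OF M_graph_Cb1[OF Cb1_const(1)]]) simp
  then have "W1p_norm R \<nu> p (\<lambda>x. 1) \<in> ?S" by (auto simp: indicator_le_1)
  then have "?S \<noteq> {}" by blast
  from cInf_lessD[OF this assms(2)[unfolded capacity_open_def]] show ?thesis using that by auto
qed

text \<open>
  The exceptional set can be taken empty, as the zero function shows that its capacity is 0.
\<close>

lemma quasicontinuous_continuous:
  assumes p: "1 < p" and "continuous_on UNIV f"
  shows "quasicontinuous R \<nu> p f"
proof -
  let ?S = "{W1p_norm R \<nu> p f |f. f \<in> W1p R \<nu> p \<and> (AE x in \<nu>. indicator {} x \<le> f x)}"
  have g: "(\<lambda>x. 0, \<lambda>x. 0) \<in> M_graph R \<nu> p"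
    using M_graph_Cb1[OF Cb1_const(1), of p 0] p bounded_linear.linear[OF bounded_linear_R]
    by (simp add: Cb1_const(2) linear_0)
  have "W1p_norm R \<nu> p (\<lambda>x. 0) = 0" using W1p_norm_eq[OF p g] p by simp
  moreover have "W1p_norm R \<nu> p (\<lambda>x. 0) \<in> ?S" using M_graph_W1p[OF g] by auto
  moreover have "bdd_below ?S" using W1p_norm_nonneg by (auto intro!: bdd_belowI[of _ 0])
  ultimately have "capacity_open R \<nu> p {} \<le> 0"
    unfolding capacity_open_def by (metis (no_types, lifting) cInf_lower)
  then show ?thesis
    unfolding quasicontinuous_def using assms(2) by (intro allI impI exI[of _ "{}"]) auto
qed

end

context surface_setting
begin

text \<open>
  Continuous functions approximate the indicator of an open set from below; they are dominated by \<open>w\<close>,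
  and so are their layer masses.
\<close>

lemma surface_measure_open_le:
  assumes G: "open G" and w: "integrable \<nu> w" "AE x in \<nu>. indicator G x \<le> w x"
    and L: "\<And>s. r < s \<Longrightarrow> (LINT x:{x. r < g x \<and> g x \<le> s}|\<nu>. w x) \<le> C * (s - r)"
  shows "measure \<sigma> G \<le> C"
proof -
  obtain \<rho> :: "nat \<Rightarrow> 'a \<Rightarrow> real" where \<rho>: "\<And>n. continuous_on UNIV (\<rho> n)" "\<And>n x. 0 \<le> \<rho> n x"
    "\<And>n x. \<rho> n x \<le> indicator G x" "\<And>x. (\<lambda>n. \<rho> n x) \<longlonglongrightarrow> indicator G x"
    by (rule open_indicator_approx[OF G]) (rule that)
  have le1: "\<bar>\<rho> n x\<bar> \<le> 1" for n x
    using \<rho>(2,3)[of n x] by (cases "x \<in> G") auto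
  have Cb: "\<rho> n \<in> Cb" for n using \<rho>(1) le1 by (auto simp: Cb_def bounded_iff)
  have [measurable]: "\<rho> n \<in> borel_measurable borel" for n using Cb_integrable(1)[OF Cb] .
  have [measurable]: "G \<in> sets borel" using G by simp
  have "(\<integral>x. \<rho> n x \<partial>\<sigma>) \<le> C" for n
  proof (rule surface_integral_le[OF Cb])
    fix s assume s: "r < s"
    have iA: "integrable \<nu> (\<lambda>x. indicator {x. r < g x \<and> g x \<le> s} x *\<^sub>R h x)" if "integrable \<nu> h" for h :: "'a \<Rightarrow> real"
      by (rule integrable_mult_indicator[OF _ that]) simp
    have "AE x in \<nu>. indicator {x. r < g x \<and> g x \<le> s} x *\<^sub>R \<rho> n x \<le> indicator {x. r < g x \<and> g x \<le> s} x *\<^sub>R w x"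
      using w(2)
    proof eventually_elim
      case (elim x)
      have "\<rho> n x \<le> w x" using \<rho>(3)[of n x] elim by linarith
      then show ?case by (simp add: indicator_def)
    qed
    then have "(LINT x:{x. r < g x \<and> g x \<le> s}|\<nu>. \<rho> n x) \<le> (LINT x:{x. r < g x \<and> g x \<le> s}|\<nu>. w x)"
      unfolding set_lebesgue_integral_def
      by (intro integral_mono_AE iA Cb_integrable(2)[OF Cb] w(1))
    also have "\<dots> \<le> C * (s - r)" by (rule L[OF s])
    finally show "(LINT x:{x. r < g x \<and> g x \<le> s}|\<nu>. \<rho> n x) \<le> C * (s - r)" .
  qed
  moreover have "(\<lambda>n. \<integral>x. \<rho> n x \<partial>\<sigma>) \<longlonglongrightarrow> (\<integral>x. indicator G x \<partial>\<sigma>)"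
    by (rule integral_dominated_convergence[where w="\<lambda>x. 1"]) (use \<rho>(4) le1 in auto)
  ultimately have "(\<integral>x. indicator G x \<partial>\<sigma>) \<le> C" by (intro LIMSEQ_le_const2) auto
  then show ?thesis by simp
qed

text \<open>
  Let \<open>U\<close> be an open set of capacity below \<open>\<epsilon>\<close> outside of which \<open>u\<close> is continuous. Then
  \<open>{\<bar>u - h\<bar> > \<kappa>} \<union> U\<close> is open, and almost everywhere its indicator is at most
  \<open>\<bar>v\<bar> + \<bar>h - f\<bar> / \<kappa>\<close>, where \<open>v\<close> is a competitor for the capacity of \<open>U\<close>. The layer estimate controls
  both summands. The set itself need not be measurable, which is why it is enclosed in an open \<open>G\<close>.
\<close>

lemma quasicontinuous_deviation_le:
  assumes p: "1 < p"
  obtains K where "0 \<le> K" "\<And>u f h c \<epsilon> \<kappa>. quasicontinuous R \<nu> p u \<Longrightarrow> f \<in> W1p R \<nu> p \<Longrightarrow>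
    AE x in \<nu>. u x = f x \<Longrightarrow> h \<in> Cb1 \<Longrightarrow> 0 < c \<Longrightarrow> 0 < \<epsilon> \<Longrightarrow> 0 < \<kappa> \<Longrightarrow>
    energy p (\<lambda>x. h x - f x) (\<lambda>x. R (grad h x) - Mp R \<nu> p f x) < c powr p \<Longrightarrow>
    \<exists>G. open G \<and> {x. \<kappa> < \<bar>u x - h x\<bar>} \<subseteq> G \<and> measure \<sigma> G \<le> K * (\<epsilon> + c / \<kappa>)"
proof -
  have p0: "0 < p" using p by simp
  obtain K where K: "0 \<le> K" "\<And>f F c a b. (f, F) \<in> M_graph R \<nu> p \<Longrightarrow> 0 < c \<Longrightarrow>
     energy p f F < c powr p \<Longrightarrow> a < b \<Longrightarrow>
     (LINT x:{x. a < g x \<and> g x \<le> b}|\<nu>. \<bar>f x\<bar>) \<le> K * c * (b - a)"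
    by (rule layer_estimate_W1p[OF p]) (rule that)
  have "\<exists>G. open G \<and> {x. \<kappa> < \<bar>u x - h x\<bar>} \<subseteq> G \<and> measure \<sigma> G \<le> 2 * K * (\<epsilon> + c / \<kappa>)"
    if u: "quasicontinuous R \<nu> p u" "f \<in> W1p R \<nu> p" "AE x in \<nu>. u x = f x" and h: "h \<in> Cb1"
      and pos: "0 < c" "0 < \<epsilon>" "0 < \<kappa>"
      and e: "energy p (\<lambda>x. h x - f x) (\<lambda>x. R (grad h x) - Mp R \<nu> p f x) < c powr p"
    for u f h c \<epsilon> \<kappa>
  proof -
    obtain U where U: "open U" "capacity_open R \<nu> p U < \<epsilon>" "continuous_on (- U) u"
      using u(1) pos(2) unfolding quasicontinuous_def by blast
    obtain v where v: "v \<in> W1p R \<nu> p" "AE x in \<nu>. indicator U x \<le> v x" "W1p_norm R \<nu> p v < \<epsilon>"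
      by (rule capacity_open_lessE[OF p U(2)]) (rule that)
    have ev: "energy p v (Mp R \<nu> p v) < (2 * \<epsilon>) powr p"
    proof -
      have "energy p v (Mp R \<nu> p v) \<le> (2 * W1p_norm R \<nu> p v) powr p"
        by (rule M_graph_mass_le[OF p Mp_graph[OF v(1)] order_refl])
      also have "\<dots> < (2 * \<epsilon>) powr p" using v(3) p0 W1p_norm_nonneg by (intro powr_less_mono2) auto
      finally show ?thesis .
    qed
    have "continuous_on (- U) (\<lambda>x. \<bar>u x - h x\<bar>)"
      using U(3) continuous_on_subset[OF Cb1_continuous[OF h]] by (intro continuous_intros) auto
    then have "openin (top_of_set (- U)) (- U \<inter> (\<lambda>x. \<bar>u x - h x\<bar>) -` {\<kappa><..})"
      by (rule continuous_openin_preimage_gen) simp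
    then obtain T where T: "open T" "- U \<inter> (\<lambda>x. \<bar>u x - h x\<bar>) -` {\<kappa><..} = - U \<inter> T"
      unfolding openin_open by blast
    have G: "open (U \<union> T)" "{x. \<kappa> < \<bar>u x - h x\<bar>} \<subseteq> U \<union> T" using U(1) T by auto
    define w where "w = (\<lambda>x. \<bar>v x\<bar> + (1 / \<kappa>) * \<bar>h x - f x\<bar>)"
    have g: "(\<lambda>x. h x - f x, \<lambda>x. R (grad h x) - Mp R \<nu> p f x) \<in> M_graph R \<nu> p"
      by (rule M_graph_diff[OF p0 M_graph_Cb1[OF h p0] Mp_graph[OF u(2)]])
    have i: "integrable \<nu> (\<lambda>x. \<bar>v x\<bar>)" "integrable \<nu> (\<lambda>x. \<bar>h x - f x\<bar>)"
      using Lp_imp_integrable[OF M_graph_Lp(1)[OF Mp_graph[OF v(1)]]] Lp_imp_integrable[OF M_graph_Lp(1)[OF g]] p by simp_all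
    have "AE x in \<nu>. indicator (U \<union> T) x \<le> w x"
      using v(2) u(3)
    proof eventually_elim
      case (elim x)
      show ?case
      proof (cases "x \<in> U")
        case True
        then have "1 \<le> v x" using elim by simp
        then show ?thesis using True pos by (simp add: w_def add_increasing2)
      next
        case False
        have "1 \<le> (1 / \<kappa>) * \<bar>h x - f x\<bar>" if "x \<in> T"
        proof -
          have "x \<in> - U \<inter> T" using that False by blast
          then have "\<kappa> < \<bar>u x - h x\<bar>" unfolding T(2)[symmetric] by simp
          then show ?thesis using elim pos by (simp add: abs_minus_commute)
        qed
        then show ?thesis using False pos by (auto simp: w_def indicator_def add_increasing)
      qed
    qed
    moreover have "(LINT x:{x. r < g x \<and> g x \<le> s}|\<nu>. w x) \<le> 2 * K * (\<epsilon> + c / \<kappa>) * (s - r)" if s: "r < s" for s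
    proof -
      let ?A = "{x. r < g x \<and> g x \<le> s}"
      have iA: "set_integrable \<nu> ?A k" if "integrable \<nu> k" for k :: "'a \<Rightarrow> real"
        unfolding set_integrable_def by (rule integrable_mult_indicator[OF _ that]) simp
      have "(LINT x:?A|\<nu>. w x) = (LINT x:?A|\<nu>. \<bar>v x\<bar>) + (1 / \<kappa>) * (LINT x:?A|\<nu>. \<bar>h x - f x\<bar>)"
        unfolding w_def using iA[OF i(1)] iA[OF integrable_mult_right[OF i(2), of "1 / \<kappa>"]]
        by (subst set_integral_add) auto
      also have "\<dots> \<le> K * (2 * \<epsilon>) * (s - r) + (1 / \<kappa>) * (K * c * (s - r))"
        using K(2)[OF Mp_graph[OF v(1)] _ ev s] K(2)[OF g pos(1) e s] pos
        by (intro add_mono mult_left_mono) auto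
      also have "\<dots> \<le> K * (2 * \<epsilon>) * (s - r) + 2 * ((1 / \<kappa>) * (K * c * (s - r)))"
      proof -
        have "0 \<le> (1 / \<kappa>) * (K * c * (s - r))" using K(1) pos s by simp
        then show ?thesis by linarith
      qed
      also have "K * (2 * \<epsilon>) * t + 2 * ((1 / \<kappa>) * (K * c * t)) = 2 * K * (\<epsilon> + c / \<kappa>) * t" for t
        by (simp add: algebra_simps)
      finally show ?thesis .
    qed
    moreover have "integrable \<nu> w" unfolding w_def using i by auto
    ultimately have "measure \<sigma> (U \<union> T) \<le> 2 * K * (\<epsilon> + c / \<kappa>)"
      by (intro surface_measure_open_le[OF G(1)])
    with G show ?thesis by blast
  qed
  moreover have "0 \<le> 2 * K" using K(1) by simp
  ultimately show ?thesis by (intro that)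
qed

text \<open>
  Along a sequence of smooth functions that converges fast enough the deviations of more than
  \<open>2\<^bsup>-j\<^esup>\<close> from \<open>u\<close> are covered by sets of measure at most \<open>2\<^bsup>-j\<^esup>\<close>; by the Borel-Cantelli lemma the sequence
  converges to \<open>u\<close> almost everywhere, and it converges to the trace as well.
\<close>

lemma trace_op_quasicontinuous:
  assumes p: "1 < p" and f: "f \<in> W1p R \<nu> p" and u: "quasicontinuous R \<nu> p u" "AE x in \<nu>. u x = f x"
  shows "AE x in \<sigma>. trace_op R \<nu> \<sigma> p f x = u x"
proof -
  have p0: "0 < p" using p by simp
  obtain K where K: "0 \<le> K" "\<And>u f h c \<epsilon> \<kappa>. quasicontinuous R \<nu> p u \<Longrightarrow> f \<in> W1p R \<nu> p \<Longrightarrow>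
    AE x in \<nu>. u x = f x \<Longrightarrow> h \<in> Cb1 \<Longrightarrow> 0 < c \<Longrightarrow> 0 < \<epsilon> \<Longrightarrow> 0 < \<kappa> \<Longrightarrow>
    energy p (\<lambda>x. h x - f x) (\<lambda>x. R (grad h x) - Mp R \<nu> p f x) < c powr p \<Longrightarrow>
    \<exists>G. open G \<and> {x. \<kappa> < \<bar>u x - h x\<bar>} \<subseteq> G \<and> measure \<sigma> G \<le> K * (\<epsilon> + c / \<kappa>)"
    by (rule quasicontinuous_deviation_le[OF p]) (rule that)
  obtain \<phi> where \<phi>: "\<And>n. \<phi> n \<in> Cb1" "W1p_tendsto R \<nu> p \<phi> f" by (rule W1p_approx[OF p f]) (rule that)
  note \<phi>' = W1p_tendsto_iff[OF p \<phi>(1) Mp_graph[OF f], THEN iffD1, OF \<phi>(2)]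
  obtain k where k: "strict_mono k" "AE x in \<sigma>. (\<lambda>n. \<phi> (k n) x) \<longlonglongrightarrow> trace_op R \<nu> \<sigma> p f x"
    using Lp_tendsto_AE_subseq[OF zero_less_one trace_op_limit[OF order_refl p f \<phi>]] by blast
  let ?E = "\<lambda>n. energy p (\<lambda>x. \<phi> n x - f x) (\<lambda>x. R (grad (\<phi> n) x) - Mp R \<nu> p f x)"
  have E: "?E \<longlonglongrightarrow> 0" using \<phi>' by (intro energy_diff_tendsto p0) auto
  have Ek: "(\<lambda>n. ?E (k n)) \<longlonglongrightarrow> 0" using LIMSEQ_subseq_LIMSEQ[OF E k(1)] by (simp add: o_def)
  have "\<exists>n G. j \<le> n \<and> open G \<and> {x. (1/2)^j < \<bar>u x - \<phi> (k n) x\<bar>} \<subseteq> G \<and> measure \<sigma> G \<le> (1/2)^j" for j :: nat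
  proof -
    \<comment> \<open>With these values the measure of the covering set is at most \<open>K (\<epsilon> + c / \<kappa>) = 2 K \<epsilon> \<le> \<kappa>\<close>.\<close>
    define \<kappa> \<epsilon> c :: real where "\<kappa> = (1/2)^j" and "\<epsilon> = \<kappa> / (2 * (K + 1))" and "c = \<kappa> * \<epsilon>"
    have pos: "0 < \<kappa>" "0 < \<epsilon>" "0 < c" using K(1) by (auto simp: \<kappa>_def \<epsilon>_def c_def)
    have "\<forall>\<^sub>F n in sequentially. ?E (k n) < c powr p"
      by (rule order_tendstoD(2)[OF Ek]) (use pos in simp)
    then have "\<forall>\<^sub>F n in sequentially. ?E (k n) < c powr p \<and> j \<le> n"
      using eventually_ge_at_top[of j] by eventually_elim simp
    then obtain n where n: "?E (k n) < c powr p" "j \<le> n"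
      using eventually_happens'[OF sequentially_bot] by blast
    obtain G where G: "open G" "{x. \<kappa> < \<bar>u x - \<phi> (k n) x\<bar>} \<subseteq> G" "measure \<sigma> G \<le> K * (\<epsilon> + c / \<kappa>)"
      using K(2)[OF u(1) f u(2) \<phi>(1) pos(3,2,1) n(1)] by blast
    have "K * (\<epsilon> + c / \<kappa>) = K * (2 * \<epsilon>)" using pos by (simp add: c_def)
    also have "\<dots> \<le> (K + 1) * (2 * \<epsilon>)" using pos by (intro mult_right_mono) auto
    also have "\<dots> = \<kappa>" using K(1) by (simp add: \<epsilon>_def field_simps)
    finally have "measure \<sigma> G \<le> \<kappa>" using G(3) by linarith
    then show ?thesis using n(2) G(1,2) unfolding \<kappa>_def by blast
  qed
  then obtain n G where nG: "\<And>j. j \<le> n j" "\<And>j. open (G j)"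
      "\<And>j. {x. (1/2)^j < \<bar>u x - \<phi> (k (n j)) x\<bar>} \<subseteq> G j" "\<And>j. measure \<sigma> (G j) \<le> (1/2)^j"
    by metis
  have "AE x in \<sigma>. \<forall>\<^sub>F j in sequentially. x \<in> space \<sigma> - G j"
  proof (rule borel_cantelli_AE1)
    show "G j \<in> sets \<sigma>" for j using nG(2)[of j] by simp
    show "summable (\<lambda>j. measure \<sigma> (G j))"
      by (rule summable_comparison_test'[of "\<lambda>j. (1/2)^j" 0]) (use nG(4) in \<open>auto intro: summable_geometric\<close>)
  qed (auto simp: sigma.emeasure_finite less_top[symmetric])
  with k(2) show ?thesis
  proof eventually_elim
    case (elim x)
    have "filterlim n at_top sequentially"
      using nG(1) by (intro filterlim_at_top_mono[OF filterlim_ident] always_eventually) auto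
    from filterlim_compose[OF elim(1) this]
    have 1: "(\<lambda>j. \<phi> (k (n j)) x) \<longlonglongrightarrow> trace_op R \<nu> \<sigma> p f x" .
    have "(\<lambda>j. u x - \<phi> (k (n j)) x) \<longlonglongrightarrow> 0"
    proof (rule Lim_null_comparison)
      show "\<forall>\<^sub>F j in sequentially. norm (u x - \<phi> (k (n j)) x) \<le> (1/2)^j"
        using elim(2)
      proof eventually_elim
        case (elim j)
        then have "\<not> (1/2)^j < \<bar>u x - \<phi> (k (n j)) x\<bar>" using nG(3)[of j] by blast
        then show ?case by simp
      qed
      show "(\<lambda>j. (1/2::real)^j) \<longlonglongrightarrow> 0" by (rule LIMSEQ_power_zero) simp
    qed
    from tendsto_diff[OF tendsto_const[of "u x"] this] have "(\<lambda>j. \<phi> (k (n j)) x) \<longlonglongrightarrow> u x" by simp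
    with 1 show ?case by (rule LIMSEQ_unique)
  qed
qed

end

section \<open>The trace theorem\<close>

theorem theorem4p4:
  fixes R :: "'a::{real_inner, banach, polish_space} \<Rightarrow> 'a"
    and \<nu> \<sigma> :: "'a measure" and g \<phi> :: "'a \<Rightarrow> real" and p r :: real
  assumes "\<nexists>B::'a set. finite B \<and> span B = UNIV"
    and "prob_space \<nu>" and "sets \<nu> = sets borel" and "nondegenerate \<nu>"
    and "bounded_linear R"
    and "\<And>p. p > 1 \<Longrightarrow> closable_grad R \<nu> p"
    and "g \<in> borel_measurable borel"
    and "\<And>p. p > 1 \<Longrightarrow> g \<in> W1p R \<nu> p"
    and "AE x in \<nu>. M_all R \<nu> g x \<noteq> 0"
    and "\<And>p. p > 1 \<Longrightarrow>
           (\<lambda>x. (1 / (norm (M_all R \<nu> g x))\<^sup>2) *\<^sub>R M_all R \<nu> g x) \<in> dom_Mp_adjoint R \<nu> p"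
    and "is_surface_measure \<nu> g r \<sigma>"
    and "p > 1" and "\<phi> \<in> W1p R \<nu> p"
  shows "(\<exists>\<psi>. is_trace R \<nu> \<sigma> p \<phi> \<psi> \<and>
            (\<forall>\<psi>'. is_trace R \<nu> \<sigma> p \<phi> \<psi>' \<longrightarrow> (AE x in \<sigma>. \<psi>' x = \<psi> x))) \<and>
    ((\<lambda>s. LINT x:{x. g x \<le> s}|\<nu>. \<phi> x) has_real_derivative
       (\<integral>x. trace_op R \<nu> \<sigma> p \<phi> x \<partial>\<sigma>)) (at r) \<and>
    (\<forall>q. 1 \<le> q \<and> q < p \<longrightarrow>
       (\<forall>\<phi>n. (\<forall>n. \<phi>n n \<in> Cb1) \<and> W1p_tendsto R \<nu> p \<phi>n \<phi> \<longrightarrow>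
          Lp_tendsto \<sigma> q \<phi>n (trace_op R \<nu> \<sigma> p \<phi>)) \<and>
       bounded_operator_W1p_Lq R \<nu> p \<sigma> q (trace_op R \<nu> \<sigma> p)) \<and>
    (\<forall>\<phi>'. quasicontinuous R \<nu> p \<phi>' \<and> (AE x in \<nu>. \<phi>' x = \<phi> x) \<longrightarrow>
       (AE x in \<sigma>. trace_op R \<nu> \<sigma> p \<phi> x = \<phi>' x)) \<and>
    (continuous_on UNIV \<phi> \<longrightarrow> (AE x in \<sigma>. trace_op R \<nu> \<sigma> p \<phi> x = \<phi> x)) \<and>
    (\<forall>p1 p2 \<phi>1 \<phi>2. p1 > 1 \<and> p2 > 1 \<and> 1 / p1 + 1 / p2 < 1 \<and>
         \<phi>1 \<in> W1p R \<nu> p1 \<and> \<phi>2 \<in> W1p R \<nu> p2 \<longrightarrow>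
       (AE x in \<sigma>. trace_op R \<nu> \<sigma> (1 / (1 / p1 + 1 / p2)) (\<lambda>y. \<phi>1 y * \<phi>2 y) x =
          trace_op R \<nu> \<sigma> p1 \<phi>1 x * trace_op R \<nu> \<sigma> p2 \<phi>2 x))"
proof -
  interpret surface_setting R \<nu> g r \<sigma>
    by (intro surface_setting.intro level_set_setting.intro gradient_setting.intro
        level_set_setting_axioms.intro surface_setting_axioms.intro; fact assms)
  show ?thesis
  proof (intro conjI)
    show "\<exists>\<psi>. is_trace R \<nu> \<sigma> p \<phi> \<psi> \<and>
        (\<forall>\<psi>'. is_trace R \<nu> \<sigma> p \<phi> \<psi>' \<longrightarrow> (AE x in \<sigma>. \<psi>' x = \<psi> x))"
      using trace_op_is_trace[OF assms(12,13)] trace_unique[OF assms(12,13)] by blast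
    show "((\<lambda>s. LINT x:{x. g x \<le> s}|\<nu>. \<phi> x) has_real_derivative (\<integral>x. trace_op R \<nu> \<sigma> p \<phi> x \<partial>\<sigma>)) (at r)"
      by (rule level_derivative_W1p[OF assms(12,13)])
    show "\<forall>q. 1 \<le> q \<and> q < p \<longrightarrow>
       (\<forall>\<phi>n. (\<forall>n. \<phi>n n \<in> Cb1) \<and> W1p_tendsto R \<nu> p \<phi>n \<phi> \<longrightarrow>
          Lp_tendsto \<sigma> q \<phi>n (trace_op R \<nu> \<sigma> p \<phi>)) \<and>
       bounded_operator_W1p_Lq R \<nu> p \<sigma> q (trace_op R \<nu> \<sigma> p)"
    proof (intro allI impI conjI)
      fix q assume q: "1 \<le> q \<and> q < p"
      then show "bounded_operator_W1p_Lq R \<nu> p \<sigma> q (trace_op R \<nu> \<sigma> p)"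
        by (intro trace_op_bounded_operator) auto
      fix \<phi>n assume "(\<forall>n. \<phi>n n \<in> Cb1) \<and> W1p_tendsto R \<nu> p \<phi>n \<phi>"
      with q show "Lp_tendsto \<sigma> q \<phi>n (trace_op R \<nu> \<sigma> p \<phi>)"
        by (intro trace_op_limit[OF _ _ assms(13)]) auto
    qed
    show "\<forall>\<phi>'. quasicontinuous R \<nu> p \<phi>' \<and> (AE x in \<nu>. \<phi>' x = \<phi> x) \<longrightarrow>
       (AE x in \<sigma>. trace_op R \<nu> \<sigma> p \<phi> x = \<phi>' x)"
      using trace_op_quasicontinuous[OF assms(12,13)] by simp
    show "continuous_on UNIV \<phi> \<longrightarrow> (AE x in \<sigma>. trace_op R \<nu> \<sigma> p \<phi> x = \<phi> x)"
      using trace_op_quasicontinuous[OF assms(12,13) quasicontinuous_continuous[OF assms(12)]] by simp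
    show "\<forall>p1 p2 \<phi>1 \<phi>2. p1 > 1 \<and> p2 > 1 \<and> 1 / p1 + 1 / p2 < 1 \<and>
         \<phi>1 \<in> W1p R \<nu> p1 \<and> \<phi>2 \<in> W1p R \<nu> p2 \<longrightarrow>
       (AE x in \<sigma>. trace_op R \<nu> \<sigma> (1 / (1 / p1 + 1 / p2)) (\<lambda>y. \<phi>1 y * \<phi>2 y) x =
          trace_op R \<nu> \<sigma> p1 \<phi>1 x * trace_op R \<nu> \<sigma> p2 \<phi>2 x)"
      by (intro allI impI trace_op_mult) auto
  qed
qed

end
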